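(* Let $F$ be an $r_0$-graph with $2\le\Delta(F)<|F|$ which is a spanning subgraph of a tight $r_0$-tree. Suppose there exists a constant $C_{r_0}$ such that $F$ is $(M_{r_0},\gamma_{r_0},\tau_{r_0})$-balanced, where $M_{r_0}(n)=C_{r_0}n^{r_0-1}$, $\gamma_{r_0}(n)=(\log n)^{C_{r_0}}$ and $\tau_{r_0}(n,m)=n^{r_0-\frac{1}{d_{r_0}(F)}}(\log n)^{C_{r_0}}$. Then for every $r\ge r_0$ there exist constants $c,C>0$ such that for every function $p=p(n)\in(0,1]$: (1) if $p\gg n^{-\frac{1}{d_r(F^{(r)})}}$, then a.a.s. $$\max\left\{c\,p\,n^{r-1},\ n^{r-\frac{1}{d_r(F^{(r)})}}(\log n)^{-C}\right\}\le \mathrm{ex}(G^r_{n,p},F^{(r)})\le \max\left\{C\,p\,n^{r-1},\ n^{r-\frac{1}{d_r(F^{(r)})}}(\log n)^{C}\right\};$$ (2) if $n^{-r}\ll p\ll n^{-\frac{1}{d_r(F^{(r)})}}$, then a.a.s. $\mathrm{ex}(G^r_{n,p},F^{(r)})=(1+o(1))\,p\binom{n}{r}$.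
   Context: An $r$-graph is a finite $r$-uniform hypergraph; $v(F)$ is its number of vertices, $|F|$ its number of edges, $\Delta(F)$ its maximum vertex degree. For $|F|\ge 2$, $d_r(F)=\max_{F'\subseteq F,\ |F'|\ge 2}\frac{|F'|-1}{v(F')-r}$. For an $r_0$-graph $F$ and $r\ge r_0$, the expansion $F^{(r)}$ is the $r$-graph obtained by inserting $r-r_0$ new vertices into each edge of $F$, all new vertices (over all edges) being distinct. An $r$-graph $T$ is a tight $r$-tree if its edges can be ordered as $h_1,\dots,h_t$ so that for every $i\ge 2$ there exist $v\in h_i$ and $1\le s\le i-1$ with $v\notin\bigcup_{j=1}^{i-1}h_j$ and $h_i\setminus\{v\}\subset h_s$. A spanning subgraph of $T$ is a subgraph with vertex set $V(T)$. For a hypergraph $\mathcal{H}$ and $S\subseteq V(\mathcal{H})$, $\deg_{\mathcal{H}}(S)$ is the number of edges of $\mathcal{H}$ containing $S$, and $\Delta_i(\mathcal{H})=\max\{\deg_{\mathcal{H}}(S): S\subseteq V(\mathcal{H}),|S|=i\}$. Given positive functions $M=M(n)$, $\gamma=\gamma(n)$, $\tau=\tau(n,m)$, an $r$-graph $F$ is $(M,\gamma,\tau)$-balanced if for every $n$-vertex $m$-edge $r$-graph $H$ with $n$ sufficiently large and $m\ge M(n)$, there exists a non-empty collection $\mathcal{H}$ of copies of $F$ in $H$ (viewed as an $|F|$-uniform hypergraph on vertex set $E(H)$) such that for all integers $1\le i\le |F|$, $\Delta_i(\mathcal{H})\le \frac{\gamma(n)|\mathcal{H}|}{m}\left(\frac{\tau(n,m)}{m}\right)^{i-1}$.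 $G^r_{n,p}$ is the random $r$-graph on $n$ vertices in which each $r$-set is an edge independently with probability $p$. $\mathrm{ex}(G^r_{n,p},F)$ is the maximum number of edges in an $F$-free subgraph of $G^r_{n,p}$. Events $A_n$ hold a.a.s. if $\Pr[A_n]\to1$ as $n\to\infty$. $f(n)\ll g(n)$ (equivalently $g\gg f$) means $f(n)/g(n)\to0$. *)

theory Defs
  imports "HOL-Probability.Probability"
begin

text \<open>A hypergraph is a pair of a vertex set and an edge set; isolated vertices are allowed.\<close>

type_synonym 'a hypergraph = "'a set \<times> 'a set set"

abbreviation verts :: "'a hypergraph \<Rightarrow> 'a set" where "verts \<equiv> fst"
abbreviation edges :: "'a hypergraph \<Rightarrow> 'a set set" where "edges \<equiv> snd"

definition r_graph :: "nat \<Rightarrow> 'a hypergraph \<Rightarrow> bool" where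
  "r_graph r F \<longleftrightarrow> finite (verts F) \<and> (\<forall>e\<in>edges F. e \<subseteq> verts F \<and> card e = r)"

definition subgraph :: "'a hypergraph \<Rightarrow> 'a hypergraph \<Rightarrow> bool" where
  "subgraph F' F \<longleftrightarrow> verts F' \<subseteq> verts F \<and> edges F' \<subseteq> edges F \<and> (\<forall>e\<in>edges F'. e \<subseteq> verts F')"

definition spanning_subgraph :: "'a hypergraph \<Rightarrow> 'a hypergraph \<Rightarrow> bool" where
  "spanning_subgraph F T \<longleftrightarrow> subgraph F T \<and> verts F = verts T"

definition isomorphic :: "'a hypergraph \<Rightarrow> 'b hypergraph \<Rightarrow> bool" where
  "isomorphic F G \<longleftrightarrow> (\<exists>f. bij_betw f (verts F) (verts G) \<and> edges G = (\<lambda>e. f ` e) ` edges F)"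

definition copies :: "'a hypergraph \<Rightarrow> 'b hypergraph \<Rightarrow> 'b hypergraph set" where
  "copies F H = {F'. subgraph F' H \<and> isomorphic F F'}"

definition is_free :: "'a hypergraph \<Rightarrow> 'b hypergraph \<Rightarrow> bool" where
  "is_free F H \<longleftrightarrow> copies F H = {}"

definition set_degree :: "'a hypergraph \<Rightarrow> 'a set \<Rightarrow> nat" where
  "set_degree H S = card {e \<in> edges H. S \<subseteq> e}"

definition max_set_degree :: "nat \<Rightarrow> 'a hypergraph \<Rightarrow> nat" where
  "max_set_degree i H = Max {set_degree H S | S. S \<subseteq> verts H \<and> card S = i}"

definition max_degree :: "'a hypergraph \<Rightarrow> nat" where
  "max_degree H = Max {card {e \<in> edges H. v \<in> e} | v. v \<in> verts H}"

text \<open>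
  For an \<open>r\<close>-graph the denominator is positive, since two distinct \<open>r\<close>-sets span more than
  \<open>r\<close> vertices.
\<close>

definition r_density :: "nat \<Rightarrow> 'a hypergraph \<Rightarrow> real" where
  "r_density r F =
     Max {(real (card (edges F')) - 1) / (real (card (verts F')) - real r) | F'.
            subgraph F' F \<and> card (edges F') \<ge> 2}"

text \<open>
  The expansion of an \<open>r0\<close>-graph: the old vertices are tagged by \<open>Inl\<close>, and the
  \<open>r - r0\<close> new vertices belonging to the edge \<open>e\<close> are the \<open>Inr (e, j)\<close>.
\<close>

definition expansion ::
    "nat \<Rightarrow> nat \<Rightarrow> 'a hypergraph \<Rightarrow> ('a + 'a set \<times> nat) hypergraph" where
  "expansion r0 r F =
     (Inl ` verts F \<union> Inr ` (edges F \<times> {..<r - r0}),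
      (\<lambda>e. Inl ` e \<union> Inr ` ({e} \<times> {..<r - r0})) ` edges F)"

definition tight_tree :: "nat \<Rightarrow> 'a hypergraph \<Rightarrow> bool" where
  "tight_tree r T \<longleftrightarrow> r_graph r T \<and>
     (\<exists>h. distinct h \<and> set h = edges T \<and>
       (\<forall>i. 1 \<le> i \<and> i < length h \<longrightarrow>
         (\<exists>v\<in>h ! i. \<exists>s<i. v \<notin> (\<Union>j<i. h ! j) \<and> h ! i - {v} \<subseteq> h ! s)))"

text \<open>
  A collection \<open>\<H>\<close> of copies of \<open>F\<close> is given by the edge sets of the copies, and
  \<open>(edges H, \<H>)\<close> is the corresponding hypergraph on the vertex set \<open>edges H\<close>.
  The host graphs have natural numbers as vertices, which covers all finite graphs up to
  isomorphism.
\<close>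

definition balanced ::
    "nat \<Rightarrow> 'a hypergraph \<Rightarrow> (nat \<Rightarrow> real) \<Rightarrow> (nat \<Rightarrow> real) \<Rightarrow> (nat \<Rightarrow> nat \<Rightarrow> real) \<Rightarrow> bool" where
  "balanced r F M \<gamma> \<tau> \<longleftrightarrow>
     (\<forall>\<^sub>F n in sequentially. \<forall>m. \<forall>H :: nat hypergraph.
        r_graph r H \<and> card (verts H) = n \<and> card (edges H) = m \<and> real m \<ge> M n \<longrightarrow>
        (\<exists>\<H>. \<H> \<subseteq> edges ` copies F H \<and> \<H> \<noteq> {} \<and>
          (\<forall>i. 1 \<le> i \<and> i \<le> card (edges F) \<longrightarrow>
             real (max_set_degree i (edges H, \<H>))
               \<le> \<gamma> n * real (card \<H>) / real m * (\<tau> n m / real m) ^ (i - 1))))"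

definition r_subsets :: "nat \<Rightarrow> nat \<Rightarrow> nat set set" where
  "r_subsets r n = {e. e \<subseteq> {..<n} \<and> card e = r}"

definition random_r_graph :: "nat \<Rightarrow> nat \<Rightarrow> real \<Rightarrow> nat hypergraph pmf" where
  "random_r_graph r n p =
     map_pmf (\<lambda>f. ({..<n}, {e \<in> r_subsets r n. f e}))
       (Pi_pmf (r_subsets r n) False (\<lambda>_. bernoulli_pmf p))"

definition ex_number :: "'b hypergraph \<Rightarrow> 'a hypergraph \<Rightarrow> nat" where
  "ex_number G F = Max {card (edges G') | G'. subgraph G' G \<and> is_free F G'}"

definition aas :: "(nat \<Rightarrow> 'b pmf) \<Rightarrow> (nat \<Rightarrow> 'b \<Rightarrow> bool) \<Rightarrow> bool" where
  "aas P A \<longleftrightarrow> (\<lambda>n. measure_pmf.prob (P n) {x. A n x}) \<longlonglongrightarrow> 1"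

definition much_less :: "(nat \<Rightarrow> real) \<Rightarrow> (nat \<Rightarrow> real) \<Rightarrow> bool" where
  "much_less f g \<longleftrightarrow> (\<lambda>n. f n / g n) \<longlonglongrightarrow> 0"

end

theory Submission
  imports Defs "HOL-Real_Asymp.Real_Asymp"
begin

text \<open>
  Lower bounds: the edges through one vertex contain no copy of \<open>F\<^sup>(\<^sup>r\<^sup>)\<close>, since no vertex lies in
  all its edges; and deleting an edge from every copy of the densest subgraph of \<open>F\<^sup>(\<^sup>r\<^sup>)\<close> in a suitably
  sparsified random graph loses few edges.

  Upper bound: balancedness passes from uniformity \<open>k\<close> to \<open>k + 1\<close>. Assign each edge \<open>e\<close> to the
  \<open>k\<close>-set \<open>e - {Max e}\<close>, pass to the \<open>k\<close>-sets with at least \<open>q\<close> assigned edges for a suitable \<open>q\<close>,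
  take a balanced collection of copies there, and extend every edge of every copy in equally many
  ways. The parameter \<open>\<tau>\<close> changes only by a power of \<open>log n\<close>, which matches
  \<open>r - 1 / d\<^sub>r(F\<^sup>(\<^sup>r\<^sup>)) \<ge> r\<^sub>0 - 1 / d\<^sub>r\<^sub>0(F)\<close>. Balanced collections give containers for free graphs: at most
  \<open>exp (n\<^sup>a (log n)\<^sup>D)\<close> of them, each with \<open>O(n\<^sup>r\<^sup>-\<^sup>1)\<close> edges. As this number is at most \<open>exp M\<close> when
  \<open>M\<close> is the claimed bound, a union bound over all containers suffices, without any fingerprints
  inside the free graph.
\<close>

section \<open>Containers for weighted hypergraphs\<close>

text \<open>Write \<open>a = r - 1 / d\<close> with \<open>d\<close> the density of the expansion.
  At edge probability \<open>n powr (- 1 / d)\<close> the expected copies of the densest subgraph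
  and the expected edges both have order at most \<open>n powr a\<close>, so deletion stops paying
  there. Two edges sharing a vertex force \<open>1 / d \<le> r - 1\<close>, hence
  \<open>a \<ge> 1\<close>: in the denser range the star has an unbounded expected number of edges,
  and a failure probability \<open>exp (- n powr a)\<close> vanishes.

  The obstacle in the lift is irregularity: the \<open>k\<close>-sets below an edge set may have
  degrees of every order up to \<open>n\<close>, but all edges must be extended in equally many
  ways. Extending in exactly \<open>q\<close> ways divides the relative degree of an
  \<open>i\<close>-set of edges by \<open>q ^ i\<close>, which turns \<open>card A\<close> into
  \<open>q * card A\<close> in every factor of the degree bound. So \<open>\<tau>\<close> keeps its
  power of \<open>n\<close> for any \<open>q\<close>, provided \<open>q * card A\<close> is at least
  \<open>card E\<close> up to a logarithm.

  Each container step shrinks the container only by one part in a power of \<open>log n\<close>, but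
  then a power of \<open>log n\<close> many rounds suffice, which is harmless in the exponent of the
  number of containers.\<close>

definition wdeg :: "'a set \<Rightarrow> ('a set \<Rightarrow> real) \<Rightarrow> 'a set \<Rightarrow> real" where
  "wdeg U w T = (\<Sum>e | e \<subseteq> U \<and> T \<subseteq> e. w e)"

text \<open>Weights replace edge sets because links of several vertices are added up, so that an
  edge may count more than once.\<close>

definition weighted :: "nat \<Rightarrow> 'a set \<Rightarrow> ('a set \<Rightarrow> real) \<Rightarrow> bool" where
  "weighted l U w \<longleftrightarrow> (\<forall>e. w e \<ge> 0) \<and> (\<forall>e. w e \<noteq> 0 \<longrightarrow> e \<subseteq> U \<and> card e = l)"

text \<open>\<open>P\<close> stays abstract: it is independence for a weight function in the
  container proof and freeness for graphs afterwards.\<close>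

definition covered_by :: "'a set \<Rightarrow> ('a set \<Rightarrow> bool) \<Rightarrow> nat \<Rightarrow> real \<Rightarrow> bool" where
  "covered_by U P Q s \<longleftrightarrow> (\<exists>\<C>. finite \<C> \<and> card \<C> \<le> Q \<and>
     (\<forall>C\<in>\<C>. C \<subseteq> U \<and> real (card C) \<le> s) \<and> (\<forall>I\<subseteq>U. P I \<longrightarrow> (\<exists>C\<in>\<C>. I \<subseteq> C)))"

lemma covered_by_mono:
  assumes "covered_by U P Q s" "\<And>I. I \<subseteq> U \<Longrightarrow> P' I \<Longrightarrow> P I" "Q \<le> Q'" "s \<le> s'"
  shows "covered_by U P' Q' s'"
proof -
  obtain \<C> where "finite \<C>" "card \<C> \<le> Q" "\<forall>C\<in>\<C>. C \<subseteq> U \<and> real (card C) \<le> s"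
    "\<forall>I\<subseteq>U. P I \<longrightarrow> (\<exists>C\<in>\<C>. I \<subseteq> C)"
    using assms(1) unfolding covered_by_def by blast
  then show ?thesis unfolding covered_by_def using assms(2-)
    by (intro exI[of _ \<C>]) (meson order_trans)
qed

lemma wdeg_nonneg: "(\<And>e. w e \<ge> 0) \<Longrightarrow> wdeg U w T \<ge> 0"
  unfolding wdeg_def by (simp add: sum_nonneg)

lemma wdeg_mono: "(\<And>e. w e \<le> w' e) \<Longrightarrow> wdeg U w T \<le> wdeg U w' T"
  unfolding wdeg_def by (simp add: sum_mono)

lemma wdeg_empty: "wdeg U w {} = (\<Sum>e\<in>Pow U. w e)"
  unfolding wdeg_def by (rule sum.cong) auto

lemma wdeg_eq_sum_if: "finite U \<Longrightarrow> wdeg U w T = (\<Sum>e\<in>Pow U. if T \<subseteq> e then w e else 0)"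
  unfolding wdeg_def by (subst sum.inter_filter[symmetric]) (auto intro!: sum.cong)

text \<open>Double counting: an edge of nonzero weight has exactly \<open>2 ^ l\<close> subsets
  \<open>T\<close>. The sum over saturated sets is later bounded by this sum over all sets.\<close>

lemma sum_wdeg:
  assumes "finite U" "weighted l U w"
  shows "(\<Sum>T\<in>Pow U. wdeg U w T) = 2 ^ l * wdeg U w {}"
proof -
  have "(\<Sum>T\<in>Pow U. wdeg U w T) = (\<Sum>e\<in>Pow U. \<Sum>T\<in>Pow U. if T \<subseteq> e then w e else 0)"
    unfolding wdeg_eq_sum_if[OF assms(1)] by (rule sum.swap)
  also have "\<dots> = (\<Sum>e\<in>Pow U. 2 ^ l * w e)"
  proof (rule sum.cong)
    fix e assume e: "e \<in> Pow U"
    have "(\<Sum>T\<in>Pow U. if T \<subseteq> e then w e else 0) = (\<Sum>T\<in>Pow e. w e)"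
      by (rule sum.mono_neutral_cong_right) (use e assms(1) in auto)
    also have "\<dots> = 2 ^ card e * w e"
      using e assms(1) by (simp add: card_Pow finite_subset) 
    also have "\<dots> = 2 ^ l * w e"
      using assms(2) unfolding weighted_def by (cases "w e = 0") auto
    finally show "(\<Sum>T\<in>Pow U. if T \<subseteq> e then w e else 0) = 2 ^ l * w e" .
  qed auto
  finally show ?thesis by (simp add: wdeg_empty sum_distrib_left)
qed

lemma sum_wdeg_singleton:
  assumes "finite U" "weighted l U w"
  shows "(\<Sum>v\<in>U. wdeg U w {v}) = real l * wdeg U w {}"
proof -
  have "(\<Sum>v\<in>U. wdeg U w {v}) = (\<Sum>e\<in>Pow U. \<Sum>v\<in>U. if v \<in> e then w e else 0)"
    unfolding wdeg_eq_sum_if[OF assms(1)] by (subst sum.swap) simp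
  also have "\<dots> = (\<Sum>e\<in>Pow U. real l * w e)"
  proof (rule sum.cong)
    fix e assume e: "e \<in> Pow U"
    have "(\<Sum>v\<in>U. if v \<in> e then w e else 0) = (\<Sum>v\<in>e. w e)"
      by (rule sum.mono_neutral_cong_right) (use e assms(1) in auto)
    also have "\<dots> = real l * w e"
      using assms(2) unfolding weighted_def by (cases "w e = 0") auto
    finally show "(\<Sum>v\<in>U. if v \<in> e then w e else 0) = real l * w e" .
  qed auto
  finally show ?thesis by (simp add: wdeg_empty sum_distrib_left)
qed

text \<open>The weight function on the left is the link of \<open>v\<close>; \<open>insert v\<close>
  matches the sets avoiding \<open>v\<close> with those containing it.\<close>

lemma wdeg_link:
  assumes "finite U" "v \<in> U"
  shows "wdeg U (\<lambda>e. if v \<in> e then 0 else g (insert v e)) T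
           = (if v \<in> T then 0 else wdeg U g (insert v T))"
proof (cases "v \<in> T")
  case True
  then show ?thesis unfolding wdeg_def by (auto intro!: sum.neutral)
next
  case False
  have "wdeg U (\<lambda>e. if v \<in> e then 0 else g (insert v e)) T
      = (\<Sum>e | e \<subseteq> U \<and> T \<subseteq> e \<and> v \<notin> e. g (insert v e))"
    unfolding wdeg_def by (rule sum.mono_neutral_cong_right) (auto simp: assms)
  also have "\<dots> = (\<Sum>e | e \<subseteq> U \<and> insert v T \<subseteq> e. g e)"
    by (rule sum.reindex_bij_witness[of _ "\<lambda>e. e - {v}" "insert v"])
       (use False assms in \<open>auto simp: insert_absorb\<close>)
  finally show ?thesis using False by (simp add: wdeg_def)
qed

text \<open>
  One step lowers the uniformity: given a set \<open>I\<close> independent for \<open>w\<close>, vertices of \<open>I\<close> that are still of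
  high degree are selected one after the other, and their links, of which \<open>I\<close> is independent as
  well, are added up to a weight function \<open>u\<close>. As soon as \<open>u\<close> is too heavy on some set \<open>T\<close>, the edges
  containing \<open>T\<close> are dropped from \<open>w\<close>, which keeps the codegrees of \<open>u\<close> bounded. If no vertex of high
  degree is left in \<open>I\<close>, then \<open>I\<close> lies in the set of vertices of low degree; after \<open>b\<close> selections \<open>u\<close> is
  heavy enough for the induction hypothesis. The selections are recorded as a sequence with
  possible repetitions, so no canonical order on \<open>U\<close> is needed.
\<close>

locale link_accumulation =
  fixes l b :: nat and U :: "'a set" and w :: "'a set \<Rightarrow> real" and K :: real
  assumes fin: "finite U" and b: "b \<ge> 1" and K: "K \<ge> 1"
    and weighted: "weighted (Suc l) U w" and W_pos: "wdeg U w {} > 0"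
    and codegree: "\<And>T. T \<noteq> {} \<Longrightarrow>
      wdeg U w T \<le> K * wdeg U w {} / card U * (real b / card U) ^ (card T - 1)"
begin

definition "D = wdeg U w {} / card U"
definition "\<beta> = real b / card U"
text \<open>With this \<open>\<sigma>\<close>, dropping the edges over saturated sets costs at most half of the weight.\<close>

definition "\<sigma> = 2 ^ (l + 1) * K ^ 2"

definition saturated :: "('a set \<Rightarrow> real) \<Rightarrow> 'a set \<Rightarrow> bool" where
  "saturated u T \<longleftrightarrow> T \<noteq> {} \<and> wdeg U u T > \<sigma> * D * \<beta> ^ card T"

definition rest :: "('a set \<Rightarrow> real) \<Rightarrow> 'a set \<Rightarrow> real" where
  "rest u e = (if \<exists>T\<subseteq>e. saturated u T then 0 else w e)"

definition add_link :: "('a set \<Rightarrow> real) \<Rightarrow> 'a \<Rightarrow> 'a set \<Rightarrow> real" where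
  "add_link u v e = u e + (if v \<in> e then 0 else rest u (insert v e))"

text \<open>Invariant after \<open>i\<close> selections. Each selected vertex contributes between
  \<open>D / 4\<close> and \<open>K * D\<close> to the total. The codegree bound exceeds the
  saturation threshold by \<open>K * D * \<beta> ^ card T\<close>, the most that a single link can
  add to a set not yet saturated.\<close>

definition state :: "nat \<Rightarrow> ('a set \<Rightarrow> real) \<Rightarrow> bool" where
  "state i u \<longleftrightarrow> weighted l U u \<and> real i * D / 4 \<le> wdeg U u {} \<and> wdeg U u {} \<le> real i * (K * D) \<and>
     (\<forall>T. T \<noteq> {} \<longrightarrow> wdeg U u T \<le> (\<sigma> + K) * D * \<beta> ^ card T)"

lemma U_nonempty: "U \<noteq> {}"
proof
  assume "U = {}"
  moreover have "w {} = 0" using weighted unfolding weighted_def by (metis card.empty nat.distinct(1))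
  ultimately show False using W_pos by (simp add: wdeg_def)
qed

lemma card_U_pos: "real (card U) > 0"
  using U_nonempty fin by (simp add: card_gt_0_iff)

lemma D_pos: "D > 0" unfolding D_def using W_pos card_U_pos by simp

lemma \<beta>_pos: "\<beta> > 0" unfolding \<beta>_def using b card_U_pos by simp

lemma \<sigma>_pos: "\<sigma> > 0" unfolding \<sigma>_def using K by simp

lemma wdeg_total: "wdeg U w {} = D * card U"
  unfolding D_def using card_U_pos by simp

lemma codegree': "T \<noteq> {} \<Longrightarrow> wdeg U w T \<le> K * D * \<beta> ^ (card T - 1)"
  using codegree[of T] unfolding D_def \<beta>_def by simp

lemma w_nonneg: "w e \<ge> 0"
  using weighted unfolding weighted_def by blast

lemma rest_le: "rest u e \<le> w e" and rest_nonneg: "rest u e \<ge> 0"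
  unfolding rest_def by (auto simp: w_nonneg)

lemma weighted_rest: "weighted (Suc l) U (rest u)"
  using weighted unfolding weighted_def rest_def by auto

lemma state_0: "state 0 (\<lambda>_. 0)"
  unfolding state_def weighted_def wdeg_def using \<sigma>_pos K D_pos \<beta>_pos by simp

text \<open>Every dropped edge lies over a saturated \<open>T\<close>. There
  \<open>wdeg U w T\<close> is at most \<open>K / (\<sigma> * \<beta>)\<close> times
  \<open>wdeg U u T\<close>, and the sum of the latter over all \<open>T\<close> is
  \<open>2 ^ l\<close> times the total of \<open>u\<close>, itself at most
  \<open>b * K * D\<close>.\<close>

lemma rest_total:
  assumes u: "state i u" and i: "i \<le> b"
  shows "wdeg U (rest u) {} \<ge> D * card U / 2"
proof -
  have wu: "weighted l U u" and tot: "wdeg U u {} \<le> real i * (K * D)"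
    using u unfolding state_def by auto
  have u0: "u e \<ge> 0" for e using wu unfolding weighted_def by blast
  let ?sat = "{T. T \<subseteq> U \<and> saturated u T}"
  have finsat: "finite ?sat" by (rule finite_subset[of _ "Pow U"]) (use fin in auto)
  have "wdeg U w {} - wdeg U (rest u) {} = (\<Sum>e\<in>Pow U. w e - rest u e)"
    by (simp add: wdeg_empty sum_subtractf)
  also have "\<dots> \<le> (\<Sum>e\<in>Pow U. \<Sum>T\<in>?sat. if T \<subseteq> e then w e else 0)"
  proof (rule sum_mono)
    fix e assume e: "e \<in> Pow U"
    show "w e - rest u e \<le> (\<Sum>T\<in>?sat. if T \<subseteq> e then w e else 0)"
    proof (cases "\<exists>T\<subseteq>e. saturated u T")
      case True
      then obtain T where T: "T \<subseteq> e" "saturated u T" by blast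
      then have "T \<in> ?sat" using e by auto
      then have "(if T \<subseteq> e then w e else 0) \<le> (\<Sum>T\<in>?sat. if T \<subseteq> e then w e else 0)"
        using finsat by (intro member_le_sum) (auto simp: w_nonneg)
      then show ?thesis using T rest_nonneg[of u e] by simp
    next
      case False
      then have "rest u e = w e" unfolding rest_def by meson
      then show ?thesis by (simp add: sum_nonneg w_nonneg)
    qed
  qed
  also have "\<dots> = (\<Sum>T\<in>?sat. wdeg U w T)"
    unfolding wdeg_eq_sum_if[OF fin] by (rule sum.swap)
  also have "\<dots> \<le> (\<Sum>T\<in>?sat. K / (\<sigma> * \<beta>) * wdeg U u T)"
  proof (rule sum_mono)
    fix T assume "T \<in> ?sat"
    then have T: "T \<noteq> {}" "T \<subseteq> U" and sat: "wdeg U u T \<ge> \<sigma> * D * \<beta> ^ card T"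
      unfolding saturated_def by auto
    then have "card T > 0" using fin by (meson card_gt_0_iff finite_subset)
    then have \<beta>: "\<beta> ^ card T = \<beta> * \<beta> ^ (card T - 1)" by (metis power_eq_if not_gr_zero)
    have "wdeg U w T \<le> K * D * \<beta> ^ (card T - 1)" by (rule codegree'[OF T(1)])
    also have "\<dots> = K / (\<sigma> * \<beta>) * (\<sigma> * D * \<beta> ^ card T)"
      using \<sigma>_pos \<beta>_pos unfolding \<beta> by simp
    also have "\<dots> \<le> K / (\<sigma> * \<beta>) * wdeg U u T"
      using sat K \<sigma>_pos \<beta>_pos by (intro mult_left_mono) auto
    finally show "wdeg U w T \<le> K / (\<sigma> * \<beta>) * wdeg U u T" .
  qed
  also have "\<dots> \<le> (\<Sum>T\<in>Pow U. K / (\<sigma> * \<beta>) * wdeg U u T)"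
    using K \<sigma>_pos \<beta>_pos fin
    by (intro sum_mono2 mult_nonneg_nonneg[OF _ wdeg_nonneg[OF u0]]) auto
  also have "\<dots> = K / (\<sigma> * \<beta>) * (2 ^ l * wdeg U u {})"
    unfolding sum_distrib_left[symmetric] sum_wdeg[OF fin wu] ..
  also have "\<dots> \<le> K / (\<sigma> * \<beta>) * (2 ^ l * (real b * (K * D)))"
  proof -
    have "wdeg U u {} \<le> real b * (K * D)"
      using tot i K D_pos by (meson order_trans mult_right_mono of_nat_le_iff mult_nonneg_nonneg less_imp_le zero_le_one)
    then show ?thesis using K \<sigma>_pos \<beta>_pos by (intro mult_left_mono) auto
  qed
  also have "\<dots> = D * card U / 2"
    using K b card_U_pos unfolding \<sigma>_def \<beta>_def by (simp add: field_simps power2_eq_square)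
  finally show ?thesis unfolding wdeg_total by argo
qed

lemma wdeg_add_link:
  assumes "v \<in> U"
  shows "wdeg U (add_link u v) T = wdeg U u T + (if v \<in> T then 0 else wdeg U (rest u) (insert v T))"
  unfolding wdeg_link[OF fin assms, symmetric] unfolding add_link_def wdeg_def by (simp add: sum.distrib)

lemma state_add_link:
  assumes u: "state i u" and v: "v \<in> U" and big: "wdeg U (rest u) {v} \<ge> D / 4"
  shows "state (Suc i) (add_link u v)"
  unfolding state_def
proof (intro conjI allI impI)
  have wu: "weighted l U u" using u unfolding state_def by auto
  show "weighted l U (add_link u v)"
    unfolding weighted_def
  proof (rule conjI; intro allI impI)
    show "0 \<le> add_link u v e" for e
      using wu rest_nonneg unfolding add_link_def weighted_def by auto
    fix e assume ne: "add_link u v e \<noteq> 0"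
    show "e \<subseteq> U \<and> card e = l"
    proof (cases "u e = 0")
      case True
      then have e: "v \<notin> e" "rest u (insert v e) \<noteq> 0"
        using ne unfolding add_link_def by (auto split: if_splits)
      then have "insert v e \<subseteq> U" "card (insert v e) = Suc l"
        using weighted_rest unfolding weighted_def by blast+
      moreover from this have "finite e" using fin by (meson finite_insert finite_subset)
      ultimately show ?thesis using e by simp
    next
      case False
      then show ?thesis using wu unfolding weighted_def by blast
    qed
  qed
  have "wdeg U (rest u) {v} \<le> wdeg U w {v}" by (rule wdeg_mono[OF rest_le])
  also have "\<dots> \<le> K * D" using codegree'[of "{v}"] by simp
  finally have up: "wdeg U (rest u) {v} \<le> K * D" .
  show "real (Suc i) * D / 4 \<le> wdeg U (add_link u v) {}"
    using u big unfolding wdeg_add_link[OF v] state_def by (simp add: algebra_simps)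
  show "wdeg U (add_link u v) {} \<le> real (Suc i) * (K * D)"
    using u up unfolding wdeg_add_link[OF v] state_def by (simp add: algebra_simps)
  fix T :: "'a set" assume T: "T \<noteq> {}"
  show "wdeg U (add_link u v) T \<le> (\<sigma> + K) * D * \<beta> ^ card T"
  \<comment> \<open>In these cases the link adds nothing over \<open>T\<close>: it avoids
    \<open>v\<close>, \<open>rest u\<close> vanishes above saturated sets, and no subset of
    \<open>U\<close> contains an infinite set.\<close>
  proof (cases "v \<in> T \<or> saturated u T \<or> infinite T")
    case True
    have "wdeg U (rest u) (insert v T) = 0" if "v \<notin> T"
    proof (cases "infinite T")
      case True
      then have "{e. e \<subseteq> U \<and> insert v T \<subseteq> e} = {}" using fin by (auto dest: finite_subset)
      then show ?thesis unfolding wdeg_def by (metis sum.empty)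
    next
      case False
      then have "saturated u T" using that \<open>v \<in> T \<or> saturated u T \<or> infinite T\<close> by blast
      then show ?thesis unfolding wdeg_def by (intro sum.neutral) (auto simp: rest_def)
    qed
    then have "wdeg U (add_link u v) T = wdeg U u T" unfolding wdeg_add_link[OF v] by simp
    then show ?thesis using u T unfolding state_def by simp
  next
    case False
    have "wdeg U (rest u) (insert v T) \<le> wdeg U w (insert v T)" by (rule wdeg_mono[OF rest_le])
    \<comment> \<open>Here \<open>card (insert v T) - 1 = card T\<close>, so passing to the link
      gains one factor \<open>\<beta>\<close>.\<close>
    also have "\<dots> \<le> K * D * \<beta> ^ card T" using codegree'[of "insert v T"] False by simp
    finally show ?thesis
      using False T unfolding wdeg_add_link[OF v] saturated_def by (simp add: algebra_simps)
  qed
qed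

text \<open>Averaging: the degrees in \<open>rest u\<close> sum to at least
  \<open>D * card U / 2\<close>, low vertices account for at most half of that, and a high vertex
  for at most \<open>K * D\<close>. So at least \<open>card U / (4 * K)\<close> vertices are
  high.\<close>

lemma low_vertices:
  assumes u: "state i u" and i: "i \<le> b"
  shows "real (card {v\<in>U. wdeg U (rest u) {v} < D / 4}) \<le> (1 - 1 / (4 * K)) * card U"
proof -
  let ?L = "{v\<in>U. wdeg U (rest u) {v} < D / 4}" and ?H = "{v\<in>U. \<not> wdeg U (rest u) {v} < D / 4}"
  have "1 * wdeg U (rest u) {} \<le> real (Suc l) * wdeg U (rest u) {}"
    by (intro mult_right_mono) (auto intro: wdeg_nonneg rest_nonneg)
  then have "D * card U / 2 \<le> real (Suc l) * wdeg U (rest u) {}"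
    using rest_total[OF u i] by linarith
  also have "\<dots> = (\<Sum>v\<in>U. wdeg U (rest u) {v})"
    using sum_wdeg_singleton[OF fin weighted_rest] by simp
  also have "\<dots> = (\<Sum>v\<in>?L. wdeg U (rest u) {v}) + (\<Sum>v\<in>?H. wdeg U (rest u) {v})"
    using fin by (subst sum.union_disjoint[symmetric]) (auto intro!: sum.cong)
  also have "\<dots> \<le> (\<Sum>v\<in>?L. D / 4) + (\<Sum>v\<in>?H. K * D)"
  proof (intro add_mono sum_mono)
    fix v
    have "wdeg U (rest u) {v} \<le> wdeg U w {v}" by (rule wdeg_mono[OF rest_le])
    also have "\<dots> \<le> K * D" using codegree'[of "{v}"] by simp
    finally show "wdeg U (rest u) {v} \<le> K * D" .
  qed auto
  also have "\<dots> \<le> card U * (D / 4) + card ?H * (K * D)"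
    using D_pos fin by (simp add: card_mono mult_right_mono)
  finally have "card U * D / 4 \<le> card ?H * K * D" by (simp add: algebra_simps)
  then have "card U / 4 \<le> card ?H * K" using D_pos by (simp add: field_simps)
  then have "card U / (4 * K) \<le> card ?H" using K by (simp add: field_simps)
  moreover have "card U = card ?L + card ?H"
    using fin by (subst card_Un_disjoint[symmetric]) (auto intro!: arg_cong[where f = card])
  ultimately have "card U / (4 * K) + card ?L \<le> card U" by linarith
  then show ?thesis by (simp add: left_diff_distrib)
qed

text \<open>Induction on the number \<open>j\<close> of selections left. Either \<open>I\<close>
  lies in the set of low vertices, which is one container, or the choice of a high vertex of
  \<open>I\<close> gives at most \<open>card U\<close> branches; the summand 1 in
  \<open>card U + 1\<close> pays for the extra container.\<close>

lemma covered_from_state: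
  assumes low: "(1 - 1 / (4 * K)) * card U \<le> s" and Q: "Q \<ge> 1"
    and final: "\<And>u. state b u \<Longrightarrow> covered_by U (\<lambda>I. \<forall>e\<subseteq>I. u e = 0) Q s"
    and u: "state i u" "i + j = b"
  shows "covered_by U (\<lambda>I. (\<forall>e\<subseteq>I. w e = 0) \<and> (\<forall>e\<subseteq>I. u e = 0)) ((card U + 1) ^ j * Q) s"
  using u
proof (induction j arbitrary: i u)
  case 0
  then have "covered_by U (\<lambda>I. \<forall>e\<subseteq>I. u e = 0) Q s" using final by simp
  then show ?case by (rule covered_by_mono) auto
next
  case (Suc j)
  let ?L = "{v\<in>U. wdeg U (rest u) {v} < D / 4}" and ?H = "{v\<in>U. \<not> wdeg U (rest u) {v} < D / 4}"
  let ?P = "\<lambda>u I. (\<forall>e\<subseteq>I. w e = 0) \<and> (\<forall>e\<subseteq>I. u e = 0)"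
  let ?Q = "(card U + 1) ^ j * Q"
  have "covered_by U (?P (add_link u v)) ?Q s" if "v \<in> ?H" for v
    using that Suc.prems by (intro Suc.IH[of "Suc i"] state_add_link) auto
  then have "\<forall>v\<in>?H. \<exists>\<C>. finite \<C> \<and> card \<C> \<le> ?Q \<and> (\<forall>C\<in>\<C>. C \<subseteq> U \<and> real (card C) \<le> s) \<and>
      (\<forall>I\<subseteq>U. ?P (add_link u v) I \<longrightarrow> (\<exists>C\<in>\<C>. I \<subseteq> C))"
    unfolding covered_by_def ..
  from bchoice[OF this] obtain \<C> where \<C>: "\<forall>v\<in>?H. finite (\<C> v) \<and> card (\<C> v) \<le> ?Q \<and>
      (\<forall>C\<in>\<C> v. C \<subseteq> U \<and> real (card C) \<le> s) \<and>
      (\<forall>I\<subseteq>U. ?P (add_link u v) I \<longrightarrow> (\<exists>C\<in>\<C> v. I \<subseteq> C))" ..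
  let ?\<C> = "insert ?L (\<Union>v\<in>?H. \<C> v)"
  have Q1: "?Q \<ge> 1" using Q by simp
  have "card ?\<C> \<le> Suc (card (\<Union>v\<in>?H. \<C> v))" by (rule card_insert_le_m1) auto
  also have "card (\<Union>v\<in>?H. \<C> v) \<le> (\<Sum>v\<in>?H. card (\<C> v))"
    using fin by (intro card_UN_le) auto
  also have "\<dots> \<le> (\<Sum>v\<in>?H. ?Q)" by (rule sum_mono) (use \<C> in blast)
  also have "\<dots> \<le> card U * ?Q" using fin by (simp add: card_mono)
  finally have "card ?\<C> \<le> Suc (card U * ?Q)" by simp
  also have "\<dots> \<le> ?Q + card U * ?Q" using Q1 by linarith
  also have "\<dots> = (card U + 1) ^ Suc j * Q" by (simp add: algebra_simps)
  finally have card: "card ?\<C> \<le> (card U + 1) ^ Suc j * Q" .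
  have "i \<le> b" using Suc.prems by simp
  show ?case unfolding covered_by_def
  proof (intro exI[of _ ?\<C>] conjI ballI allI impI)
    show "finite ?\<C>" using fin \<C> by auto
    show "card ?\<C> \<le> (card U + 1) ^ Suc j * Q" by (rule card)
    show "C \<subseteq> U" if "C \<in> ?\<C>" for C using that \<C> by blast
    show "real (card C) \<le> s" if "C \<in> ?\<C>" for C
      using that \<C> low_vertices[OF Suc.prems(1) \<open>i \<le> b\<close>] low by (auto intro: order_trans)
    fix I assume I: "I \<subseteq> U" and P: "?P u I"
    show "\<exists>C\<in>?\<C>. I \<subseteq> C"
    proof (cases "I \<subseteq> ?L")
      case False
      then obtain v where v: "v \<in> I" "v \<in> ?H" using I by blast
      \<comment> \<open>As \<open>v\<close> belongs to \<open>I\<close>, so does all of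
        \<open>insert v e\<close>; there \<open>w\<close> vanishes and with it
        \<open>rest u\<close>.\<close>
      have "add_link u v e = 0" if "e \<subseteq> I" for e
        using that P v(1) rest_le[of u "insert v e"] rest_nonneg[of u "insert v e"]
        unfolding add_link_def by auto
      then have "?P (add_link u v) I" using P by simp
      moreover have "\<forall>I\<subseteq>U. ?P (add_link u v) I \<longrightarrow> (\<exists>C\<in>\<C> v. I \<subseteq> C)"
        using bspec[OF \<C> v(2)] by (elim conjE)
      ultimately have "\<exists>C\<in>\<C> v. I \<subseteq> C" using I by metis
      then obtain C where C: "C \<in> \<C> v" "I \<subseteq> C" ..
      have "C \<in> (\<Union>v\<in>?H. \<C> v)" using v(2) C(1) by (rule UN_I)
      with C(2) show ?thesis by (rule bexI[OF _ insertI2])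
    next
      case True
      then show ?thesis by (rule bexI[OF _ insertI1])
    qed
  qed
qed

end

text \<open>One number \<open>A\<close> serves as factor and as exponent, to keep the induction on
  \<open>l\<close> short. The ratio \<open>b / card U\<close> is the same for all uniformities, so
  each level costs another \<open>b\<close> selections, while \<open>K\<close> is essentially
  squared.\<close>

lemma hypergraph_containers:
  fixes l :: nat
  shows "\<exists>A\<ge>1. \<forall>(U :: 'a set) w K b. finite U \<longrightarrow> K \<ge> 1 \<longrightarrow> b \<ge> 1 \<longrightarrow> weighted l U w \<longrightarrow> wdeg U w {} > 0 \<longrightarrow>
     (\<forall>T. T \<noteq> {} \<longrightarrow> wdeg U w T \<le> K * wdeg U w {} / card U * (real b / card U) ^ (card T - 1)) \<longrightarrow>
     covered_by U (\<lambda>I. \<forall>e\<subseteq>I. w e = 0) ((card U + 1) ^ (l * b)) ((1 - 1 / (real A * K ^ A)) * card U)"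
proof (induction l)
  case 0
  show ?case
  proof (intro exI[of _ 1] conjI allI impI)
    fix U :: "'a set" and w :: "'a set \<Rightarrow> real" and K :: real and b :: nat
    assume "finite U" "weighted 0 U w" and W: "wdeg U w {} > 0"
    then have w: "w e = 0" if "e \<noteq> {}" for e
      using that unfolding weighted_def by (metis card_eq_0_iff finite_subset)
    have "w {} \<noteq> 0"
    proof
      assume "w {} = 0"
      then have "w e = 0" for e using w by (cases "e = {}") auto
      then show False using W by (simp add: wdeg_def)
    qed
    then show "covered_by U (\<lambda>I. \<forall>e\<subseteq>I. w e = 0) ((card U + 1) ^ (0 * b)) ((1 - 1 / (real 1 * K ^ 1)) * card U)"
      unfolding covered_by_def by (intro exI[of _ "{}"]) auto
  qed simp
next
  case (Suc l)
  from Suc.IH obtain A where A: "A \<ge> 1" and IH: "\<forall>(U :: 'a set) w K b. finite U \<longrightarrow> K \<ge> 1 \<longrightarrow> b \<ge> 1 \<longrightarrow>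
     weighted l U w \<longrightarrow> wdeg U w {} > 0 \<longrightarrow>
     (\<forall>T. T \<noteq> {} \<longrightarrow> wdeg U w T \<le> K * wdeg U w {} / card U * (real b / card U) ^ (card T - 1)) \<longrightarrow>
     covered_by U (\<lambda>I. \<forall>e\<subseteq>I. w e = 0) ((card U + 1) ^ (l * b)) ((1 - 1 / (real A * K ^ A)) * card U)"
    by (elim exE conjE) (rule that)
  define B :: nat where "B = 4 * (2 ^ (l + 1) + 1)"
  \<comment> \<open>The 4 serves the containers of low vertices, where \<open>4 * K\<close> has to
    be dominated; the other two entries dominate \<open>A * (B * K ^ 2) ^ A\<close> from the
    induction hypothesis.\<close>
  define A' where "A' = max 4 (max (A * B ^ A) (2 * A))"
  show ?case
  proof (intro exI[of _ A'] conjI allI impI)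
    show "A' \<ge> 1" unfolding A'_def by simp
    fix U :: "'a set" and w :: "'a set \<Rightarrow> real" and K :: real and b :: nat
    assume hyps: "finite U" "K \<ge> 1" "b \<ge> 1" "weighted (Suc l) U w" "wdeg U w {} > 0"
      "\<forall>T. T \<noteq> {} \<longrightarrow> wdeg U w T \<le> K * wdeg U w {} / card U * (real b / card U) ^ (card T - 1)"
    interpret link_accumulation l b U w K by unfold_locales (use hyps in auto)
    define s where "s = (1 - 1 / (real A' * K ^ A')) * card U"
    \<comment> \<open>The total of the final \<open>u\<close> is at least \<open>b * D / 4\<close>,
      that is \<open>\<beta> * D * card U / 4\<close>. Rewriting the codegree bound in terms of the
      total costs this factor 4 and uses up one \<open>\<beta>\<close>.\<close>
    define K' where "K' = 4 * (\<sigma> + K)"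
    have K'1: "K' \<ge> 1" unfolding K'_def using \<sigma>_pos K by simp
    have K'_le: "K' \<le> B * K ^ 2"
    proof -
      have "K \<le> K ^ 2" using K by (simp add: self_le_power)
      then show ?thesis unfolding K'_def B_def \<sigma>_def by (simp add: algebra_simps)
    qed
    have s_mono: "(1 - 1 / x) * card U \<le> s" if "0 < x" "x \<le> real A' * K ^ A'" for x
      unfolding s_def using that by (intro mult_right_mono) (auto simp: frac_le)
    have "covered_by U (\<lambda>I. (\<forall>e\<subseteq>I. w e = 0) \<and> (\<forall>e\<subseteq>I. (\<lambda>_. 0 :: real) e = 0))
       ((card U + 1) ^ b * (card U + 1) ^ (l * b)) s"
    proof (rule covered_from_state[where i = 0])
      show "(1 - 1 / (4 * K)) * card U \<le> s"
      proof (rule s_mono)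
        have "K \<le> K ^ A'" using K unfolding A'_def by (intro self_le_power) auto
        then show "4 * K \<le> real A' * K ^ A'" using K unfolding A'_def by (intro mult_mono) auto
      qed (use K in simp)
      fix u assume u: "state b u"
      have tot: "wdeg U u {} \<ge> real b * D / 4" using u unfolding state_def by simp
      have pos: "real b * D / 4 > 0" using b D_pos by simp
      have "covered_by U (\<lambda>I. \<forall>e\<subseteq>I. u e = 0) ((card U + 1) ^ (l * b)) ((1 - 1 / (real A * K' ^ A)) * card U)"
      proof (rule IH[rule_format, OF fin K'1 b])
        show "weighted l U u" using u unfolding state_def by simp
        show "wdeg U u {} > 0" using tot pos by linarith
        fix T :: "'a set" assume T: "T \<noteq> {}"
        show "wdeg U u T \<le> K' * wdeg U u {} / card U * (real b / card U) ^ (card T - 1)"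
        proof (cases "finite T")
          case True
          have rearrange: "(\<sigma> + K) * D * (\<beta> * x) = K' * (real b * D / 4) / card U * x" for x
            using card_U_pos unfolding K'_def \<beta>_def by (simp add: field_simps)
          from T True have c: "card T > 0" using T by (simp add: card_gt_0_iff)
          have "wdeg U u T \<le> (\<sigma> + K) * D * \<beta> ^ card T" using u T unfolding state_def by blast
          also have "\<beta> ^ card T = \<beta> * \<beta> ^ (card T - 1)" using c by (metis power_eq_if not_gr_zero)
          also have "(\<sigma> + K) * D * (\<beta> * \<beta> ^ (card T - 1)) = K' * (real b * D / 4) / card U * \<beta> ^ (card T - 1)"
            by (rule rearrange)
          also have "\<dots> \<le> K' * wdeg U u {} / card U * \<beta> ^ (card T - 1)"
            using tot K'1 \<beta>_pos card_U_pos by (intro mult_right_mono divide_right_mono mult_left_mono) auto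
          finally show ?thesis unfolding \<beta>_def .
        next
          case False
          then have "{e. e \<subseteq> U \<and> T \<subseteq> e} = {}" using fin by (auto dest: finite_subset)
          then have "wdeg U u T = 0" unfolding wdeg_def by (metis sum.empty)
          then show ?thesis using tot pos K'1 by simp
        qed
      qed
      then show "covered_by U (\<lambda>I. \<forall>e\<subseteq>I. u e = 0) ((card U + 1) ^ (l * b)) s"
      proof (rule covered_by_mono)
        show "(1 - 1 / (real A * K' ^ A)) * card U \<le> s"
        proof (rule s_mono)
          show "0 < real A * K' ^ A" using A K'1 by simp
          have "real A * K' ^ A \<le> real A * (B * K ^ 2) ^ A"
            using K'_le K'1 by (intro mult_left_mono power_mono) auto
          also have "\<dots> = real (A * B ^ A) * K ^ (2 * A)" by (simp add: power_mult_distrib power_mult)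
          also have "\<dots> \<le> real A' * K ^ A'"
          proof (intro mult_mono power_increasing)
            show "real (A * B ^ A) \<le> real A'" unfolding A'_def of_nat_le_iff by simp
          qed (use K in \<open>auto simp: A'_def\<close>)
          finally show "real A * K' ^ A \<le> real A' * K ^ A'" .
        qed
      qed auto
    qed (use state_0 in auto)
    then show "covered_by U (\<lambda>I. \<forall>e\<subseteq>I. w e = 0) ((card U + 1) ^ (Suc l * b)) ((1 - 1 / (real A' * K ^ A')) * card U)"
      unfolding s_def by (rule covered_by_mono) (auto simp: power_add)
  qed
qed


text \<open>A container above size \<open>R\<close> is replaced by its own containers, one at most
  \<open>R\<close> is kept. The step is only required above \<open>R\<close>, since spread
  collections exist only in large edge sets.\<close>

lemma covered_by_iterate:
  fixes \<delta> R :: real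
  assumes "finite V" "Q \<ge> 1" "\<delta> \<ge> 0" "\<delta> \<le> 1"
    and step: "\<And>U. U \<subseteq> V \<Longrightarrow> R \<le> real (card U) \<Longrightarrow> covered_by U P Q ((1 - \<delta>) * card U)"
    and "U \<subseteq> V" "(1 - \<delta>) ^ L * card U \<le> R"
  shows "covered_by U P (Q ^ L) R"
  using assms(6,7)
proof (induction L arbitrary: U)
  case 0
  then show ?case unfolding covered_by_def by (intro exI[of _ "{U}"]) auto
next
  case (Suc L)
  show ?case
  proof (cases "real (card U) \<le> R")
    case True
    then show ?thesis unfolding covered_by_def using assms(2) by (intro exI[of _ "{U}"]) auto
  next
    case False
    then have "covered_by U P Q ((1 - \<delta>) * card U)" using step[OF Suc.prems(1)] by simp
    then obtain \<C> where \<C>: "finite \<C>" "card \<C> \<le> Q"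
      "\<forall>C\<in>\<C>. C \<subseteq> U \<and> real (card C) \<le> (1 - \<delta>) * card U" "\<forall>I\<subseteq>U. P I \<longrightarrow> (\<exists>C\<in>\<C>. I \<subseteq> C)"
      unfolding covered_by_def by (elim exE conjE) (rule that)
    have "covered_by C P (Q ^ L) R" if C: "C \<in> \<C>" for C
    proof (rule Suc.IH)
      show "C \<subseteq> V" using C \<C>(3) Suc.prems(1) by blast
      have "(1 - \<delta>) ^ L * card C \<le> (1 - \<delta>) ^ L * ((1 - \<delta>) * card U)"
        using C \<C>(3) assms(3,4) by (intro mult_left_mono) auto
      then show "(1 - \<delta>) ^ L * card C \<le> R" using Suc.prems(2) by (simp add: algebra_simps)
    qed
    then have "\<forall>C\<in>\<C>. \<exists>\<D>. finite \<D> \<and> card \<D> \<le> Q ^ L \<and>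
      (\<forall>D\<in>\<D>. D \<subseteq> C \<and> real (card D) \<le> R) \<and> (\<forall>I\<subseteq>C. P I \<longrightarrow> (\<exists>D\<in>\<D>. I \<subseteq> D))"
      unfolding covered_by_def ..
    from bchoice[OF this] obtain \<D> where \<D>: "\<forall>C\<in>\<C>. finite (\<D> C) \<and> card (\<D> C) \<le> Q ^ L \<and>
      (\<forall>D\<in>\<D> C. D \<subseteq> C \<and> real (card D) \<le> R) \<and> (\<forall>I\<subseteq>C. P I \<longrightarrow> (\<exists>D\<in>\<D> C. I \<subseteq> D))" ..
    have "card (\<Union>C\<in>\<C>. \<D> C) \<le> (\<Sum>C\<in>\<C>. card (\<D> C))" by (rule card_UN_le[OF \<C>(1)])
    also have "\<dots> \<le> (\<Sum>C\<in>\<C>. Q ^ L)" by (rule sum_mono) (use \<D> in blast)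
    also have "\<dots> \<le> Q ^ Suc L" using \<C>(2) by (simp add: mult_right_mono)
    finally have card: "card (\<Union>C\<in>\<C>. \<D> C) \<le> Q ^ Suc L" .
    show ?thesis unfolding covered_by_def
    proof (intro exI[of _ "\<Union>C\<in>\<C>. \<D> C"] conjI ballI allI impI)
      show "finite (\<Union>C\<in>\<C>. \<D> C)" using \<C>(1) \<D> by blast
      show "card (\<Union>C\<in>\<C>. \<D> C) \<le> Q ^ Suc L" by (rule card)
      show "D \<subseteq> U" if "D \<in> (\<Union>C\<in>\<C>. \<D> C)" for D
        using that \<C>(3) \<D> by (meson UN_E order_trans)
      show "real (card D) \<le> R" if "D \<in> (\<Union>C\<in>\<C>. \<D> C)" for D
        using that \<D> by (meson UN_E)
      fix I assume I: "I \<subseteq> U" "P I"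
      then obtain C where C: "C \<in> \<C>" "I \<subseteq> C" using \<C>(4) by meson
      then obtain D where "D \<in> \<D> C" "I \<subseteq> D" using \<D> I(2) by meson
      then show "\<exists>D\<in>\<Union>C\<in>\<C>. \<D> C. I \<subseteq> D" using C(1) by (meson UN_I)
    qed
  qed
qed

section \<open>Copies and expansions\<close>

text \<open>The vertex set of a copy can always be taken as the image of the embedding, so from here
  on copies are handled as injections together with their edge images.\<close>

lemma edges_copies_iff:
  assumes "\<forall>e\<in>edges F. e \<subseteq> verts F"
  shows "S \<in> edges ` copies F H \<longleftrightarrow>
    (\<exists>f. inj_on f (verts F) \<and> f ` verts F \<subseteq> verts H \<and> S = (`) f ` edges F \<and> S \<subseteq> edges H)"
proof
  assume "S \<in> edges ` copies F H"
  then obtain F' f where "subgraph F' H" "bij_betw f (verts F) (verts F')"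
    "edges F' = (`) f ` edges F" "S = edges F'"
    unfolding copies_def isomorphic_def by auto
  then show "\<exists>f. inj_on f (verts F) \<and> f ` verts F \<subseteq> verts H \<and> S = (`) f ` edges F \<and> S \<subseteq> edges H"
    unfolding subgraph_def bij_betw_def by (intro exI[of _ f]) auto
next
  assume "\<exists>f. inj_on f (verts F) \<and> f ` verts F \<subseteq> verts H \<and> S = (`) f ` edges F \<and> S \<subseteq> edges H"
  then obtain f where f: "inj_on f (verts F)" "f ` verts F \<subseteq> verts H" "S = (`) f ` edges F" "S \<subseteq> edges H"
    by blast
  have "(f ` verts F, S) \<in> copies F H"
    unfolding copies_def isomorphic_def subgraph_def bij_betw_def using f assms
    by (simp add: image_mono) blast
  then show "S \<in> edges ` copies F H" by force
qed

definition expand_edge :: "nat \<Rightarrow> nat \<Rightarrow> 'a set \<Rightarrow> ('a + 'a set \<times> nat) set" where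
  "expand_edge r0 r e = Inl ` e \<union> Inr ` ({e} \<times> {..<r - r0})"

lemma verts_expansion: "verts (expansion r0 r F) = Inl ` verts F \<union> Inr ` (edges F \<times> {..<r - r0})"
  and edges_expansion: "edges (expansion r0 r F) = expand_edge r0 r ` edges F"
  unfolding expansion_def expand_edge_def by auto

lemma inj_expand_edge: "inj_on (expand_edge r0 r) A"
proof (rule inj_onI)
  fix e e' :: "'a set" assume "expand_edge r0 r e = expand_edge r0 r e'"
  then have "Inl -` expand_edge r0 r e = Inl -` expand_edge r0 r e'" by simp
  then show "e = e'" unfolding expand_edge_def by auto
qed

lemma card_edges_expansion: "card (edges (expansion r0 r F)) = card (edges F)"
  unfolding edges_expansion by (rule card_image[OF inj_expand_edge])

lemma finite_edges: "r_graph r F \<Longrightarrow> finite (edges F)"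
  unfolding r_graph_def by (meson finite_Pow_iff finite_subset subsetI PowI)

lemma card_expand_edge:
  assumes "finite e" "card e = r0" "r0 \<le> r"
  shows "card (expand_edge r0 r e) = r"
proof -
  have "card (expand_edge r0 r e) = card (Inl ` e :: ('a + 'a set \<times> nat) set)
      + card (Inr ` ({e} \<times> {..<r - r0}) :: ('a + 'a set \<times> nat) set)"
    unfolding expand_edge_def by (rule card_Un_disjoint) (use assms in auto)
  also have "\<dots> = r" using assms by (simp add: card_image card_cartesian_product)
  finally show ?thesis .
qed

lemma r_graph_expansion:
  assumes "r_graph r0 F" "r0 \<le> r"
  shows "r_graph r (expansion r0 r F)"
  unfolding r_graph_def verts_expansion edges_expansion
proof (intro conjI ballI)
  show "finite (Inl ` verts F \<union> Inr ` (edges F \<times> {..<r - r0}))"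
    using assms finite_edges[OF assms(1)] unfolding r_graph_def by simp
  fix e' assume "e' \<in> expand_edge r0 r ` edges F"
  then obtain e where e: "e \<in> edges F" "e' = expand_edge r0 r e" by blast
  then show "e' \<subseteq> Inl ` verts F \<union> Inr ` (edges F \<times> {..<r - r0})"
    using assms unfolding expand_edge_def r_graph_def by auto
  show "card e' = r"
    using e assms unfolding r_graph_def by (auto intro!: card_expand_edge dest: finite_subset)
qed

lemma expansion_edges_subset: "\<forall>e\<in>edges F. e \<subseteq> verts F \<Longrightarrow>
    \<forall>e\<in>edges (expansion r0 r F). e \<subseteq> verts (expansion r0 r F)"
  unfolding verts_expansion edges_expansion expand_edge_def by auto

text \<open>Choosing the new vertices of a copy from disjoint sets of equal size makes all choices compatible,
  so that the number of extensions is an exact power.\<close>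

lemma disjoint_subfamily:
  fixes M :: "'b \<Rightarrow> 'c set"
  assumes "finite S" "\<forall>s\<in>S. finite (M s) \<and> card S * q \<le> card (M s)"
  shows "\<exists>N. (\<forall>s\<in>S. N s \<subseteq> M s \<and> card (N s) = q) \<and> disjoint_family_on N S"
  using assms
proof (induction S)
  case empty
  then show ?case by (simp add: disjoint_family_on_def)
next
  case (insert a S)
  have "\<forall>s\<in>S. finite (M s) \<and> card S * q \<le> card (M s)"
    using insert.prems insert.hyps by auto
  then obtain N where N: "\<forall>s\<in>S. N s \<subseteq> M s \<and> card (N s) = q" "disjoint_family_on N S"
    using insert.IH by blast
  let ?B = "\<Union>s\<in>S. N s"
  have "card ?B \<le> (\<Sum>s\<in>S. card (N s))" by (rule card_UN_le[OF insert.hyps(1)])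
  also have "\<dots> = card S * q" using N by simp
  finally have B: "card ?B \<le> card S * q" .
  have finB: "finite ?B" using insert.hyps(1) insert.prems N(1) by (meson finite_UN finite_subset insertCI)
  have "card (M a) \<ge> card S * q + q" using insert by (simp add: algebra_simps)
  then have "q \<le> card (M a - ?B)" using B diff_card_le_card_Diff[OF finB, of "M a"] by linarith
  then obtain X where X: "X \<subseteq> M a - ?B" "card X = q" by (meson obtain_subset_with_card_n)
  show ?case
  proof (intro exI[of _ "N(a := X)"] conjI ballI)
    fix s assume "s \<in> insert a S"
    then show "(N(a := X)) s \<subseteq> M s" "card ((N(a := X)) s) = q" using N X by auto
  next
    have "X \<inter> N s = {}" "N s \<inter> X = {}" if "s \<in> S" for s using X(1) that by blast+
    then show "disjoint_family_on (N(a := X)) (insert a S)"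
      using N(2) insert.hyps(2) unfolding disjoint_family_on_def by simp
  qed
qed

section \<open>Lifting balancedness to expansions\<close>

text \<open>Balancedness of a single edge set on \<open>{..<n}\<close>, with numbers in place of
  functions and a bound for each \<open>T\<close> instead of a maximum. No upper limit on
  \<open>card T\<close> is imposed: a larger set than \<open>edges F\<close> lies in no
  copy.\<close>

definition spread :: "'a hypergraph \<Rightarrow> nat \<Rightarrow> nat set set \<Rightarrow> real \<Rightarrow> real \<Rightarrow> bool" where
  "spread F n E \<gamma> \<tau> \<longleftrightarrow> (\<exists>\<H>. \<H> \<subseteq> edges ` copies F ({..<n}, E) \<and> \<H> \<noteq> {} \<and>
     (\<forall>T. T \<noteq> {} \<longrightarrow> finite T \<longrightarrow> real (card {S \<in> \<H>. T \<subseteq> S})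
        \<le> \<gamma> * real (card \<H>) / real (card E) * (\<tau> / real (card E)) ^ (card T - 1)))"

text \<open>The edges assigned to \<open>s\<close> are those obtained by adding a vertex above all
  of \<open>s\<close>; hence every edge is assigned to exactly one set.\<close>

definition top_nbrs :: "nat set set \<Rightarrow> nat set \<Rightarrow> nat set" where
  "top_nbrs E s = {x. insert x s \<in> E \<and> (\<forall>y\<in>s. y < x)}"

lemma finite_r_subsets: "finite (r_subsets r n)"
  unfolding r_subsets_def by (rule finite_subset[of _ "Pow {..<n}"]) auto

lemma top_nbrs_subset: "E \<subseteq> r_subsets r n \<Longrightarrow> top_nbrs E s \<subseteq> {..<n}"
  unfolding top_nbrs_def r_subsets_def by auto

text \<open>An extended edge determines both the edge it came from and the added vertex. This makes
  different extensions distinct edge sets.\<close>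

lemma Max_insert_top:
  assumes "finite s" "x \<in> top_nbrs E s"
  shows "Max (insert x s) = x" and "insert x s - {Max (insert x s)} = s"
proof -
  show m: "Max (insert x s) = x"
    using assms unfolding top_nbrs_def by (intro Max_eqI) (auto intro: less_imp_le)
  show "insert x s - {Max (insert x s)} = s"
    unfolding m using assms unfolding top_nbrs_def by auto
qed

lemma scale_mono:
  fixes g t u w :: real
  assumes "0 \<le> g" "0 \<le> t" "0 \<le> u" "u \<le> w"
  shows "g * u * (t * u) ^ i \<le> g * w * (t * w) ^ i"
  using assms by (intro mult_mono power_mono mult_left_mono) auto

text \<open>A copy \<open>S\<close> together with a choice of one of \<open>q\<close> top neighbours
  for each of its edges gives an extended copy, so there are
  \<open>card \<G> * q ^ card (edges F)\<close> of them. Those containing \<open>T\<close> have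
  their choices on the projection of \<open>T\<close> prescribed. The degree hypothesis leaves room
  to avoid the old vertices of the copy and to make the candidate sets disjoint.\<close>

lemma spread_lift:
  fixes F :: "'a hypergraph" and q :: nat and \<rho> \<gamma> \<tau> :: real
  assumes F: "r_graph r0 F" and k: "r0 \<le> k"
    and E: "E \<subseteq> r_subsets (Suc k) n" "E \<noteq> {}" and A: "A \<subseteq> r_subsets k n" and q: "q \<ge> 1"
    and deg: "\<And>s. s \<in> A \<Longrightarrow>
      card (verts (expansion r0 k F)) + card (edges F) * q \<le> card (top_nbrs E s)"
    and spread: "spread (expansion r0 k F) n A \<gamma> \<tau>" and nonneg: "\<gamma> \<ge> 0" "\<tau> \<ge> 0"
    and \<rho>: "\<rho> * (real (card A) * real q) \<ge> real (card E)"
  shows "spread (expansion r0 (Suc k) F) n E (\<rho> * \<gamma>) (\<rho> * \<tau>)"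
proof -
  let ?V = "verts (expansion r0 k F)" and ?l = "card (edges F)"
  let ?xe = "expand_edge r0 k"
  \<comment> \<open>The index \<open>k - r0\<close> is the one label that uniformity
    \<open>Suc k\<close> has in addition to those of uniformity \<open>k\<close>.\<close>
  let ?new = "\<lambda>e. Inr (e, k - r0) :: 'a + 'a set \<times> nat"
  have sub: "\<forall>e\<in>edges F. e \<subseteq> verts F" using F unfolding r_graph_def by blast
  note subk = expansion_edges_subset[OF sub, of r0 k]
  have finF: "finite (edges F)" by (rule finite_edges[OF F])
  have finV: "finite ?V" using r_graph_expansion[OF F k] unfolding r_graph_def by blast
  have V_Suc: "verts (expansion r0 (Suc k) F) = ?V \<union> ?new ` edges F"
    unfolding verts_expansion using k by (auto simp: Suc_diff_le lessThan_Suc)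
  have xe_Suc: "expand_edge r0 (Suc k) e = insert (?new e) (?xe e)" for e
    unfolding expand_edge_def using k by (auto simp: Suc_diff_le lessThan_Suc)
  have finA: "finite A" by (rule finite_subset[OF A finite_r_subsets])
  have finE: "finite E" by (rule finite_subset[OF E(1) finite_r_subsets])
  have finite_mem: "finite s" if "s \<in> A" for s
    using that A unfolding r_subsets_def by (auto dest: finite_subset)
  obtain \<G> where \<G>: "\<G> \<subseteq> edges ` copies (expansion r0 k F) ({..<n}, A)" "\<G> \<noteq> {}"
    "\<And>T. T \<noteq> {} \<Longrightarrow> finite T \<Longrightarrow> real (card {S \<in> \<G>. T \<subseteq> S})
        \<le> \<gamma> * real (card \<G>) / real (card A) * (\<tau> / real (card A)) ^ (card T - 1)"
    using spread unfolding spread_def by blast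
  have "\<forall>S\<in>\<G>. \<exists>f. inj_on f ?V \<and> f ` ?V \<subseteq> {..<n} \<and> S = (`) f ` ?xe ` edges F \<and> S \<subseteq> A"
  proof
    fix S assume "S \<in> \<G>"
    then have "S \<in> edges ` copies (expansion r0 k F) ({..<n}, A)" using \<G>(1) by blast
    then show "\<exists>f. inj_on f ?V \<and> f ` ?V \<subseteq> {..<n} \<and> S = (`) f ` ?xe ` edges F \<and> S \<subseteq> A"
      unfolding edges_copies_iff[OF subk] unfolding edges_expansion by simp
  qed
  from bchoice[OF this] obtain f where f': "\<forall>S\<in>\<G>. inj_on (f S) ?V \<and> f S ` ?V \<subseteq> {..<n} \<and>
      S = (`) (f S) ` ?xe ` edges F \<and> S \<subseteq> A" ..
  have f: "inj_on (f S) ?V" "f S ` ?V \<subseteq> {..<n}" "S = (`) (f S) ` ?xe ` edges F" "S \<subseteq> A"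
    if "S \<in> \<G>" for S using bspec[OF f' that] by blast+
  have fin\<G>: "finite \<G>" by (rule finite_subset[of _ "Pow A"]) (use f(4) finA in auto)
  have finS: "finite S" if "S \<in> \<G>" for S using f(4)[OF that] finA by (rule finite_subset)
  have inj_fxe: "inj_on (\<lambda>e. f S ` ?xe e) (edges F)" if S: "S \<in> \<G>" for S
  proof -
    have "inj_on ((`) (f S)) (?xe ` edges F)"
    proof (rule inj_on_image, rule inj_on_subset[OF f(1)[OF S]])
      show "\<Union> (?xe ` edges F) \<subseteq> ?V" using subk unfolding edges_expansion by blast
    qed
    then show ?thesis using comp_inj_on[OF inj_expand_edge] by (fastforce simp: comp_def)
  qed
  have S_eq: "S = (\<lambda>e. f S ` ?xe e) ` edges F" if "S \<in> \<G>" for S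
    using f(3)[OF that] by (simp add: image_image)
  have cardS: "card S = ?l" if "S \<in> \<G>" for S
    using card_image[OF inj_fxe[OF that]] S_eq[OF that] by simp
  have "\<forall>S\<in>\<G>. \<exists>N. (\<forall>s\<in>S. N s \<subseteq> top_nbrs E s - f S ` ?V \<and> card (N s) = q) \<and> disjoint_family_on N S"
  proof
    fix S assume S: "S \<in> \<G>"
    show "\<exists>N. (\<forall>s\<in>S. N s \<subseteq> top_nbrs E s - f S ` ?V \<and> card (N s) = q) \<and> disjoint_family_on N S"
    proof (rule disjoint_subfamily[OF finS[OF S]], intro ballI conjI)
      fix s assume s: "s \<in> S"
      show "finite (top_nbrs E s - f S ` ?V)"
        using top_nbrs_subset[OF E(1)] by (meson finite_Diff finite_lessThan finite_subset)
      have "card (f S ` ?V) \<le> card ?V" by (rule card_image_le[OF finV])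
      then show "card S * q \<le> card (top_nbrs E s - f S ` ?V)"
        using deg[of s] s f(4)[OF S] diff_card_le_card_Diff[of "f S ` ?V" "top_nbrs E s"] finV
        unfolding cardS[OF S] by fastforce
    qed
  qed
  from bchoice[OF this] obtain N where N':
    "\<forall>S\<in>\<G>. (\<forall>s\<in>S. N S s \<subseteq> top_nbrs E s - f S ` ?V \<and> card (N S s) = q) \<and> disjoint_family_on (N S) S" ..
  have N: "\<And>S s. S \<in> \<G> \<Longrightarrow> s \<in> S \<Longrightarrow> N S s \<subseteq> top_nbrs E s - f S ` ?V"
    "\<And>S s. S \<in> \<G> \<Longrightarrow> s \<in> S \<Longrightarrow> card (N S s) = q" "\<And>S. S \<in> \<G> \<Longrightarrow> disjoint_family_on (N S) S"
    using N' by simp_all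
  have finN: "finite (N S s)" if "S \<in> \<G>" "s \<in> S" for S s
    using N(2)[OF that] q by (intro card_ge_0_finite) simp
  define ext :: "nat set set \<times> (nat set \<Rightarrow> nat) \<Rightarrow> nat set set" where
    "ext = (\<lambda>(S, x). (\<lambda>s. insert (x s) s) ` S)"
  define \<pi> :: "nat set \<Rightarrow> nat set" where "\<pi> e = e - {Max e}" for e
  let ?\<X> = "SIGMA S:\<G>. PiE S (N S)"
  have top: "Max (insert (x s) s) = x s" "\<pi> (insert (x s) s) = s"
    if "S \<in> \<G>" "x \<in> PiE S (N S)" "s \<in> S" for S x s
  proof -
    have "x s \<in> top_nbrs E s" using that N(1) PiE_mem by fastforce
    moreover have "finite s" using that f(4) finite_mem by blast
    ultimately show "Max (insert (x s) s) = x s" "\<pi> (insert (x s) s) = s"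
      unfolding \<pi>_def using Max_insert_top by blast+
  qed
  have \<pi>_ext: "\<pi> ` ext (S, x) = S" if "S \<in> \<G>" "x \<in> PiE S (N S)" for S x
    unfolding ext_def using top(2)[OF that] by (simp add: image_image)
  have ext_mem: "\<pi> e \<in> S \<and> x (\<pi> e) = Max e" if "S \<in> \<G>" "x \<in> PiE S (N S)" "e \<in> ext (S, x)" for S x e
    using that(3) top[OF that(1,2)] unfolding ext_def by auto
  have ext_inj_\<pi>: "inj_on \<pi> (ext (S, x))" if "S \<in> \<G>" "x \<in> PiE S (N S)" for S x
    unfolding ext_def using top(2)[OF that] by (auto simp: inj_on_def)
  have inj_ext: "inj_on ext ?\<X>"
  proof (rule inj_onI, clarify)
    fix S x S' x' assume *: "S \<in> \<G>" "x \<in> PiE S (N S)" "S' \<in> \<G>" "x' \<in> PiE S' (N S')"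
      "ext (S, x) = ext (S', x')"
    then have S: "S = S'" using \<pi>_ext by metis
    have "x s = x' s" if s: "s \<in> S" for s
    proof -
      have "insert (x s) s \<in> ext (S', x')" using s unfolding *(5)[symmetric] by (auto simp: ext_def)
      from ext_mem[OF *(3,4) this] show ?thesis using top[OF *(1,2) s] by simp
    qed
    then show "S = S' \<and> x = x'" using S PiE_ext[OF *(2)] *(4) by blast
  qed
  have card_X: "card ?\<X> = card \<G> * q ^ ?l"
  proof -
    have "card ?\<X> = (\<Sum>S\<in>\<G>. card (PiE S (N S)))"
      using fin\<G> finS finN by (subst card_SigmaI) (auto intro!: finite_PiE)
    also have "\<dots> = (\<Sum>S\<in>\<G>. q ^ ?l)"
      by (rule sum.cong) (auto simp: card_PiE finS N(2) cardS)
    finally show ?thesis by simp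
  qed
  have copy: "ext (S, x) \<in> edges ` copies (expansion r0 (Suc k) F) ({..<n}, E)"
    if S: "S \<in> \<G>" and x: "x \<in> PiE S (N S)" for S x
    unfolding edges_copies_iff[OF expansion_edges_subset[OF sub]]
  proof (intro exI conjI)
    \<comment> \<open>Old vertices follow the embedding of \<open>S\<close>, and the new vertex of
      \<open>e\<close> goes to the vertex chosen for the image of \<open>e\<close>. Injectivity
      holds because candidates avoid the image of the old vertices and candidate sets of different
      edges are disjoint.\<close>
    define g where "g u = (case u of Inl v \<Rightarrow> f S u | Inr (e, j) \<Rightarrow>
      if j < k - r0 then f S u else x (f S ` ?xe e))" for u
    have gV: "g u = f S u" if "u \<in> ?V" for u
      using that unfolding verts_expansion g_def by auto
    have gnew: "g (?new e) = x (f S ` ?xe e)" for e unfolding g_def by simp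
    have gxe: "g ` ?xe e = f S ` ?xe e" if "e \<in> edges F" for e
      using that gV subk unfolding edges_expansion by (intro image_cong) blast+
    have mem: "f S ` ?xe e \<in> S" if "e \<in> edges F" for e using that S_eq[OF S] by blast
    have xN: "x s \<in> N S s" if "s \<in> S" for s using x that by (rule PiE_mem)
    have xtop: "x s \<in> top_nbrs E s" "x s \<notin> f S ` ?V" if "s \<in> S" for s
      using xN[OF that] N(1)[OF S that] by blast+
    show "inj_on g (verts (expansion r0 (Suc k) F))"
      unfolding V_Suc inj_on_Un
    proof (intro conjI)
      show "inj_on g ?V" using f(1)[OF S] gV by (simp cong: inj_on_cong)
      show "inj_on g (?new ` edges F)"
      proof (rule inj_onI)
        fix u u' assume u: "u \<in> ?new ` edges F" "u' \<in> ?new ` edges F" "g u = g u'"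
        from u(1,2) obtain e e' where e: "e \<in> edges F" "e' \<in> edges F" and eq: "u = ?new e" "u' = ?new e'"
          by blast
        then have "g (?new e) = g (?new e')" using u(3) by simp
        then have "x (f S ` ?xe e) = x (f S ` ?xe e')" by (simp add: gnew)
        then have "x (f S ` ?xe e) \<in> N S (f S ` ?xe e) \<inter> N S (f S ` ?xe e')"
          using xN[OF mem[OF e(1)]] xN[OF mem[OF e(2)]] by simp
        then have "f S ` ?xe e = f S ` ?xe e'"
          using N(3)[OF S] mem e unfolding disjoint_family_on_def by blast
        then have "e = e'" using inj_fxe[OF S] e unfolding inj_on_def by blast
        then show "u = u'" using eq by simp
      qed
      show "g ` (?V - ?new ` edges F) \<inter> g ` (?new ` edges F - ?V) = {}"
      proof -
        have "g u \<noteq> g (?new e)" if "u \<in> ?V" "e \<in> edges F" for u e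
          using xtop(2)[OF mem[OF that(2)]] imageI[OF that(1), of "f S"] gV[OF that(1)] gnew[of e] by metis
        then show ?thesis by blast
      qed
    qed
    show "g ` verts (expansion r0 (Suc k) F) \<subseteq> verts ({..<n}, E)"
    proof -
      have "g ` ?V \<subseteq> {..<n}" using gV f(2)[OF S] by auto
      moreover have "g (?new e) \<in> {..<n}" if "e \<in> edges F" for e
        using xtop(1)[OF mem[OF that]] top_nbrs_subset[OF E(1)] unfolding gnew by blast
      ultimately show ?thesis unfolding V_Suc by auto
    qed
    have "(`) g ` edges (expansion r0 (Suc k) F) = (\<lambda>e. insert (g (?new e)) (g ` ?xe e)) ` edges F"
      unfolding edges_expansion xe_Suc image_image image_insert ..
    also have "\<dots> = (\<lambda>e. insert (x (f S ` ?xe e)) (f S ` ?xe e)) ` edges F"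
      using gnew gxe by (intro image_cong) auto
    also have "\<dots> = (\<lambda>s. insert (x s) s) ` (\<lambda>e. f S ` ?xe e) ` edges F" by (simp only: image_image)
    also have "\<dots> = ext (S, x)" unfolding S_eq[OF S, symmetric] ext_def by simp
    finally show "ext (S, x) = (`) g ` edges (expansion r0 (Suc k) F)" ..
    show "ext (S, x) \<subseteq> edges ({..<n}, E)"
      using xtop(1) unfolding ext_def top_nbrs_def by auto
  qed
  \<comment> \<open>Fixing \<open>T\<close> forces the copy to contain its projection and fixes
    \<open>card T\<close> of the choices; each of the other edges keeps its \<open>q\<close>
    choices.\<close>
  have count: "card {R \<in> ext ` ?\<X>. T \<subseteq> R} \<le> card {S \<in> \<G>. \<pi> ` T \<subseteq> S} * q ^ (?l - card T)
      \<and> card (\<pi> ` T) = card T \<and> card T \<le> ?l"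
    if ne: "{R \<in> ext ` ?\<X>. T \<subseteq> R} \<noteq> {}" and finT: "finite T" for T
  proof (intro conjI)
    obtain S0 x0 where S0: "S0 \<in> \<G>" "x0 \<in> PiE S0 (N S0)" "T \<subseteq> ext (S0, x0)" using ne by auto
    have inj: "inj_on \<pi> T" by (rule inj_on_subset[OF ext_inj_\<pi>[OF S0(1,2)] S0(3)])
    then show cT: "card (\<pi> ` T) = card T" by (rule card_image)
    have "\<pi> ` T \<subseteq> S0" using S0(3) \<pi>_ext[OF S0(1,2)] by blast
    then show "card T \<le> ?l" using cT cardS[OF S0(1)] card_mono[OF finS[OF S0(1)]] by metis
    \<comment> \<open>The forced choice at \<open>s\<close>: the top vertex of the element of
      \<open>T\<close> lying above \<open>s\<close>, unique because \<open>\<pi>\<close> is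
      injective on \<open>T\<close>.\<close>
    define h where "h s = Max (inv_into T \<pi> s)" for s
    let ?\<Y> = "SIGMA S:{S \<in> \<G>. \<pi> ` T \<subseteq> S}. PiE S (\<lambda>s. if s \<in> \<pi> ` T then {h s} else N S s)"
    have finY: "finite ?\<Y>"
      using fin\<G> finS finN by (intro finite_SigmaI finite_PiE) auto
    have "{R \<in> ext ` ?\<X>. T \<subseteq> R} \<subseteq> ext ` ?\<Y>"
    proof clarify
      fix S x assume S: "S \<in> \<G>" and x: "x \<in> PiE S (N S)" and T: "T \<subseteq> ext (S, x)"
      have "\<pi> ` T \<subseteq> S" using T \<pi>_ext[OF S x] by blast
      moreover have "x s = h s" if "s \<in> \<pi> ` T" for s
        using ext_mem[OF S x, of "inv_into T \<pi> s"] T inv_into_into[OF that] f_inv_into_f[OF that]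
        unfolding h_def by auto
      ultimately have "(S, x) \<in> ?\<Y>" using S x by (auto simp: PiE_iff)
      then show "ext (S, x) \<in> ext ` ?\<Y>" by (rule imageI)
    qed
    then have "card {R \<in> ext ` ?\<X>. T \<subseteq> R} \<le> card (ext ` ?\<Y>)"
      using finY by (intro card_mono) auto
    also have "\<dots> \<le> card ?\<Y>" by (rule card_image_le[OF finY])
    also have "\<dots> = (\<Sum>S\<in>{S \<in> \<G>. \<pi> ` T \<subseteq> S}. card (PiE S (\<lambda>s. if s \<in> \<pi> ` T then {h s} else N S s)))"
      using fin\<G> finS finN by (subst card_SigmaI) (auto intro!: finite_PiE)
    also have "\<dots> = (\<Sum>S\<in>{S \<in> \<G>. \<pi> ` T \<subseteq> S}. q ^ (?l - card T))"
    proof (rule sum.cong)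
      fix S assume "S \<in> {S \<in> \<G>. \<pi> ` T \<subseteq> S}"
      then have S: "S \<in> \<G>" and T: "\<pi> ` T \<subseteq> S" by auto
      have "card (PiE S (\<lambda>s. if s \<in> \<pi> ` T then {h s} else N S s)) = (\<Prod>s\<in>S. if s \<in> \<pi> ` T then 1 else q)"
        using finS[OF S] N(2)[OF S] by (subst card_PiE) (auto intro!: prod.cong)
      also have "\<dots> = (\<Prod>s\<in>S - \<pi> ` T. q)"
        by (rule prod.mono_neutral_cong_right) (use finS[OF S] in auto)
      also have "\<dots> = q ^ (?l - card T)"
        using card_Diff_subset[OF _ T] finT cT cardS[OF S] by simp
      finally show "card (PiE S (\<lambda>s. if s \<in> \<pi> ` T then {h s} else N S s)) = q ^ (?l - card T)" .
    qed simp
    finally show "card {R \<in> ext ` ?\<X>. T \<subseteq> R} \<le> card {S \<in> \<G>. \<pi> ` T \<subseteq> S} * q ^ (?l - card T)" by simp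
  qed
  have card_H: "card (ext ` ?\<X>) = card \<G> * q ^ ?l" using card_image[OF inj_ext] card_X by simp
  have Epos: "real (card E) > 0" using E(2) finE by (simp add: card_gt_0_iff)
  show ?thesis unfolding spread_def
  proof (intro exI[of _ "ext ` ?\<X>"] conjI allI impI)
    show "ext ` ?\<X> \<subseteq> edges ` copies (expansion r0 (Suc k) F) ({..<n}, E)" using copy by auto
    have "card (ext ` ?\<X>) \<noteq> 0" using card_H \<G>(2) fin\<G> q by (simp add: card_eq_0_iff)
    then show "ext ` ?\<X> \<noteq> {}" by fastforce
    fix T :: "nat set set" assume T: "T \<noteq> {}" "finite T"
    have "0 < \<rho> * (real (card A) * real q)" using \<rho> Epos by linarith
    moreover have "real (card A) * real q \<ge> 0" by simp
    ultimately have \<rho>0: "\<rho> > 0" and Aq: "real (card A) * real q > 0"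
      unfolding zero_less_mult_iff by linarith+
    have A0: "real (card A) > 0" using Aq by (simp add: zero_less_mult_iff)
    show "real (card {S \<in> ext ` ?\<X>. T \<subseteq> S}) \<le> \<rho> * \<gamma> * real (card (ext ` ?\<X>)) / real (card E) *
         (\<rho> * \<tau> / real (card E)) ^ (card T - 1)"
    proof (cases "{R \<in> ext ` ?\<X>. T \<subseteq> R} = {}")
      case True
      show ?thesis unfolding True using \<rho>0 nonneg by simp
    next
      case False
      note c = count[OF False T(2)]
      obtain i where i: "card T = Suc i" using T by (metis card_eq_0_iff not0_implies_Suc)
      then have "?l = (?l - card T) + Suc i" using c by linarith
      then have "real q ^ ?l = real q ^ ((?l - card T) + Suc i)" by (rule arg_cong)
      then have l: "real q ^ ?l = real q ^ (?l - card T) * (real q * real q ^ i)" by (simp add: power_add)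
      \<comment> \<open>The only use of the size of \<open>\<rho>\<close>: each of the
        \<open>card T\<close> factors \<open>1 / (card A * q)\<close> is traded for
        \<open>\<rho> / card E\<close>.\<close>
      have inv: "1 / (real (card A) * real q) \<le> \<rho> / real (card E)"
        using \<rho> Aq Epos by (simp add: field_simps)
      have "real (card {S \<in> ext ` ?\<X>. T \<subseteq> S}) \<le> real (card {S \<in> \<G>. \<pi> ` T \<subseteq> S}) * real q ^ (?l - card T)"
        using of_nat_mono[OF conjunct1[OF c]] unfolding of_nat_mult of_nat_power .
      also have "\<dots> \<le> (\<gamma> * real (card \<G>) / real (card A) * (\<tau> / real (card A)) ^ i) * real q ^ (?l - card T)"
      proof (rule mult_right_mono)
        have "\<pi> ` T \<noteq> {}" "finite (\<pi> ` T)" "card (\<pi> ` T) - 1 = i" using T c i by simp_all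
        then show "real (card {S \<in> \<G>. \<pi> ` T \<subseteq> S}) \<le>
            \<gamma> * real (card \<G>) / real (card A) * (\<tau> / real (card A)) ^ i"
          using \<G>(3)[of "\<pi> ` T"] by simp
      qed simp
      also have "\<dots> = (\<gamma> * (real (card \<G>) * real q ^ ?l)) * (1 / (real (card A) * real q)) *
          (\<tau> * (1 / (real (card A) * real q))) ^ i"
        unfolding l power_mult_distrib power_divide using q A0 by simp
      also have "\<dots> \<le> (\<gamma> * (real (card \<G>) * real q ^ ?l)) * (\<rho> / real (card E)) *
          (\<tau> * (\<rho> / real (card E))) ^ i"
        using nonneg inv Aq by (intro scale_mono) simp_all
      also have "\<dots> = \<rho> * \<gamma> * real (card (ext ` ?\<X>)) / real (card E) * (\<rho> * \<tau> / real (card E)) ^ (card T - 1)"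
        unfolding card_H i by (simp add: mult_ac)
      finally show ?thesis .
    qed
  qed
qed

section \<open>Choosing the degree threshold for the lift\<close>

lemma sum_inverse_le: "n \<ge> 1 \<Longrightarrow> (\<Sum>q = 1..n. 1 / real q) \<le> 1 + ln (real n)"
proof (induction n rule: nat_induct_at_least)
  case (Suc n)
  have "ln (real n / real (Suc n)) \<le> real n / real (Suc n) - 1"
    using Suc.hyps by (intro ln_le_minus_one) simp
  moreover have "real n / real (Suc n) - 1 = - (1 / real (Suc n))" by (simp add: field_simps)
  moreover have "ln (real n / real (Suc n)) = ln (real n) - ln (real (Suc n))"
    using Suc.hyps by (simp add: ln_div)
  ultimately show ?case using Suc.IH by simp
qed simp

text \<open>Otherwise summing \<open>card {s \<in> Z. q \<le> d s}\<close> over \<open>q\<close> gives a harmonic sum that is less than \<open>m\<close>.\<close>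

lemma threshold_pigeonhole:
  fixes d :: "'b \<Rightarrow> nat" and m :: real
  assumes Z: "finite Z" and d: "\<And>s. s \<in> Z \<Longrightarrow> d s \<le> n" and m: "m > 0" "m \<le> real (\<Sum>s\<in>Z. d s)"
    and K: "real (card Z * K) \<le> m / 2" and n: "ln (real n) \<ge> 1"
  shows "\<exists>q>K. m / (4 * real n) \<le> real (card {s\<in>Z. q \<le> d s}) \<and>
    m / (16 * ln (real n)) \<le> real q * real (card {s\<in>Z. q \<le> d s})"
proof (rule ccontr)
  assume contra: "\<not> ?thesis"
  let ?a = "\<lambda>q. real (card {s\<in>Z. q \<le> d s})"
  have n1: "n \<ge> 1" using n by (cases n) auto
  have "(\<Sum>s\<in>Z. d s) = (\<Sum>s\<in>Z. \<Sum>q\<in>{1..n}. if q \<le> d s then 1 else 0)"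
  proof (rule sum.cong)
    fix s assume s: "s \<in> Z"
    have "(\<Sum>q\<in>{1..n}. if q \<le> d s then 1 else (0::nat)) = (\<Sum>q\<in>{1..d s}. 1)"
      by (rule sum.mono_neutral_cong_right) (use d[OF s] in auto)
    then show "d s = (\<Sum>q\<in>{1..n}. if q \<le> d s then 1 else 0)" by simp
  qed simp
  also have "\<dots> = (\<Sum>q\<in>{1..n}. card {s\<in>Z. q \<le> d s})"
    using Z by (subst sum.swap, intro sum.cong) (simp_all add: sum.If_cases Int_def)
  finally have "m \<le> (\<Sum>q\<in>{1..n}. ?a q)" using m(2) by simp
  also have "\<dots> \<le> (\<Sum>q\<in>{1..n}. (if q \<le> K then real (card Z) else 0)
      + (m / (4 * real n) + m / (16 * ln (real n)) * (1 / real q)))"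
  proof (rule sum_mono)
    fix q assume q: "q \<in> {1..n}"
    have pos: "0 \<le> m / (4 * real n)" "0 \<le> m / (16 * ln (real n)) * (1 / real q)" using m(1) n by auto
    show "?a q \<le> (if q \<le> K then real (card Z) else 0)
      + (m / (4 * real n) + m / (16 * ln (real n)) * (1 / real q))"
    proof (cases "q \<le> K")
      case True
      have "?a q \<le> real (card Z)" using Z by (simp add: card_mono)
      then show ?thesis using True pos by simp
    next
      case False
      then have "\<not> (m / (4 * real n) \<le> ?a q \<and> m / (16 * ln (real n)) \<le> real q * ?a q)"
        using contra by (meson linorder_not_le)
      then consider "?a q < m / (4 * real n)" | "real q * ?a q < m / (16 * ln (real n))"
        by linarith
      then show ?thesis
      proof cases
        case 2
        then have "?a q < m / (16 * ln (real n)) / real q"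
          using q by (subst pos_less_divide_eq) (auto simp: mult.commute)
        then show ?thesis using pos False by simp
      qed (use pos False in simp)
    qed
  qed
  also have "\<dots> = (\<Sum>q\<in>{1..n}. if q \<le> K then real (card Z) else 0)
      + real n * (m / (4 * real n)) + m / (16 * ln (real n)) * (\<Sum>q\<in>{1..n}. 1 / real q)"
    by (simp add: sum.distrib sum_distrib_left)
  \<comment> \<open>The three terms come from \<open>q \<le> K\<close>, from thresholds met by too
    few elements, and from thresholds with too small a product. The last is a harmonic sum, at most
    \<open>2 * ln n\<close>. Together they stay below \<open>m\<close>.\<close>
  also have "\<dots> \<le> m / 2 + m / 4 + m / 8"
  proof (intro add_mono)
    have "(\<Sum>q\<in>{1..n}. if q \<le> K then real (card Z) else 0) = (\<Sum>q\<in>{1..n} \<inter> {..K}. real (card Z))"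
      by (rule sum.mono_neutral_cong_right) auto
    also have "\<dots> \<le> real (card Z * K)"
    proof -
      have "card ({1..n} \<inter> {..K}) \<le> card {1..K}" by (intro card_mono) auto
      then have "card ({1..n} \<inter> {..K}) * card Z \<le> card Z * K" by (simp add: mult.commute mult_right_mono)
      then show ?thesis unfolding sum_constant of_nat_mult[symmetric] by (rule of_nat_mono)
    qed
    finally show "(\<Sum>q\<in>{1..n}. if q \<le> K then real (card Z) else 0) \<le> m / 2" using K by linarith
    show "real n * (m / (4 * real n)) \<le> m / 4" using n1 by simp
    have "(\<Sum>q\<in>{1..n}. 1 / real q) \<le> 2 * ln (real n)" using sum_inverse_le[OF n1] n by linarith
    then have "m / (16 * ln (real n)) * (\<Sum>q\<in>{1..n}. 1 / real q) \<le> m / (16 * ln (real n)) * (2 * ln (real n))"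
      using m(1) n by (intro mult_left_mono) auto
    also have "\<dots> = m / 8" using n by simp
    finally show "m / (16 * ln (real n)) * (\<Sum>q\<in>{1..n}. 1 / real q) \<le> m / 8" .
  qed
  finally show False using m(1) by linarith
qed

lemma card_r_subsets: "card (r_subsets r n) = n choose r"
  unfolding r_subsets_def using n_subsets[of "{..<n}" r] by simp

lemma choose_le_power: "n choose r \<le> n ^ r"
proof (cases "r \<le> n")
  case True
  then show ?thesis by (rule binomial_le_pow)
qed (simp add: binomial_eq_0)

text \<open>Every edge is the image of the pair formed by the edge without its maximum and that
  maximum.\<close>

lemma card_le_sum_top_nbrs:
  assumes E: "E \<subseteq> r_subsets (Suc k) n"
  shows "card E \<le> (\<Sum>s\<in>r_subsets k n. card (top_nbrs E s))"
proof -
  let ?S = "SIGMA s:r_subsets k n. top_nbrs E s"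
  have fin: "finite (top_nbrs E s)" for s
    by (rule finite_subset[OF top_nbrs_subset[OF E]]) simp
  have "E \<subseteq> (\<lambda>(s, x). insert x s) ` ?S"
  proof
    fix e assume e: "e \<in> E"
    then have "e \<subseteq> {..<n}" "card e = Suc k" using E unfolding r_subsets_def by auto
    moreover from this have "finite e" "e \<noteq> {}" by (auto dest: finite_subset)
    ultimately have "e - {Max e} \<in> r_subsets k n" "Max e \<in> e"
      unfolding r_subsets_def by auto
    moreover from this have "insert (Max e) (e - {Max e}) = e" by blast
    moreover have "y < Max e" if "y \<in> e - {Max e}" for y
      using that Max_ge[OF \<open>finite e\<close>, of y] by (auto simp: le_less)
    ultimately have "(e - {Max e}, Max e) \<in> ?S" using e unfolding top_nbrs_def by auto
    then show "e \<in> (\<lambda>(s, x). insert x s) ` ?S"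
      using \<open>insert (Max e) (e - {Max e}) = e\<close> by (intro image_eqI[of _ _ "(e - {Max e}, Max e)"]) auto
  qed
  moreover have "finite ?S" using fin finite_r_subsets by blast
  ultimately have "card E \<le> card ?S" by (rule surj_card_le[rotated])
  then show ?thesis using fin finite_r_subsets by (subst (asm) card_SigmaI) auto
qed

lemma spread_mono:
  assumes "spread F n E \<gamma> \<tau>" "0 \<le> \<gamma>" "\<gamma> \<le> \<gamma>'" "0 \<le> \<tau>" "\<tau> \<le> \<tau>'"
  shows "spread F n E \<gamma>' \<tau>'"
proof -
  obtain \<H> where H: "\<H> \<subseteq> edges ` copies F ({..<n}, E)" "\<H> \<noteq> {}"
     "\<forall>T. T \<noteq> {} \<longrightarrow> finite T \<longrightarrow> real (card {S \<in> \<H>. T \<subseteq> S})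
        \<le> \<gamma> * real (card \<H>) / real (card E) * (\<tau> / real (card E)) ^ (card T - 1)"
    using assms(1) unfolding spread_def by blast
  show ?thesis unfolding spread_def
  proof (intro exI[of _ \<H>] conjI allI impI)
    fix T :: "nat set set" assume T: "T \<noteq> {}" "finite T"
    have "real (card {S \<in> \<H>. T \<subseteq> S})
        \<le> \<gamma> * real (card \<H>) / real (card E) * (\<tau> / real (card E)) ^ (card T - 1)" using H(3) T by blast
    also have "\<dots> \<le> \<gamma>' * real (card \<H>) / real (card E) * (\<tau>' / real (card E)) ^ (card T - 1)"
      using assms(2-5) by (intro mult_mono divide_right_mono power_mono mult_right_mono) auto
    finally show "real (card {S \<in> \<H>. T \<subseteq> S})
      \<le> \<gamma>' * real (card \<H>) / real (card E) * (\<tau>' / real (card E)) ^ (card T - 1)" .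
  qed (use H in auto)
qed

text \<open>The exponent \<open>a\<close> is a parameter that does not depend on \<open>k\<close>;
  only \<open>C\<close> and \<open>B\<close>, which are quantified inside, may grow along the
  induction on \<open>k\<close>.\<close>

definition eventually_spread :: "nat \<Rightarrow> 'a hypergraph \<Rightarrow> real \<Rightarrow> nat \<Rightarrow> bool" where
  "eventually_spread r0 F a k \<longleftrightarrow> (\<exists>C>0. \<exists>B>0. \<forall>\<^sub>F n in sequentially. \<forall>E \<subseteq> r_subsets k n.
     E \<noteq> {} \<longrightarrow> C * real n ^ (k - 1) \<le> real (card E) \<longrightarrow>
     spread (expansion r0 k F) n E (ln (real n) powr B) (real n powr a * ln (real n) powr B))"

lemma eventually_spread_Suc:
  assumes F: "r_graph r0 F" "edges F \<noteq> {}" and k: "r0 \<le> k" "1 \<le> k" and spread: "eventually_spread r0 F a k"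
  shows "eventually_spread r0 F a (Suc k)"
proof -
  obtain C B where C: "C > 0" and B: "B > 0" and ev: "\<forall>\<^sub>F n in sequentially. \<forall>E \<subseteq> r_subsets k n.
     E \<noteq> {} \<longrightarrow> C * real n ^ (k - 1) \<le> real (card E) \<longrightarrow>
     spread (expansion r0 k F) n E (ln (real n) powr B) (real n powr a * ln (real n) powr B)"
    using spread unfolding eventually_spread_def by (elim exE conjE) (rule that)
  define v where "v = card (verts (expansion r0 k F))"
  define l where "l = card (edges F)"
  have l: "l \<ge> 1" unfolding l_def using F finite_edges[OF F(1)] by (simp add: Suc_leI card_gt_0_iff)
  \<comment> \<open>A threshold \<open>q\<close> above \<open>v + l\<close> leaves at least one
    extension per edge after the \<open>v\<close> old vertices are set aside and the rest is shared
    among \<open>l\<close> edges.\<close>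
  define K where "K = v + l"
  \<comment> \<open>The 16 is the loss in the choice of the threshold, and \<open>v + 2 * l\<close>
    bounds the ratio of \<open>q\<close> to \<open>q'\<close>. Eventually \<open>c * ln n\<close> is
    at most the square of \<open>ln n\<close>, which is why \<open>B\<close> rises by 2.\<close>
  define c where "c = 16 * real (v + 2 * l)"
  have c: "c > 0" unfolding c_def using l by simp
  \<comment> \<open>\<open>4 * C\<close> keeps \<open>card A \<ge> card E / (4 * n)\<close> above
    the requirement of the induction hypothesis; \<open>2 * K\<close> makes the thresholds up to
    \<open>K\<close> account for at most half of \<open>card E\<close>.\<close>
  define C' where "C' = 4 * C + 2 * real K"
  have ev_c: "\<forall>\<^sub>F n in sequentially. c * ln (real n) \<le> ln (real n) powr 2" using c by real_asymp
  have ev_1: "\<forall>\<^sub>F n in sequentially. 1 \<le> ln (real n)" by real_asymp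
  have "\<forall>\<^sub>F n in sequentially. \<forall>E \<subseteq> r_subsets (Suc k) n.
     E \<noteq> {} \<longrightarrow> C' * real n ^ (Suc k - 1) \<le> real (card E) \<longrightarrow>
     spread (expansion r0 (Suc k) F) n E (ln (real n) powr (B + 2)) (real n powr a * ln (real n) powr (B + 2))"
    using ev ev_c ev_1
  proof eventually_elim
    case (elim n)
    show ?case
    proof (intro allI impI)
      fix E assume E: "E \<subseteq> r_subsets (Suc k) n" "E \<noteq> {}" and big: "C' * real n ^ (Suc k - 1) \<le> real (card E)"
      have n: "n \<ge> 1" using elim(3) by (cases n) auto
      have finE: "finite E" by (rule finite_subset[OF E(1) finite_r_subsets])
      then have m: "real (card E) > 0" using E(2) by (simp add: card_gt_0_iff)
      have "\<exists>q>K. real (card E) / (4 * real n) \<le> real (card {s\<in>r_subsets k n. q \<le> card (top_nbrs E s)}) \<and>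
        real (card E) / (16 * ln (real n)) \<le> real q * real (card {s\<in>r_subsets k n. q \<le> card (top_nbrs E s)})"
      proof (rule threshold_pigeonhole[OF finite_r_subsets _ m _ _ elim(3)])
        show "card (top_nbrs E s) \<le> n" for s
          using card_mono[OF _ top_nbrs_subset[OF E(1)], of s] by simp
        show "real (card E) \<le> real (\<Sum>s\<in>r_subsets k n. card (top_nbrs E s))"
          using card_le_sum_top_nbrs[OF E(1)] by (rule of_nat_mono)
        have "real (card (r_subsets k n) * K) \<le> real n ^ k * real K"
          unfolding card_r_subsets using choose_le_power[of n k]
          by (metis mult_right_mono of_nat_0_le_iff of_nat_le_iff of_nat_mult of_nat_power)
        also have "\<dots> \<le> C' * real n ^ k / 2" unfolding C'_def using C by (simp add: algebra_simps)
        finally show "real (card (r_subsets k n) * K) \<le> real (card E) / 2" using big by simp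
      qed
      then obtain q where q: "q > K" and
        A1: "real (card E) / (4 * real n) \<le> real (card {s\<in>r_subsets k n. q \<le> card (top_nbrs E s)})" and
        A2: "real (card E) / (16 * ln (real n)) \<le> real q * real (card {s\<in>r_subsets k n. q \<le> card (top_nbrs E s)})"
        by blast
      define A where "A = {s\<in>r_subsets k n. q \<le> card (top_nbrs E s)}"
      \<comment> \<open>The largest number with \<open>v + l * q' \<le> q\<close>, as the extension
        of copies requires.\<close>
      define q' where "q' = (q - v) div l"
      have q'1: "q' \<ge> 1" unfolding q'_def using q l unfolding K_def by (simp add: div_greater_zero_iff Suc_leI)
      have "l * q' \<le> q - v" unfolding q'_def by simp
      then have lq': "v + l * q' \<le> q" using q unfolding K_def by linarith
      have "q - v < l * (q' + 1)" unfolding q'_def using l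
        by (metis add.commute dividend_less_times_div less_le_trans mult_Suc_right plus_1_eq_Suc zero_less_one)
      then have "q < v + l * q' + l" by (simp add: algebra_simps)
      also have "\<dots> \<le> v * q' + l * q' + l * q'" using q'1 by (intro add_mono) auto
      finally have q_le: "q \<le> (v + 2 * l) * q'" by (simp add: algebra_simps)
      have "C * real n ^ (k - 1) \<le> C' * real n ^ k / (4 * real n)"
      proof -
        have "real n ^ k = real n * real n ^ (k - 1)" using k(2) by (cases k) auto
        then have "C' * real n ^ k / (4 * real n) = C' / 4 * real n ^ (k - 1)" using n by simp
        moreover have "C * real n ^ (k - 1) \<le> C' / 4 * real n ^ (k - 1)"
          unfolding C'_def by (intro mult_right_mono) auto
        ultimately show ?thesis by simp
      qed
      also have "\<dots> \<le> real (card E) / (4 * real n)" using big by (intro divide_right_mono) auto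
      finally have bigA: "C * real n ^ (k - 1) \<le> real (card A)" using A1 unfolding A_def by linarith
      have "0 < real (card E) / (4 * real n)" using m n by simp
      then have "real (card A) > 0" using A1 unfolding A_def by linarith
      then have neA: "A \<noteq> {}" by auto
      have subA: "A \<subseteq> r_subsets k n" unfolding A_def by blast
      have spreadA: "spread (expansion r0 k F) n A (ln (real n) powr B) (real n powr a * ln (real n) powr B)"
        by (rule elim(1)[rule_format, OF subA neA bigA])
      let ?\<rho> = "c * ln (real n)"
      have "spread (expansion r0 (Suc k) F) n E (?\<rho> * (ln (real n) powr B)) (?\<rho> * (real n powr a * ln (real n) powr B))"
      proof (rule spread_lift[OF F(1) k(1) E _ q'1 _ spreadA])
        show "A \<subseteq> r_subsets k n" by (rule subA)
        show "card (verts (expansion r0 k F)) + card (edges F) * q' \<le> card (top_nbrs E s)" if "s \<in> A" for s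
          using that lq' unfolding A_def v_def l_def by simp
        have "real (card E) \<le> 16 * ln (real n) * (real q * real (card A))"
          using A2 elim(3) unfolding A_def by (simp add: field_simps)
        also have "\<dots> \<le> 16 * ln (real n) * ((real (v + 2 * l) * real q') * real (card A))"
          using of_nat_mono[OF q_le, where 'a = real] elim(3)
          unfolding of_nat_mult by (intro mult_left_mono mult_right_mono) simp_all
        finally show "real (card E) \<le> ?\<rho> * (real (card A) * real q')"
          unfolding c_def by (simp add: mult_ac)
      qed auto
      then show "spread (expansion r0 (Suc k) F) n E (ln (real n) powr (B + 2)) (real n powr a * ln (real n) powr (B + 2))"
      proof (rule spread_mono)
        have *: "?\<rho> * ln (real n) powr B \<le> ln (real n) powr (B + 2)"
          using mult_right_mono[OF elim(2), of "ln (real n) powr B"] by (simp add: powr_add mult.commute)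
        then show "?\<rho> * ln (real n) powr B \<le> ln (real n) powr (B + 2)" .
        show "?\<rho> * (real n powr a * ln (real n) powr B) \<le> real n powr a * ln (real n) powr (B + 2)"
          using mult_left_mono[OF *, of "real n powr a"] by (simp add: mult_ac)
      qed (use c elim(3) in auto)
    qed
  qed
  moreover have "C' > 0" "B + 2 > 0" unfolding C'_def using C B by (auto intro: add_pos_nonneg)
  ultimately show ?thesis unfolding eventually_spread_def by blast
qed

section \<open>From the balanced hypothesis to every uniformity\<close>

lemma expansion_self: "expansion r0 r0 F = (Inl ` verts F, (`) Inl ` edges F)"
  unfolding expansion_def by simp

text \<open>No vertices are added here; embeddings are translated by composing with
  \<open>Inl\<close> in one direction and with \<open>projl\<close> in the other.\<close>

lemma edges_copies_expansion_self:
  assumes "\<forall>e\<in>edges F. e \<subseteq> verts F"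
  shows "edges ` copies (expansion r0 r0 F) H = edges ` copies F H"
proof (intro set_eqI)
  fix S
  have sub: "\<forall>e\<in>edges (expansion r0 r0 F). e \<subseteq> verts (expansion r0 r0 F)"
    using assms by (rule expansion_edges_subset)
  show "S \<in> edges ` copies (expansion r0 r0 F) H \<longleftrightarrow> S \<in> edges ` copies F H"
    unfolding edges_copies_iff[OF assms] edges_copies_iff[OF sub]
    unfolding expansion_self fst_conv snd_conv
  proof (intro iffI; elim exE conjE)
    fix f assume "inj_on f (Inl ` verts F)" "f ` Inl ` verts F \<subseteq> verts H"
      "S = (`) f ` (`) Inl ` edges F" "S \<subseteq> edges H"
    then show "\<exists>f. inj_on f (verts F) \<and> f ` verts F \<subseteq> verts H \<and> S = (`) f ` edges F \<and> S \<subseteq> edges H"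
      by (intro exI[of _ "\<lambda>v. f (Inl v)"]) (simp add: inj_on_def image_image)
  next
    fix f assume "inj_on f (verts F)" "f ` verts F \<subseteq> verts H" "S = (`) f ` edges F" "S \<subseteq> edges H"
    then show "\<exists>f. inj_on f (Inl ` verts F) \<and> f ` Inl ` verts F \<subseteq> verts H \<and>
        S = (`) f ` (`) Inl ` edges F \<and> S \<subseteq> edges H"
      by (intro exI[of _ "\<lambda>v. f (projl v)"]) (simp add: image_image inj_on_def)
  qed
qed

lemma card_copy_edges:
  assumes "S \<in> edges ` copies F H" "\<forall>e\<in>edges F. e \<subseteq> verts F"
  shows "card S = card (edges F)" "S \<subseteq> edges H"
proof -
  obtain f where f: "inj_on f (verts F) \<and> f ` verts F \<subseteq> verts H \<and> S = (`) f ` edges F \<and> S \<subseteq> edges H"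
    using assms(1) unfolding edges_copies_iff[OF assms(2)] ..
  have "inj_on ((`) f) (edges F)"
    by (rule inj_on_image, rule inj_on_subset[OF conjunct1[OF f]]) (use assms(2) in blast)
  then have "card ((`) f ` edges F) = card (edges F)" by (rule card_image)
  then show "card S = card (edges F)" using f by simp
  show "S \<subseteq> edges H" using f by blast
qed

text \<open>A set \<open>T\<close> inside some copy is a set of at most
  \<open>card (edges F)\<close> edges of \<open>E\<close>, so its degree is one of the values under
  the maximum; any other \<open>T\<close> has degree 0.\<close>

lemma eventually_spread_base:
  assumes F: "r_graph r0 F" and C: "C0 > 0"
    and bal: "balanced r0 F (\<lambda>n. C0 * real n ^ (r0 - 1)) (\<lambda>n. ln (real n) powr C0)
             (\<lambda>n m. real n powr a * ln (real n) powr C0)"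
  shows "eventually_spread r0 F a r0"
  unfolding eventually_spread_def
proof (intro exI[of _ C0] conjI C)
  have sub: "\<forall>e\<in>edges F. e \<subseteq> verts F" using F unfolding r_graph_def by blast
  show "\<forall>\<^sub>F n in sequentially. \<forall>E \<subseteq> r_subsets r0 n.
     E \<noteq> {} \<longrightarrow> C0 * real n ^ (r0 - 1) \<le> real (card E) \<longrightarrow>
     spread (expansion r0 r0 F) n E (ln (real n) powr C0) (real n powr a * ln (real n) powr C0)"
    using bal unfolding balanced_def
  proof eventually_elim
    case (elim n)
    show ?case
    proof (intro allI impI)
      fix E assume E: "E \<subseteq> r_subsets r0 n" "E \<noteq> {}" and big: "C0 * real n ^ (r0 - 1) \<le> real (card E)"
      have finE: "finite E" by (rule finite_subset[OF E(1) finite_r_subsets])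
      let ?H = "({..<n}, E)"
      have "r_graph r0 ?H" using E(1) unfolding r_graph_def r_subsets_def by auto
      then have "\<exists>\<H>. \<H> \<subseteq> edges ` copies F ?H \<and> \<H> \<noteq> {} \<and>
          (\<forall>i. 1 \<le> i \<and> i \<le> card (edges F) \<longrightarrow>
             real (max_set_degree i (edges ?H, \<H>))
               \<le> ln (real n) powr C0 * real (card \<H>) / real (card E) *
                 (real n powr a * ln (real n) powr C0 / real (card E)) ^ (i - 1))"
        using elim[rule_format, of ?H "card E"] big by simp
      then obtain \<H> where H: "\<H> \<subseteq> edges ` copies F ?H" "\<H> \<noteq> {}" and
          deg: "\<And>i. 1 \<le> i \<Longrightarrow> i \<le> card (edges F) \<Longrightarrow>
             real (max_set_degree i (E, \<H>))
               \<le> ln (real n) powr C0 * real (card \<H>) / real (card E) *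
                 (real n powr a * ln (real n) powr C0 / real (card E)) ^ (i - 1)"
        by (elim exE conjE) (simp add: that)
      show "spread (expansion r0 r0 F) n E (ln (real n) powr C0) (real n powr a * ln (real n) powr C0)"
        unfolding spread_def edges_copies_expansion_self[OF sub]
      proof (intro exI[of _ \<H>] conjI allI impI H)
        fix T :: "nat set set" assume T: "T \<noteq> {}" "finite T"
        show "real (card {S \<in> \<H>. T \<subseteq> S}) \<le> ln (real n) powr C0 * real (card \<H>) / real (card E) *
             (real n powr a * ln (real n) powr C0 / real (card E)) ^ (card T - 1)"
        proof (cases "{S \<in> \<H>. T \<subseteq> S} = {}")
          case True
          show ?thesis unfolding True by simp
        next
          case False
          then obtain S where S: "S \<in> \<H>" "T \<subseteq> S" by blast
          then have cS: "card S = card (edges F)" "S \<subseteq> E"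
            using card_copy_edges[OF subsetD[OF H(1) S(1)] sub] by simp_all
          then have TE: "T \<subseteq> E" and cT: "card T \<le> card (edges F)" "1 \<le> card T"
            using S T finE card_mono[OF finite_subset[OF cS(2) finE] S(2)]
            by (auto simp: Suc_le_eq card_gt_0_iff)
          have "card {S \<in> \<H>. T \<subseteq> S} \<le> max_set_degree (card T) (E, \<H>)"
            unfolding max_set_degree_def
          proof (rule Max_ge)
            show "finite {set_degree (E, \<H>) S |S. S \<subseteq> verts (E, \<H>) \<and> card S = card T}"
              by (rule finite_subset[of _ "set_degree (E, \<H>) ` Pow E"]) (use finE in auto)
            show "card {S \<in> \<H>. T \<subseteq> S} \<in> {set_degree (E, \<H>) S |S. S \<subseteq> verts (E, \<H>) \<and> card S = card T}"
              using TE by (auto simp: set_degree_def)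
          qed
          then show ?thesis using deg[OF cT(2,1)] by linarith
        qed
      qed
    qed
  qed
qed

lemma eventually_spread_expansion:
  assumes "r_graph r0 F" "edges F \<noteq> {}" "1 \<le> r0" "eventually_spread r0 F a r0" "r0 \<le> r"
  shows "eventually_spread r0 F a r"
  using assms(5)
proof (induction r rule: dec_induct)
  case (step k)
  then show ?case using assms by (intro eventually_spread_Suc) auto
qed (rule assms(4))

section \<open>Random subsets\<close>

text \<open>The random edge set without its constant vertex set, over a general ground set.\<close>

definition random_subset :: "'b set \<Rightarrow> real \<Rightarrow> 'b set pmf" where
  "random_subset A p = map_pmf (\<lambda>f. {e \<in> A. f e}) (Pi_pmf A False (\<lambda>_. bernoulli_pmf p))"

lemma random_r_graph_eq: "random_r_graph r n p = map_pmf (Pair {..<n}) (random_subset (r_subsets r n) p)"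
  unfolding random_r_graph_def random_subset_def by (simp add: map_pmf_comp)

lemma set_random_subset: "set_pmf (random_subset A p) \<subseteq> Pow A"
  unfolding random_subset_def by auto

lemma finite_set_random_subset: "finite A \<Longrightarrow> finite (set_pmf (random_subset A p))"
  by (rule finite_subset[OF set_random_subset]) simp

lemma integrable_random_subset [simp]:
  fixes f :: "'b set \<Rightarrow> real"
  shows "finite A \<Longrightarrow> integrable (measure_pmf (random_subset A p)) f"
  by (intro integrable_measure_pmf_finite finite_set_random_subset)

lemma prob_random_subset_superset:
  assumes "finite A" "S \<subseteq> A" "0 \<le> p" "p \<le> 1"
  shows "measure_pmf.prob (random_subset A p) {R. S \<subseteq> R} = p ^ card S"
proof -
  have "measure_pmf.prob (random_subset A p) {R. S \<subseteq> R} =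
      measure_pmf.prob (Pi_pmf A False (\<lambda>_. bernoulli_pmf p)) (Pi A (\<lambda>e. if e \<in> S then {True} else UNIV))"
    unfolding random_subset_def measure_map_pmf
    by (rule arg_cong2[where f = measure]) (use assms(2) in \<open>auto simp: Pi_def vimage_def\<close>)
  also have "\<dots> = (\<Prod>e\<in>A. measure_pmf.prob (bernoulli_pmf p) (if e \<in> S then {True} else UNIV))"
    by (rule measure_Pi_pmf_Pi[OF assms(1)])
  also have "\<dots> = (\<Prod>e\<in>S. p)"
    by (rule prod.mono_neutral_cong_right) (use assms in \<open>auto simp: measure_pmf_single\<close>)
  finally show ?thesis by simp
qed

lemma expectation_random_subset_superset:
  assumes "finite A" "S \<subseteq> A" "0 \<le> p" "p \<le> 1"
  shows "measure_pmf.expectation (random_subset A p) (\<lambda>R. if S \<subseteq> R then 1 else 0) = p ^ card S"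
proof -
  have "measure_pmf.expectation (random_subset A p) (\<lambda>R. if S \<subseteq> R then 1 else 0) =
      measure_pmf.expectation (random_subset A p) (indicator {R. S \<subseteq> R})"
    by (rule Bochner_Integration.integral_cong) (auto simp: indicator_def)
  also have "\<dots> = measure_pmf.prob (random_subset A p) {R. S \<subseteq> R}"
    by (simp only: Bochner_Integration.integral_indicator space_measure_pmf Int_UNIV_right)
  finally show ?thesis by (simp only: prob_random_subset_superset[OF assms])
qed

lemma expectation_count:
  assumes "finite A" "finite \<X>" "\<And>S. S \<in> \<X> \<Longrightarrow> S \<subseteq> A" "0 \<le> p" "p \<le> 1"
  shows "measure_pmf.expectation (random_subset A p) (\<lambda>R. real (card {S\<in>\<X>. S \<subseteq> R})) = (\<Sum>S\<in>\<X>. p ^ card S)"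
proof -
  have "real (card {S\<in>\<X>. S \<subseteq> R}) = (\<Sum>S\<in>\<X>. if S \<subseteq> R then 1 else 0)" for R
    using assms(2) by (simp add: sum.If_cases Int_def)
  then have "measure_pmf.expectation (random_subset A p) (\<lambda>R. real (card {S\<in>\<X>. S \<subseteq> R})) =
      (\<Sum>S\<in>\<X>. measure_pmf.expectation (random_subset A p) (\<lambda>R. if S \<subseteq> R then 1 else 0))"
    using assms(1) by simp
  also have "\<dots> = (\<Sum>S\<in>\<X>. p ^ card S)"
    by (intro sum.cong expectation_random_subset_superset assms) auto
  finally show ?thesis .
qed

lemma random_subset_markov:
  fixes f :: "'b set \<Rightarrow> real"
  assumes "finite A" "\<And>R. f R \<ge> 0" "t > 0" "measure_pmf.expectation (random_subset A p) f \<le> c"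
  shows "measure_pmf.prob (random_subset A p) {R. f R \<ge> t} \<le> c / t"
proof -
  have "measure_pmf.prob (random_subset A p) {R. f R \<ge> t} \<le> measure_pmf.expectation (random_subset A p) f / t"
    using integral_Markov_inequality_measure[of "random_subset A p" f UNIV t] assms by simp
  also have "\<dots> \<le> c / t" using assms by (intro divide_right_mono) auto
  finally show ?thesis .
qed

lemma random_subset_chebyshev:
  assumes A: "finite A" "B \<subseteq> A" and p: "0 \<le> p" "p \<le> 1" and t: "t > 0"
  shows "measure_pmf.prob (random_subset A p) {R. \<bar>real (card (R \<inter> B)) - p * card B\<bar> \<ge> t} \<le> p * card B / t ^ 2"
proof -
  define \<mu> where "\<mu> = p * card B"
  have finB: "finite B" using A finite_subset by blast
  let ?E = "measure_pmf.expectation (random_subset A p)"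
  have X: "real (card (R \<inter> B)) = (\<Sum>e\<in>B. if {e} \<subseteq> R then 1 else 0)" for R
    using finB by (simp add: sum.If_cases Int_def conj_commute)
  \<comment> \<open>The square is again a sum of containment events, so one expectation formula
    covers both moments.\<close>
  have X2: "(real (card (R \<inter> B)))\<^sup>2 = (\<Sum>e\<in>B. \<Sum>e'\<in>B. if {e, e'} \<subseteq> R then 1 else 0)" for R
    unfolding X power2_eq_square sum_product by (intro sum.cong) auto
  have EX: "?E (\<lambda>R. real (card (R \<inter> B))) = \<mu>"
  proof -
    have "?E (\<lambda>R. real (card (R \<inter> B))) = (\<Sum>e\<in>B. ?E (\<lambda>R. if {e} \<subseteq> R then 1 else 0))"
      unfolding X using A by (intro Bochner_Integration.integral_sum) auto
    also have "\<dots> = (\<Sum>e\<in>B. p ^ card {e})"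
      by (intro sum.cong expectation_random_subset_superset) (use A p in auto)
    finally show ?thesis unfolding \<mu>_def by simp
  qed
  have "?E (\<lambda>R. (real (card (R \<inter> B)))\<^sup>2) = (\<Sum>e\<in>B. \<Sum>e'\<in>B. ?E (\<lambda>R. if {e, e'} \<subseteq> R then 1 else 0))"
    unfolding X2 using A by (subst Bochner_Integration.integral_sum, simp, intro sum.cong refl Bochner_Integration.integral_sum) auto
  also have "\<dots> = (\<Sum>e\<in>B. \<Sum>e'\<in>B. p ^ card {e, e'})"
    by (intro sum.cong expectation_random_subset_superset) (use A p in auto)
  \<comment> \<open>Pairs of distinct elements contribute \<open>p ^ 2\<close>, and a diagonal pair,
    where \<open>card {e, e'} = 1\<close>, contributes \<open>p\<close>.\<close>
  also have "\<dots> \<le> (\<Sum>e\<in>B. \<Sum>e'\<in>B. p\<^sup>2 + (if e' = e then p else 0))"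
    by (intro sum_mono) (use p in \<open>auto simp: power2_eq_square\<close>)
  also have "\<dots> = \<mu>\<^sup>2 + \<mu>"
    using finB by (simp add: sum.distrib \<mu>_def power2_eq_square algebra_simps)
  finally have EX2: "?E (\<lambda>R. (real (card (R \<inter> B)))\<^sup>2) \<le> \<mu>\<^sup>2 + \<mu>" .
  have "?E (\<lambda>R. (real (card (R \<inter> B)) - \<mu>)\<^sup>2) =
      ?E (\<lambda>R. (real (card (R \<inter> B)))\<^sup>2 - 2 * \<mu> * real (card (R \<inter> B)) + \<mu>\<^sup>2)"
    by (simp add: power2_diff algebra_simps)
  also have "\<dots> = ?E (\<lambda>R. (real (card (R \<inter> B)))\<^sup>2) - 2 * \<mu> * ?E (\<lambda>R. real (card (R \<inter> B))) + \<mu>\<^sup>2"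
    using A by simp
  also have "\<dots> \<le> \<mu>" using EX2 unfolding EX by (simp add: power2_eq_square)
  finally have "measure_pmf.prob (random_subset A p) {R. (real (card (R \<inter> B)) - \<mu>)\<^sup>2 \<ge> t\<^sup>2} \<le> \<mu> / t\<^sup>2"
    using t A by (intro random_subset_markov) auto
  moreover have "t\<^sup>2 \<le> (real (card (R \<inter> B)) - \<mu>)\<^sup>2 \<longleftrightarrow> t \<le> \<bar>real (card (R \<inter> B)) - \<mu>\<bar>" for R
    using t abs_le_square_iff[of t "real (card (R \<inter> B)) - \<mu>"] by simp
  ultimately show ?thesis unfolding \<mu>_def by simp
qed

text \<open>Deletion method: a subset \<open>R\<close> maximizing its size minus the number of
  members of \<open>\<X>\<close> inside does at least as well as the average over a random subset of
  density \<open>s\<close>. Removing one element from each such member gives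
  \<open>J\<close>.\<close>

lemma independent_subset_exists:
  assumes A: "finite A" and X: "finite \<X>" "\<And>S. S \<in> \<X> \<Longrightarrow> S \<subseteq> A \<and> card S = k" "k \<ge> 1"
    and s: "0 \<le> s" "s \<le> 1"
  shows "\<exists>J\<subseteq>A. (\<forall>S\<in>\<X>. \<not> S \<subseteq> J) \<and> s * real (card A) - s ^ k * real (card \<X>) \<le> real (card J)"
proof -
  let ?v = "\<lambda>R. real (card (R \<inter> A)) - real (card {S\<in>\<X>. S \<subseteq> R})"
  have "finite (?v ` Pow A)" "?v ` Pow A \<noteq> {}" using A by auto
  then have "Max (?v ` Pow A) \<in> ?v ` Pow A" by (rule Max_in)
  then obtain R where R: "R \<subseteq> A" "Max (?v ` Pow A) = ?v R" by (elim imageE) (simp add: that)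
  have max: "?v R' \<le> ?v R" if "R' \<subseteq> A" for R'
    unfolding R(2)[symmetric] using A that by (intro Max_ge) auto
  have "measure_pmf.expectation (random_subset A s) ?v \<le> ?v R"
  proof (rule measure_pmf.integral_le_const)
    show "AE R' in measure_pmf (random_subset A s). ?v R' \<le> ?v R"
      unfolding AE_measure_pmf_iff using set_random_subset[of A s] max by blast
  qed (use A in simp)
  moreover have "real (card (R \<inter> A)) = real (card {S \<in> (\<lambda>e. {e}) ` A. S \<subseteq> R})" for R
  proof -
    have "{S \<in> (\<lambda>e. {e}) ` A. S \<subseteq> R} = (\<lambda>e. {e}) ` (R \<inter> A)" by auto
    then show ?thesis by (simp add: card_image)
  qed
  then have "measure_pmf.expectation (random_subset A s) (\<lambda>R. real (card (R \<inter> A))) = s * card A"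
    using expectation_count[of A "(\<lambda>e. {e}) ` A" s] A s by (auto simp: sum.reindex mult.commute)
  moreover have "measure_pmf.expectation (random_subset A s) (\<lambda>R. real (card {S\<in>\<X>. S \<subseteq> R})) = s ^ k * real (card \<X>)"
    using expectation_count[OF A X(1) _ s] X(2) by simp
  ultimately have v: "s * card A - s ^ k * real (card \<X>) \<le> ?v R"
    using A by simp
  let ?Y = "{S\<in>\<X>. S \<subseteq> R}"
  have "\<forall>S\<in>?Y. \<exists>x. x \<in> S"
  proof
    fix S assume "S \<in> ?Y"
    then have "card S \<noteq> 0" using X(2)[of S] X(3) by simp
    then show "\<exists>x. x \<in> S" by (metis card.empty all_not_in_conv)
  qed
  from bchoice[OF this] obtain g where "\<forall>S\<in>?Y. g S \<in> S" ..
  then have g: "g S \<in> S" if "S \<in> ?Y" for S using that by (rule bspec)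
  let ?J = "R - g ` ?Y"
  have "card (g ` ?Y) \<le> card ?Y" using X(1) by (intro card_image_le) auto
  then have "card R - card ?Y \<le> card ?J" using diff_card_le_card_Diff[of "g ` ?Y" R] X(1) by simp
  then have "?v R \<le> real (card ?J)" using R by (simp add: Int_absorb2)
  moreover have "\<not> S \<subseteq> ?J" if "S \<in> \<X>" for S
  proof
    assume "S \<subseteq> ?J"
    then show False using g[of S] that by blast
  qed
  ultimately show ?thesis using R v by (intro exI[of _ ?J]) auto
qed

section \<open>Union bounds over containers\<close>

lemma power_le_exp_fact: "real M ^ M \<le> exp (real M) * fact M"
proof -
  have "(\<lambda>n. real M ^ n /\<^sub>R fact n) sums exp (real M)" by (rule exp_converges)
  then have "(\<Sum>n\<in>{M}. real M ^ n /\<^sub>R fact n) \<le> exp (real M)"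
    using sum_le_suminf[of "\<lambda>n. real M ^ n /\<^sub>R fact n" "{M}"] by (simp add: sums_iff)
  then show ?thesis by (simp add: field_simps)
qed

text \<open>From \<open>N choose M \<le> N ^ M / fact M\<close>, where \<open>fact M\<close> is
  bounded below through a single term of the exponential series.\<close>

lemma choose_le_exp:
  assumes "M \<ge> 1"
  shows "real (N choose M) \<le> (exp 1 * real N / real M) ^ M"
proof -
  have "real (N choose M) * fact M \<le> real N ^ M"
    using binomial_fact_pow[of N M] by (metis of_nat_fact of_nat_le_iff of_nat_mult of_nat_power)
  then have "exp (real M) * (real (N choose M) * fact M) \<le> exp (real M) * real N ^ M"
    by (intro mult_left_mono) auto
  moreover have "real (N choose M) * real M ^ M \<le> real (N choose M) * (exp (real M) * fact M)"
    by (intro mult_left_mono power_le_exp_fact) auto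
  moreover have "real (N choose M) * (exp (real M) * fact M) = exp (real M) * (real (N choose M) * fact M)"
    by (simp only: mult_ac)
  ultimately have "real (N choose M) * real M ^ M \<le> exp (real M) * real N ^ M" by linarith
  then show ?thesis using assms
    by (simp add: power_divide power_mult_distrib pos_le_divide_eq exp_of_nat_mult[symmetric])
qed

lemma prob_many_in_subset:
  assumes A: "finite A" "C \<subseteq> A" and p: "0 \<le> p" "p \<le> 1" and M: "M \<ge> 1"
  shows "measure_pmf.prob (random_subset A p) {R. \<exists>S\<subseteq>C. card S = M \<and> S \<subseteq> R}
    \<le> (exp 1 * real (card C) * p / real M) ^ M"
proof -
  let ?\<S> = "{S. S \<subseteq> C \<and> card S = M}"
  have finC: "finite C" using A finite_subset by blast
  have finS: "finite ?\<S>" by (rule finite_subset[of _ "Pow C"]) (use finC in auto)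
  have "{R. \<exists>S\<subseteq>C. card S = M \<and> S \<subseteq> R} = (\<Union>S\<in>?\<S>. {R. S \<subseteq> R})" by auto
  then have "measure_pmf.prob (random_subset A p) {R. \<exists>S\<subseteq>C. card S = M \<and> S \<subseteq> R}
      \<le> (\<Sum>S\<in>?\<S>. measure_pmf.prob (random_subset A p) {R. S \<subseteq> R})"
    using measure_pmf.finite_measure_subadditive_finite[OF finS, of "\<lambda>S. {R. S \<subseteq> R}" "random_subset A p"] by simp
  also have "\<dots> = (\<Sum>S\<in>?\<S>. p ^ M)"
    by (rule sum.cong) (use prob_random_subset_superset[OF A(1) _ p] A(2) in auto)
  also have "\<dots> = real (card C choose M) * p ^ M" using n_subsets[OF finC] by simp
  also have "\<dots> \<le> (exp 1 * real (card C) / real M) ^ M * p ^ M"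
    using p by (intro mult_right_mono choose_le_exp M) auto
  also have "\<dots> = (exp 1 * real (card C) * p / real M) ^ M" by (simp flip: power_mult_distrib)
  finally show ?thesis .
qed

lemma prob_union_le:
  assumes "finite \<C>"
    and "\<And>C. C \<in> \<C> \<Longrightarrow> measure_pmf.prob P (X C) \<le> c"
  shows "measure_pmf.prob P (\<Union>C\<in>\<C>. X C) \<le> real (card \<C>) * c"
proof -
  have "measure_pmf.prob P (\<Union>C\<in>\<C>. X C) \<le> (\<Sum>C\<in>\<C>. measure_pmf.prob P (X C))"
    by (rule measure_pmf.finite_measure_subadditive_finite[OF assms(1)]) auto
  also have "\<dots> \<le> (\<Sum>C\<in>\<C>. c)" by (rule sum_mono) (rule assms(2))
  finally show ?thesis by simp
qed

text \<open>A large \<open>I\<close> inside the random set puts \<open>M\<close> random elements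
  into the container of \<open>I\<close>. The sum therefore runs over containers and their
  \<open>M\<close>-subsets, never over the sets \<open>I\<close>.\<close>

lemma prob_covered_by:
  assumes A: "finite A" and cov: "\<exists>\<C>. finite \<C> \<and> card \<C> \<le> Q \<and>
     (\<forall>C\<in>\<C>. C \<subseteq> A \<and> real (card C) \<le> s) \<and> (\<forall>I\<subseteq>A. P I \<longrightarrow> (\<exists>C\<in>\<C>. I \<subseteq> C))"
    and p: "0 \<le> p" "p \<le> 1" and M: "M \<ge> 1" and s: "s \<ge> 0"
  shows "measure_pmf.prob (random_subset A p) {R. R \<subseteq> A \<and> (\<exists>I\<subseteq>R. P I \<and> M \<le> card I)}
    \<le> real Q * (exp 1 * s * p / real M) ^ M"
proof -
  obtain \<C> where C: "finite \<C>" "card \<C> \<le> Q" "\<forall>C\<in>\<C>. C \<subseteq> A \<and> real (card C) \<le> s"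
    "\<forall>I\<subseteq>A. P I \<longrightarrow> (\<exists>C\<in>\<C>. I \<subseteq> C)" using cov by (elim exE conjE)
  have "{R. R \<subseteq> A \<and> (\<exists>I\<subseteq>R. P I \<and> M \<le> card I)} \<subseteq> (\<Union>C\<in>\<C>. {R. \<exists>S\<subseteq>C. card S = M \<and> S \<subseteq> R})"
  proof
    fix R assume "R \<in> {R. R \<subseteq> A \<and> (\<exists>I\<subseteq>R. P I \<and> M \<le> card I)}"
    then obtain I where I: "R \<subseteq> A" "I \<subseteq> R" "P I" "M \<le> card I" by blast
    then obtain C' where C': "C' \<in> \<C>" "I \<subseteq> C'" using C(4) by (meson order_trans)
    obtain S where "S \<subseteq> I" "card S = M" using obtain_subset_with_card_n[OF I(4)] by blast
    then show "R \<in> (\<Union>C\<in>\<C>. {R. \<exists>S\<subseteq>C. card S = M \<and> S \<subseteq> R})"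
      using C' I by (intro UN_I[of C']) (auto intro!: exI[of _ S])
  qed
  then have "measure_pmf.prob (random_subset A p) {R. R \<subseteq> A \<and> (\<exists>I\<subseteq>R. P I \<and> M \<le> card I)}
      \<le> measure_pmf.prob (random_subset A p) (\<Union>C\<in>\<C>. {R. \<exists>S\<subseteq>C. card S = M \<and> S \<subseteq> R})"
    by (intro measure_pmf.finite_measure_mono) auto
  also have "\<dots> \<le> real (card \<C>) * (exp 1 * s * p / real M) ^ M"
  proof (rule prob_union_le[OF C(1)])
    fix C' assume C': "C' \<in> \<C>"
    have "measure_pmf.prob (random_subset A p) {R. \<exists>S\<subseteq>C'. card S = M \<and> S \<subseteq> R}
        \<le> (exp 1 * real (card C') * p / real M) ^ M"
      using C' C(3) by (intro prob_many_in_subset A p M) auto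
    also have "\<dots> \<le> (exp 1 * s * p / real M) ^ M"
      using C' C(3) p M by (intro power_mono divide_right_mono mult_right_mono mult_left_mono) auto
    finally show "measure_pmf.prob (random_subset A p) {R. \<exists>S\<subseteq>C'. card S = M \<and> S \<subseteq> R}
        \<le> (exp 1 * s * p / real M) ^ M" .
  qed
  also have "\<dots> \<le> real Q * (exp 1 * s * p / real M) ^ M"
    using C(2) p s by (intro mult_right_mono) auto
  finally show ?thesis .
qed

text \<open>Reduces every claim to a bound on the failure probability of the random edge set, which
  almost surely consists of \<open>r\<close>-subsets of \<open>{..<n}\<close>.\<close>

lemma aasI:
  assumes "\<forall>\<^sub>F n in sequentially. measure_pmf.prob (random_subset (r_subsets r n) (p n))
      {R. R \<subseteq> r_subsets r n \<and> \<not> A n ({..<n}, R)} \<le> \<epsilon> n" and "\<epsilon> \<longlonglongrightarrow> 0"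
  shows "aas (\<lambda>n. random_r_graph r n (p n)) A"
proof -
  let ?P = "\<lambda>n. measure_pmf.prob (random_r_graph r n (p n)) {x. A n x}"
  have lower: "?P n \<ge> 1 - measure_pmf.prob (random_subset (r_subsets r n) (p n))
      {R. R \<subseteq> r_subsets r n \<and> \<not> A n ({..<n}, R)}" for n
  proof -
    let ?M = "random_subset (r_subsets r n) (p n)"
    have "1 - measure_pmf.prob ?M {R. A n ({..<n}, R)} = measure_pmf.prob ?M {R. \<not> A n ({..<n}, R)}"
      using measure_pmf.prob_compl[of "{R. A n ({..<n}, R)}" ?M] by (simp add: Compl_eq_Diff_UNIV[symmetric] Collect_neg_eq)
    also have "\<dots> = measure_pmf.prob ?M {R. R \<subseteq> r_subsets r n \<and> \<not> A n ({..<n}, R)}"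
    proof (rule measure_pmf.finite_measure_eq_AE)
      show "AE R in measure_pmf ?M. (R \<in> {R. \<not> A n ({..<n}, R)}) =
          (R \<in> {R. R \<subseteq> r_subsets r n \<and> \<not> A n ({..<n}, R)})"
        unfolding AE_measure_pmf_iff using set_random_subset[of "r_subsets r n" "p n"] by blast
    qed auto
    finally show ?thesis unfolding random_r_graph_eq by (simp add: vimage_def)
  qed
  have "\<forall>\<^sub>F n in sequentially. 1 - \<epsilon> n \<le> ?P n"
    using assms(1)
  proof eventually_elim
    case (elim n)
    then show ?case using lower[of n] by linarith
  qed
  moreover have "\<forall>\<^sub>F n in sequentially. ?P n \<le> 1" by simp
  moreover have "(\<lambda>n. 1 - \<epsilon> n) \<longlonglongrightarrow> 1" using tendsto_diff[OF tendsto_const assms(2), of 1] by simp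
  ultimately show ?thesis unfolding aas_def by (rule tendsto_sandwich[OF _ _ _ tendsto_const])
qed

section \<open>Containers for free graphs and the upper bound\<close>

text \<open>Allows the exponent given by the density of \<open>F\<close> to be raised to the one
  given by the density of its expansion.\<close>

lemma eventually_spread_mono:
  assumes "eventually_spread r0 F a k" "a \<le> a'"
  shows "eventually_spread r0 F a' k"
proof -
  obtain C B where C: "C > 0" and B: "B > 0" and ev: "\<forall>\<^sub>F n in sequentially. \<forall>E \<subseteq> r_subsets k n.
     E \<noteq> {} \<longrightarrow> C * real n ^ (k - 1) \<le> real (card E) \<longrightarrow>
     spread (expansion r0 k F) n E (ln (real n) powr B) (real n powr a * ln (real n) powr B)"
    using assms(1) unfolding eventually_spread_def by (elim exE conjE) (rule that)
  have "\<forall>\<^sub>F n in sequentially. \<forall>E \<subseteq> r_subsets k n.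
     E \<noteq> {} \<longrightarrow> C * real n ^ (k - 1) \<le> real (card E) \<longrightarrow>
     spread (expansion r0 k F) n E (ln (real n) powr B) (real n powr a' * ln (real n) powr B)"
    using ev eventually_ge_at_top[of 1]
  proof eventually_elim
    case (elim n)
    have "real n powr a * ln (real n) powr B \<le> real n powr a' * ln (real n) powr B"
      using elim(2) assms(2) by (intro mult_right_mono powr_mono) auto
    then show ?case using elim(1) by (meson spread_mono powr_ge_zero mult_nonneg_nonneg order_refl)
  qed
  then show ?thesis unfolding eventually_spread_def using C B by blast
qed

lemma copies_mono_edges:
  assumes "S \<in> edges ` copies F (V, U)" "S \<subseteq> I"
  shows "\<not> is_free F (V, I)"
proof -
  obtain F' where "F' \<in> copies F (V, U)" "edges F' = S" using assms(1) by blast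
  then have "F' \<in> copies F (V, I)" using assms(2) unfolding copies_def subgraph_def by auto
  then show ?thesis unfolding is_free_def by blast
qed

text \<open>For the indicator weight of the spread collection, \<open>wdeg\<close> counts copies,
  and a free set is independent because it contains no copy. The real \<open>\<tau>\<close> is
  replaced by an integer \<open>b\<close> above it, since \<open>b\<close> counts
  selections.\<close>

lemma container_step:
  assumes F: "\<forall>e\<in>edges F. e \<subseteq> verts F" and "finite U" "U \<noteq> {}" and sp: "spread F n U K \<tau>"
    and K: "K \<ge> 1" and b: "b \<ge> 1" "\<tau> \<ge> 0" "\<tau> \<le> real b"
    and cont: "\<forall>(U :: nat set set) w K b. finite U \<longrightarrow> K \<ge> 1 \<longrightarrow> b \<ge> 1 \<longrightarrow>
     weighted (card (edges F)) U w \<longrightarrow> wdeg U w {} > 0 \<longrightarrow>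
     (\<forall>T. T \<noteq> {} \<longrightarrow> wdeg U w T \<le> K * wdeg U w {} / card U * (real b / card U) ^ (card T - 1)) \<longrightarrow>
     covered_by U (\<lambda>I. \<forall>e\<subseteq>I. w e = 0) ((card U + 1) ^ (card (edges F) * b)) ((1 - 1 / (real A * K ^ A)) * card U)"
  shows "covered_by U (\<lambda>I. is_free F ({..<n}, I)) ((card U + 1) ^ (card (edges F) * b)) ((1 - 1 / (real A * K ^ A)) * card U)"
proof -
  obtain \<H> where H: "\<H> \<subseteq> edges ` copies F ({..<n}, U)" "\<H> \<noteq> {}" and
     deg: "\<And>T. T \<noteq> {} \<Longrightarrow> finite T \<Longrightarrow> real (card {S \<in> \<H>. T \<subseteq> S})
        \<le> K * real (card \<H>) / real (card U) * (\<tau> / real (card U)) ^ (card T - 1)"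
    using sp unfolding spread_def by blast
  define w where "w S = (if S \<in> \<H> then 1 else 0 :: real)" for S
  have S: "S \<subseteq> U" "card S = card (edges F)" if "S \<in> \<H>" for S
    using card_copy_edges[OF subsetD[OF H(1) that] F] by simp_all
  have finH: "finite \<H>" by (rule finite_subset[of _ "Pow U"]) (use S assms(2) in auto)
  have wdeg: "wdeg U w T = real (card {S \<in> \<H>. T \<subseteq> S})" for T
  proof -
    have "wdeg U w T = (\<Sum>S\<in>{S \<in> \<H>. T \<subseteq> S}. 1)"
      unfolding wdeg_def by (rule sum.mono_neutral_cong_right) (use assms(2) S in \<open>auto simp: w_def\<close>)
    then show ?thesis by simp
  qed
  have "covered_by U (\<lambda>I. \<forall>e\<subseteq>I. w e = 0) ((card U + 1) ^ (card (edges F) * b)) ((1 - 1 / (real A * K ^ A)) * card U)"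
  proof (rule cont[rule_format, OF assms(2) K b(1)])
    show "weighted (card (edges F)) U w" unfolding weighted_def w_def using S by auto
    show "wdeg U w {} > 0" unfolding wdeg using H(2) finH by (simp add: card_gt_0_iff)
    fix T :: "nat set set" assume T: "T \<noteq> {}"
    show "wdeg U w T \<le> K * wdeg U w {} / card U * (real b / card U) ^ (card T - 1)"
    proof (cases "finite T")
      case True
      have "wdeg U w T \<le> K * real (card \<H>) / real (card U) * (\<tau> / real (card U)) ^ (card T - 1)"
        unfolding wdeg by (rule deg[OF T True])
      also have "\<dots> \<le> K * real (card \<H>) / real (card U) * (real b / real (card U)) ^ (card T - 1)"
        using K b by (intro mult_left_mono power_mono divide_right_mono) auto
      finally show ?thesis unfolding wdeg by simp
    next
      case False
      have "finite T" if "X \<in> \<H>" "T \<subseteq> X" for X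
        by (rule finite_subset[OF that(2) finite_subset[OF S(1)[OF that(1)] assms(2)]])
      then have "{S \<in> \<H>. T \<subseteq> S} = {}" using False by blast
      then have "wdeg U w T = 0" unfolding wdeg by (simp only: card.empty of_nat_0)
      moreover have "0 \<le> K * wdeg U w {} / card U * (real b / card U) ^ (card T - 1)"
        using K unfolding wdeg by simp
      ultimately show ?thesis by linarith
    qed
  qed
  then show ?thesis
  proof (rule covered_by_mono)
    fix I assume "I \<subseteq> U" and free: "is_free F ({..<n}, I)"
    show "\<forall>e\<subseteq>I. w e = 0"
      using copies_mono_edges[OF subsetD[OF H(1)]] free unfolding w_def by auto
  qed auto
qed

lemma one_minus_power_le:
  fixes \<delta> :: real
  assumes "0 \<le> \<delta>" "\<delta> \<le> 1"
  shows "(1 - \<delta>) ^ L \<le> exp (- \<delta> * real L)"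
proof -
  have "(1 - \<delta>) ^ L \<le> exp (- \<delta>) ^ L" using assms exp_ge_add_one_self[of "- \<delta>"] by (intro power_mono) auto
  then show ?thesis by (simp add: exp_of_nat_mult[symmetric] mult.commute)
qed

text \<open>The steps start from the set of all \<open>r\<close>-sets and stop at order
  \<open>n ^ (r - 1)\<close>, where spread collections are no longer guaranteed.\<close>

lemma free_graph_containers:
  assumes F: "\<forall>e\<in>edges F. e \<subseteq> verts F" and r: "r \<ge> 1" and a: "a > 0" and C1: "C1 > 0" and B: "B > 0"
    and spread: "\<forall>\<^sub>F n in sequentially. \<forall>E \<subseteq> r_subsets r n. E \<noteq> {} \<longrightarrow>
      C1 * real n ^ (r - 1) \<le> real (card E) \<longrightarrow>
      spread F n E (ln (real n) powr B) (real n powr a * ln (real n) powr B)"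
  shows "\<exists>D>0. \<exists>R>0. \<forall>\<^sub>F n in sequentially. \<exists>Q. real Q \<le> exp (real n powr a * ln (real n) powr D) \<and>
    covered_by (r_subsets r n) (\<lambda>I. is_free F ({..<n}, I)) Q (R * real n ^ (r - 1))"
proof -
  define l where "l = card (edges F)"
  obtain A where A: "A \<ge> 1" and cont: "\<forall>(U :: nat set set) w K b. finite U \<longrightarrow> K \<ge> 1 \<longrightarrow> b \<ge> 1 \<longrightarrow>
     weighted l U w \<longrightarrow> wdeg U w {} > 0 \<longrightarrow>
     (\<forall>T. T \<noteq> {} \<longrightarrow> wdeg U w T \<le> K * wdeg U w {} / card U * (real b / card U) ^ (card T - 1)) \<longrightarrow>
     covered_by U (\<lambda>I. \<forall>e\<subseteq>I. w e = 0) ((card U + 1) ^ (l * b)) ((1 - 1 / (real A * K ^ A)) * card U)"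
    using hypergraph_containers[of l, where 'a = "nat set"] by (elim exE conjE) (rule that)
  \<comment> \<open>\<open>C1\<close> is the limit of the spread hypothesis. The 1 ensures
    \<open>R * n ^ (r - 1) \<ge> 1\<close>, so that it is enough to shrink \<open>n ^ r\<close> to
    1.\<close>
  define R where "R = max C1 1"
  define c where "c = real l * (real r * real A + 1) * 2 * (real r + 1)"
  \<comment> \<open>\<open>B\<close> comes from \<open>\<tau>\<close> and \<open>B * A\<close> from
    \<open>K ^ A\<close> in the number of rounds. The three further logarithms come from the number
    of rounds, from \<open>ln (n ^ r + 1)\<close> and from absorbing the constant
    \<open>c\<close>.\<close>
  define D where "D = B * real A + B + 3"
  have ev_c: "\<forall>\<^sub>F n in sequentially. c \<le> ln (real n)" by real_asymp
  have ev_1: "\<forall>\<^sub>F n in sequentially. 1 \<le> ln (real n)" by real_asymp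
  have "\<forall>\<^sub>F n in sequentially. \<exists>Q. real Q \<le> exp (real n powr a * ln (real n) powr D) \<and>
    covered_by (r_subsets r n) (\<lambda>I. is_free F ({..<n}, I)) Q (R * real n ^ (r - 1))"
    using spread ev_c ev_1 eventually_ge_at_top[of 2]
  proof eventually_elim
    case (elim n)
    define y where "y = ln (real n)"
    have y: "y \<ge> 1" using elim(3) unfolding y_def .
    define K where "K = y powr B"
    have K: "K \<ge> 1" unfolding K_def using y B by (simp add: ge_one_powr_ge_zero)
    define \<tau> where "\<tau> = real n powr a * K"
    have na: "real n powr a \<ge> 1" using elim(4) a by (simp add: ge_one_powr_ge_zero)
    have \<tau>: "\<tau> \<ge> 1" unfolding \<tau>_def using mult_mono[OF na K] by simp
    define b where "b = nat \<lceil>\<tau>\<rceil>"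
    have b: "b \<ge> 1" "\<tau> \<le> real b" "real b \<le> 2 * \<tau>" unfolding b_def using \<tau> by linarith+
    define \<delta> where "\<delta> = 1 / (real A * K ^ A)"
    have AK: "real A * K ^ A \<ge> 1"
      using A K mult_mono[of 1 "real A" 1 "K ^ A"] by (simp add: one_le_power)
    have \<delta>: "0 < \<delta>" "\<delta> \<le> 1" unfolding \<delta>_def using AK by auto
    define Q where "Q = (n ^ r + 1) ^ (l * b)"
    \<comment> \<open>So many rounds that \<open>exp (- \<delta> * L)\<close> cancels
      \<open>n ^ r = exp (r * y)\<close>.\<close>
    define L where "L = nat \<lceil>real r * y / \<delta>\<rceil>"
    have L: "real r * y \<le> \<delta> * real L"
    proof -
      have "real r * y / \<delta> \<le> real L" unfolding L_def by linarith
      then show ?thesis using \<delta> by (simp add: field_simps)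
    qed
    have L_le: "real L \<le> real r * y * (real A * K ^ A) + 1"
    proof -
      have "0 \<le> real r * y / \<delta>" using y \<delta> by simp
      then have "real L \<le> real r * y / \<delta> + 1" unfolding L_def by linarith
      then show ?thesis unfolding \<delta>_def by simp
    qed
    have n1: "real n ^ (r - 1) \<ge> 1" using elim(4) by (intro one_le_power) auto
    have R1: "R * real n ^ (r - 1) \<ge> 1" using mult_mono[of 1 R 1 "real n ^ (r - 1)"] n1 unfolding R_def by simp
    have card_le: "card (r_subsets r n) \<le> n ^ r" unfolding card_r_subsets by (rule choose_le_power)
    have "covered_by (r_subsets r n) (\<lambda>I. is_free F ({..<n}, I)) (Q ^ L) (R * real n ^ (r - 1))"
    proof (rule covered_by_iterate[OF finite_r_subsets[of r n] _ _ _ _ subset_refl])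
      show "Q \<ge> 1" unfolding Q_def by simp
      show "\<delta> \<ge> 0" "\<delta> \<le> 1" using \<delta> by auto
      show "(1 - \<delta>) ^ L * real (card (r_subsets r n)) \<le> R * real n ^ (r - 1)"
      proof -
        have "(1 - \<delta>) ^ L * real (card (r_subsets r n)) \<le> exp (- \<delta> * real L) * real (n ^ r)"
          using \<delta> card_le by (intro mult_mono one_minus_power_le of_nat_mono) auto
        also have "\<dots> \<le> exp (- (real r * y)) * real (n ^ r)"
          using L by (intro mult_right_mono) auto
        also have "\<dots> = 1"
        proof -
          have "exp (real r * y) = real n ^ r" unfolding y_def exp_of_nat_mult using elim(4) by simp
          then show ?thesis using elim(4) by (simp add: exp_minus)
        qed
        finally show ?thesis using R1 by linarith
      qed
      fix U assume U: "U \<subseteq> r_subsets r n" "R * real n ^ (r - 1) \<le> real (card U)"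
      have "C1 * real n ^ (r - 1) \<le> R * real n ^ (r - 1)" unfolding R_def by (intro mult_right_mono) auto
      then have big: "C1 * real n ^ (r - 1) \<le> real (card U)" using U(2) by linarith
      have finU: "finite U" by (rule finite_subset[OF U(1) finite_r_subsets])
      have "real (card U) \<ge> 1" using U(2) R1 by linarith
      then have neU: "U \<noteq> {}" by auto
      have sp: "spread F n U K \<tau>"
        using elim(1)[rule_format, OF U(1) neU big] unfolding K_def \<tau>_def y_def .
      have "covered_by U (\<lambda>I. is_free F ({..<n}, I)) ((card U + 1) ^ (l * b)) ((1 - \<delta>) * card U)"
        unfolding \<delta>_def l_def
        by (rule container_step[OF F finU neU sp K b(1) _ b(2) cont[unfolded l_def]]) (use \<tau> in linarith)
      then show "covered_by U (\<lambda>I. is_free F ({..<n}, I)) Q ((1 - \<delta>) * card U)"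
      proof (rule covered_by_mono)
        have "card U \<le> n ^ r" using card_mono[OF finite_r_subsets U(1)] card_le by linarith
        then show "(card U + 1) ^ (l * b) \<le> Q" unfolding Q_def by (intro power_mono) auto
      qed auto
    qed
    moreover have "real (Q ^ L) \<le> exp (real n powr a * y powr D)"
    proof -
      have "real n ^ r + 1 \<le> 2 * real n ^ r" using elim(4) by simp
      also have "\<dots> \<le> real n * real n ^ r" using elim(4) by (intro mult_right_mono) auto
      also have "\<dots> = exp ((real r + 1) * y)"
      proof -
        have "exp (real (Suc r) * y) = real n ^ Suc r" unfolding y_def exp_of_nat_mult using elim(4) by simp
        then show ?thesis by (simp add: add.commute)
      qed
      finally have "real (n ^ r + 1) \<le> exp ((real r + 1) * y)" by simp
      then have "real (Q ^ L) \<le> exp ((real r + 1) * y) ^ (l * b * L)"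
        unfolding Q_def power_mult[symmetric] of_nat_power[of "n ^ r + 1"] by (intro power_mono) auto
      also have "\<dots> = exp (real l * real b * real L * ((real r + 1) * y))"
        by (simp add: exp_of_nat_mult[symmetric])
      also have "\<dots> \<le> exp (real n powr a * y powr D)"
      proof -
        have KA: "K ^ A = y powr (B * real A)"
          unfolding K_def using y by (simp add: powr_realpow[symmetric] powr_powr)
        have yK: "y * K ^ A \<ge> 1" using mult_mono[OF y, of 1 "K ^ A"] K y by (simp add: one_le_power)
        have "real L \<le> (real r * real A + 1) * (y * K ^ A)"
          using L_le yK by (simp add: algebra_simps)
        then have "real l * real b * real L * ((real r + 1) * y)
            \<le> real l * (2 * \<tau>) * ((real r * real A + 1) * (y * K ^ A)) * ((real r + 1) * y)"
          using b y K \<tau> by (intro mult_mono mult_left_mono mult_right_mono) auto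
        also have "\<dots> = c * (real n powr a * (K * K ^ A * (y * y)))"
          unfolding \<tau>_def c_def by (simp add: algebra_simps)
        also have "\<dots> \<le> y * (real n powr a * (K * K ^ A * (y * y)))"
          using elim(2) K y unfolding y_def[symmetric] by (intro mult_right_mono) auto
        also have "\<dots> = real n powr a * (y powr B * y powr (B * real A) * (y powr 1 * y powr 1 * y powr 1))"
          unfolding KA unfolding K_def using y by (simp add: mult_ac)
        also have "y powr B * y powr (B * real A) * (y powr 1 * y powr 1 * y powr 1) = y powr D"
          unfolding powr_add[symmetric] D_def by (simp add: algebra_simps)
        finally show ?thesis by simp
      qed
      finally show ?thesis .
    qed
    ultimately show ?case unfolding y_def by blast
  qed
  moreover have "D > 0" "R > 0" unfolding D_def R_def using B by (auto intro: add_nonneg_pos)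
  ultimately show ?thesis by blast
qed

section \<open>Extremal numbers of random edge sets\<close>

lemma aas_conj:
  assumes "aas P A" "aas P B"
  shows "aas P (\<lambda>n x. A n x \<and> B n x)"
proof -
  let ?p = "\<lambda>A n. measure_pmf.prob (P n) {x. A n x}"
  have "?p A n + ?p B n - 1 \<le> ?p (\<lambda>n x. A n x \<and> B n x) n" for n
  proof -
    have "?p A n + ?p B n = measure_pmf.prob (P n) ({x. A n x} \<union> {x. B n x})
        + measure_pmf.prob (P n) ({x. A n x} \<inter> {x. B n x})"
      using measure_Un3[of "{x. A n x}" "measure_pmf (P n)" "{x. B n x}"]
      by (simp add: measure_pmf.fmeasurable_eq_sets)
    moreover have "measure_pmf.prob (P n) ({x. A n x} \<union> {x. B n x}) \<le> 1" by simp
    ultimately show ?thesis by (simp add: Int_def)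
  qed
  then have "\<forall>\<^sub>F n in sequentially. ?p A n + ?p B n - 1 \<le> ?p (\<lambda>n x. A n x \<and> B n x) n" by simp
  moreover have "\<forall>\<^sub>F n in sequentially. ?p (\<lambda>n x. A n x \<and> B n x) n \<le> 1" by simp
  moreover have "(\<lambda>n. ?p A n + ?p B n - 1) \<longlonglongrightarrow> 1"
    using tendsto_diff[OF tendsto_add[OF assms[unfolded aas_def]] tendsto_const[of 1]] by simp
  ultimately show ?thesis unfolding aas_def by (rule tendsto_sandwich[OF _ _ _ tendsto_const])
qed

lemma ex_number_ge:
  assumes "finite E" "subgraph G' (V, E)" "is_free F G'"
  shows "card (edges G') \<le> ex_number (V, E) F"
  unfolding ex_number_def
proof (rule Max_ge)
  show "finite {card (edges G') |G'. subgraph G' (V, E) \<and> is_free F G'}"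
    by (rule finite_subset[of _ "{..card E}"]) (use assms(1) in \<open>auto simp: subgraph_def card_mono\<close>)
qed (use assms in blast)

lemma ex_number_attained:
  assumes E: "finite E" and F: "edges F \<noteq> {}"
  obtains G' where "subgraph G' (V, E)" "is_free F G'" "card (edges G') = ex_number (V, E) F"
proof -
  let ?S = "{card (edges G') |G'. subgraph G' (V, E) \<and> is_free F G'}"
  have "finite ?S"
    by (rule finite_subset[of _ "{..card E}"]) (use E in \<open>auto simp: subgraph_def card_mono\<close>)
  moreover have "\<exists>G'. subgraph G' (V, E) \<and> is_free F G'"
  \<comment> \<open>The graph with no vertices is free because \<open>F\<close> has an edge; hence
    the maximum is taken over a nonempty set.\<close>
  proof (intro exI[of _ "({}, {})"] conjI)
    show "subgraph ({}, {}) (V, E)" unfolding subgraph_def by simp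
    show "is_free F ({}, {})" using F unfolding is_free_def copies_def isomorphic_def subgraph_def by auto
  qed
  then have "?S \<noteq> {}" by blast
  ultimately have "ex_number (V, E) F \<in> ?S" unfolding ex_number_def by (rule Max_in)
  then obtain G' where "ex_number (V, E) F = card (edges G')" "subgraph G' (V, E)" "is_free F G'"
    by blast
  then show ?thesis by (intro that[of G']) simp_all
qed

lemma ex_number_le_card:
  assumes "finite E" "edges F \<noteq> {}"
  shows "ex_number (V, E) F \<le> card E"
proof -
  obtain G' where "subgraph G' (V, E)" "card (edges G') = ex_number (V, E) F"
    using ex_number_attained[OF assms] .
  then show ?thesis using card_mono[OF assms(1), of "edges G'"] unfolding subgraph_def by simp
qed

lemma inj_on_extend:
  assumes V: "finite V" "W \<subseteq> V" and f: "inj_on f W" "f ` W \<subseteq> V'" and V': "finite V'" "card V \<le> card V'"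
  shows "\<exists>g. inj_on g V \<and> g ` V \<subseteq> V' \<and> (\<forall>x\<in>W. g x = f x)"
proof -
  have finW: "finite W" using V finite_subset by blast
  have "card (V - W) = card V - card W" using V finW by (simp add: card_Diff_subset)
  moreover have "card (V' - f ` W) = card V' - card W"
    using f V' finW by (simp add: card_Diff_subset card_image)
  ultimately have "card (V - W) \<le> card (V' - f ` W)" using V'(2) by linarith
  then obtain h where h: "h ` (V - W) \<subseteq> V' - f ` W" "inj_on h (V - W)"
    using card_le_inj[of "V - W" "V' - f ` W"] V V' by blast
  define g where "g x = (if x \<in> W then f x else h x)" for x
  have "inj_on g (W \<union> (V - W))"
    unfolding inj_on_Un using f(1) h unfolding g_def inj_on_def by auto
  moreover have "W \<union> (V - W) = V" using V(2) by blast
  ultimately have "inj_on g V" by simp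
  moreover have "g ` V \<subseteq> V'" using f(2) h(1) unfolding g_def by auto
  moreover have "\<forall>x\<in>W. g x = f x" unfolding g_def by simp
  ultimately show ?thesis by blast
qed

text \<open>Isolated vertices of \<open>F\<close> can be relocated into the host graph unless it has fewer vertices
  than \<open>F\<close>.\<close>

lemma is_free_enlarge:
  assumes F: "finite (verts F)" "\<forall>e\<in>edges F. e \<subseteq> verts F"
    and G': "subgraph G' (V, E)" "finite V" "is_free F G'"
  shows "is_free F (V, edges G') \<or> card (edges G') \<le> 2 ^ card (verts F)"
proof (cases "card (verts F) \<le> card (verts G')")
  case True
  have finG': "finite (verts G')" and sub: "\<forall>e\<in>edges G'. e \<subseteq> verts G'"
    using G' unfolding subgraph_def by (auto dest: finite_subset)
  have "is_free F (V, edges G')"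
  proof (rule ccontr)
    assume "\<not> is_free F (V, edges G')"
    then obtain S where "S \<in> edges ` copies F (V, edges G')" unfolding is_free_def by blast
    then obtain f where f: "inj_on f (verts F) \<and> f ` verts F \<subseteq> verts (V, edges G') \<and>
        S = (`) f ` edges F \<and> S \<subseteq> edges (V, edges G')"
      unfolding edges_copies_iff[OF F(2)] ..
    let ?W = "\<Union> (edges F)"
    have W: "?W \<subseteq> verts F" using F(2) by blast
    have "f ` e \<subseteq> verts G'" if "e \<in> edges F" for e
      using f sub that by (metis image_eqI snd_conv subsetD)
    then have "f ` ?W \<subseteq> verts G'" by blast
    then obtain g where g: "inj_on g (verts F)" "g ` verts F \<subseteq> verts G'" "\<forall>x\<in>?W. g x = f x"
      using inj_on_extend[OF F(1) W inj_on_subset[OF conjunct1[OF f] W] _ finG' True] by blast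
    have "(`) g ` edges F = (`) f ` edges F"
      by (intro image_cong refl) (use g(3) in blast)
    then have "S = (`) g ` edges F" using f by simp
    moreover have "S \<subseteq> edges G'" using f unfolding snd_conv by blast
    ultimately have "\<exists>g. inj_on g (verts F) \<and> g ` verts F \<subseteq> verts G' \<and> S = (`) g ` edges F \<and> S \<subseteq> edges G'"
      using g by blast
    then have "S \<in> edges ` copies F G'" unfolding edges_copies_iff[OF F(2)] .
    then show False using G'(3) unfolding is_free_def by blast
  qed
  then show ?thesis ..
next
  case False
  have finG': "finite (verts G')" and sub: "edges G' \<subseteq> Pow (verts G')"
    using G' unfolding subgraph_def by (auto dest: finite_subset)
  have "card (edges G') \<le> card (Pow (verts G'))" using sub finG' by (intro card_mono) auto
  also have "\<dots> = 2 ^ card (verts G')" using finG' by (rule card_Pow)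
  also have "\<dots> \<le> 2 ^ card (verts F)" using False by (intro power_increasing) auto
  finally show ?thesis ..
qed

text \<open>With \<open>M\<close> the claimed bound rounded up, there are at most
  \<open>exp M\<close> containers. One of them contains \<open>M\<close> random edges with
  probability at most \<open>exp (- 2 * M)\<close>: the factor \<open>exp 3\<close> in the condition
  on \<open>C\<close> pays for this and for the \<open>exp 1\<close> of the binomial
  estimate.\<close>

lemma ex_number_upper_aas:
  assumes F: "r_graph r F" "edges F \<noteq> {}" and a: "a > 0"
    and cont: "\<forall>\<^sub>F n in sequentially. \<exists>Q. real Q \<le> exp (real n powr a * ln (real n) powr D) \<and>
      covered_by (r_subsets r n) (\<lambda>I. is_free F ({..<n}, I)) Q (R * real n ^ (r - 1))"
    and D: "D > 0" and R: "R > 0" and C: "C \<ge> D" "C \<ge> exp 3 * R"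
    and p: "\<And>n. 0 < p n \<and> p n \<le> 1"
  shows "aas (\<lambda>n. random_r_graph r n (p n)) (\<lambda>n G. real (ex_number G F)
    \<le> max (C * p n * real n ^ (r - 1)) (real n powr a * ln (real n) powr C))"
proof (rule aasI)
  have sub: "\<forall>e\<in>edges F. e \<subseteq> verts F" and finF: "finite (verts F)" using F unfolding r_graph_def by auto
  define v where "v = (2::real) ^ card (verts F)"
  have ev_1: "\<forall>\<^sub>F n in sequentially. 1 \<le> ln (real n)" by real_asymp
  have ev_v: "\<forall>\<^sub>F n in sequentially. v \<le> real n powr a" using a by real_asymp
  show "(\<lambda>n. exp (- (real n powr a))) \<longlonglongrightarrow> 0" using a by real_asymp
  show "\<forall>\<^sub>F n in sequentially. measure_pmf.prob (random_subset (r_subsets r n) (p n))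
      {E. E \<subseteq> r_subsets r n \<and> \<not> real (ex_number ({..<n}, E) F)
        \<le> max (C * p n * real n ^ (r - 1)) (real n powr a * ln (real n) powr C)}
      \<le> exp (- (real n powr a))"
    using cont ev_1 ev_v
  proof eventually_elim
    case (elim n)
    then obtain Q where Q: "real Q \<le> exp (real n powr a * ln (real n) powr D)" and
      cov: "covered_by (r_subsets r n) (\<lambda>I. is_free F ({..<n}, I)) Q (R * real n ^ (r - 1))" by blast
    define X where "X = max (C * p n * real n ^ (r - 1)) (real n powr a * ln (real n) powr C)"
    define M where "M = nat \<lceil>X\<rceil>"
    define s where "s = R * real n ^ (r - 1)"
    have n: "n \<ge> 1" using elim(2) by (cases n) auto
    have C0: "C > 0" using C D by linarith
    have na: "real n powr a \<ge> 1" using n a by (simp add: ge_one_powr_ge_zero)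
    have "1 \<le> ln (real n) powr C" using elim(2) C0 by (simp add: ge_one_powr_ge_zero)
    then have Xa: "real n powr a \<le> X" unfolding X_def using mult_left_mono[of 1 "ln (real n) powr C" "real n powr a"] by simp
    have XM: "X \<le> real M" unfolding M_def by linarith
    have M1: "M \<ge> 1" using XM Xa na by linarith
    have "measure_pmf.prob (random_subset (r_subsets r n) (p n))
        {E. E \<subseteq> r_subsets r n \<and> \<not> real (ex_number ({..<n}, E) F) \<le> X}
      \<le> measure_pmf.prob (random_subset (r_subsets r n) (p n))
        {E. E \<subseteq> r_subsets r n \<and> (\<exists>I\<subseteq>E. is_free F ({..<n}, I) \<and> M \<le> card I)}"
    proof (rule measure_pmf.finite_measure_mono)
      show "{E. E \<subseteq> r_subsets r n \<and> \<not> real (ex_number ({..<n}, E) F) \<le> X}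
        \<subseteq> {E. E \<subseteq> r_subsets r n \<and> (\<exists>I\<subseteq>E. is_free F ({..<n}, I) \<and> M \<le> card I)}"
      proof
        fix E assume "E \<in> {E. E \<subseteq> r_subsets r n \<and> \<not> real (ex_number ({..<n}, E) F) \<le> X}"
        then have E: "E \<subseteq> r_subsets r n" and big: "real (ex_number ({..<n}, E) F) > X" by auto
        have finE: "finite E" by (rule finite_subset[OF E finite_r_subsets])
        obtain G' where G': "subgraph G' ({..<n}, E)" "is_free F G'" "card (edges G') = ex_number ({..<n}, E) F"
          using ex_number_attained[OF finE F(2)] .
        \<comment> \<open>Containers are stated for edge sets on all of \<open>{..<n}\<close>, but
          an extremal \<open>G'\<close> may have fewer vertices. This matters only for at most
          \<open>v\<close> edges, eventually fewer than the claimed bound.\<close>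
        have "real (card (edges G')) > v" using G'(3) big Xa elim(3) by simp
        then have "\<not> card (edges G') \<le> 2 ^ card (verts F)" unfolding v_def
          by (metis not_le of_nat_le_iff of_nat_numeral of_nat_power)
        then have "is_free F ({..<n}, edges G')" using is_free_enlarge[OF finF sub G'(1) _ G'(2)] by simp
        moreover have "M \<le> card (edges G')" using big unfolding G'(3) M_def by linarith
        moreover have "edges G' \<subseteq> E" using G'(1) unfolding subgraph_def by simp
        ultimately show "E \<in> {E. E \<subseteq> r_subsets r n \<and> (\<exists>I\<subseteq>E. is_free F ({..<n}, I) \<and> M \<le> card I)}"
          using E by blast
      qed
    qed simp
    also have "\<dots> \<le> real Q * (exp 1 * s * p n / real M) ^ M"
      using p[of n] M1 R cov unfolding s_def covered_by_def
      by (intro prob_covered_by finite_r_subsets) auto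
    also have "\<dots> \<le> exp (real M) * exp (- 2) ^ M"
    proof (intro mult_mono power_mono)
      have "real n powr a * ln (real n) powr D \<le> real n powr a * ln (real n) powr C"
        using C elim(2) by (intro mult_left_mono powr_mono) auto
      also have "\<dots> \<le> real M" using XM unfolding X_def by linarith
      finally show "real Q \<le> exp (real M)" using Q by (meson exp_le_cancel_iff order_trans)
      have pn: "p n * real n ^ (r - 1) > 0" using p[of n] n by simp
      have "exp 1 * s * p n = exp (- 2) * (exp 3 * R * (p n * real n ^ (r - 1)))"
        unfolding s_def using exp_add[of "- 2 :: real" 3] by (simp add: mult_ac)
      also have "\<dots> \<le> exp (- 2) * (C * (p n * real n ^ (r - 1)))"
        using C pn by (intro mult_left_mono mult_right_mono) auto
      also have "\<dots> \<le> exp (- 2) * real M"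
        using XM unfolding X_def by (intro mult_left_mono) (auto simp: mult_ac)
      finally show "exp 1 * s * p n / real M \<le> exp (- 2)" using M1 by (simp add: pos_divide_le_eq)
    qed (use p[of n] R in \<open>auto simp: s_def\<close>)
    also have "\<dots> = exp (- real M)" by (simp add: exp_of_nat_mult[symmetric] exp_add[symmetric])
    also have "\<dots> \<le> exp (- (real n powr a))" using XM Xa by simp
    finally show ?case unfolding X_def .
  qed
qed

section \<open>Densities\<close>

lemma r_graph_subgraph: "r_graph r F \<Longrightarrow> subgraph F' F \<Longrightarrow> r_graph r F'"
  unfolding r_graph_def subgraph_def by (auto dest: finite_subset)

lemma card_verts_gt:
  assumes F: "r_graph r F" and two: "card (edges F) \<ge> 2"
  shows "r < card (verts F)"
proof (rule ccontr)
  assume "\<not> r < card (verts F)"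
  then have "e = verts F" if "e \<in> edges F" for e
    using that F unfolding r_graph_def by (metis card_mono card_subset_eq not_le_imp_less order_antisym not_less)
  then have "edges F \<subseteq> {verts F}" by blast
  then have "card (edges F) \<le> card {verts F}" by (intro card_mono) auto
  then show False using two by simp
qed

lemma finite_densities:
  assumes "r_graph r F"
  shows "finite {(real (card (edges F')) - 1) / (real (card (verts F')) - real r) | F'.
            subgraph F' F \<and> card (edges F') \<ge> 2}"
proof -
  have "finite (Pow (verts F) \<times> Pow (edges F))"
    using assms finite_edges[OF assms] unfolding r_graph_def by simp
  moreover have "{F'. subgraph F' F} \<subseteq> Pow (verts F) \<times> Pow (edges F)"
    unfolding subgraph_def by auto
  ultimately have "finite {F'. subgraph F' F}" using finite_subset by blast
  then have "finite ((\<lambda>F'. (real (card (edges F')) - 1) / (real (card (verts F')) - real r)) ` {F'. subgraph F' F})"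
    by (rule finite_imageI)
  then show ?thesis by (rule finite_subset[rotated]) blast
qed

lemma r_density_ge:
  assumes "r_graph r F" "subgraph F' F" "card (edges F') \<ge> 2"
  shows "(real (card (edges F')) - 1) / (real (card (verts F')) - real r) \<le> r_density r F"
  unfolding r_density_def by (rule Max_ge[OF finite_densities[OF assms(1)]]) (use assms in blast)

lemma r_density_attained:
  assumes F: "r_graph r F" "card (edges F) \<ge> 2"
  obtains F' where "subgraph F' F" "card (edges F') \<ge> 2" "r < card (verts F')"
    "r_density r F = (real (card (edges F')) - 1) / (real (card (verts F')) - real r)"
proof -
  let ?S = "{(real (card (edges F')) - 1) / (real (card (verts F')) - real r) | F'.
            subgraph F' F \<and> card (edges F') \<ge> 2}"
  have "subgraph F F" using F(1) unfolding subgraph_def r_graph_def by auto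
  then have "?S \<noteq> {}" using F(2) by blast
  then have "r_density r F \<in> ?S"
    unfolding r_density_def by (rule Max_in[OF finite_densities[OF F(1)]])
  then obtain F' where F': "subgraph F' F" "card (edges F') \<ge> 2"
    "r_density r F = (real (card (edges F')) - 1) / (real (card (verts F')) - real r)" by blast
  then show ?thesis using that card_verts_gt[OF r_graph_subgraph[OF F(1)]] by blast
qed

lemma r_density_pos:
  assumes F: "r_graph r F" "card (edges F) \<ge> 2"
  shows "r_density r F > 0"
  by (rule r_density_attained[OF F]) simp

lemma card_verts_expansion:
  assumes "finite (verts F)" "finite (edges F)"
  shows "card (verts (expansion r0 r F)) = card (verts F) + card (edges F) * (r - r0)"
  unfolding verts_expansion using assms
  by (subst card_Un_disjoint) (auto simp: card_image card_cartesian_product)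

lemma subgraph_expansion: "subgraph F' F \<Longrightarrow> subgraph (expansion r0 r F') (expansion r0 r F)"
  unfolding subgraph_def verts_expansion edges_expansion expand_edge_def
  by (intro conjI ballI; elim conjE imageE; blast)

text \<open>In the densest \<open>F'\<close> with \<open>e + 1\<close> edges, expansion adds
  \<open>(e + 1) * (r - r0)\<close> vertices while the uniformity grows by \<open>r - r0\<close>. So
  the numerator of the density stays \<open>e\<close>, the denominator grows by
  \<open>e * (r - r0)\<close>, and \<open>1 / d\<close> grows by at most
  \<open>r - r0\<close>.\<close>

lemma r_density_expansion:
  assumes F: "r_graph r0 F" "card (edges F) \<ge> 2" and r: "r0 \<le> r"
  shows "real r0 - 1 / r_density r0 F \<le> real r - 1 / r_density r (expansion r0 r F)"
proof -
  obtain F' where F': "subgraph F' F" "card (edges F') \<ge> 2" "r0 < card (verts F')"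
    "r_density r0 F = (real (card (edges F')) - 1) / (real (card (verts F')) - real r0)"
    using r_density_attained[OF F] .
  define v where "v = real (card (verts F')) - real r0"
  define e where "e = real (card (edges F')) - 1"
  have v: "v > 0" and e: "e > 0" unfolding v_def e_def using F'(2,3) by auto
  have F'r: "r_graph r0 F'" by (rule r_graph_subgraph[OF F(1) F'(1)])
  have "card (verts (expansion r0 r F')) = card (verts F') + card (edges F') * (r - r0)"
    using F'r finite_edges[OF F'r] unfolding r_graph_def by (intro card_verts_expansion) auto
  then have "real (card (verts (expansion r0 r F')))
      = real (card (verts F')) + real (card (edges F')) * (real r - real r0)"
    using r by (simp add: of_nat_diff)
  then have v': "real (card (verts (expansion r0 r F'))) - real r = v + e * (real r - real r0)"
    unfolding v_def e_def by (simp add: algebra_simps)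
  have "e / (v + e * (real r - real r0)) \<le> r_density r (expansion r0 r F)"
    using r_density_ge[OF r_graph_expansion[OF F(1) r] subgraph_expansion[OF F'(1)]] F'(2)
    unfolding v' card_edges_expansion e_def by simp
  moreover have pos: "e / (v + e * (real r - real r0)) > 0"
    using v e r by (intro divide_pos_pos add_pos_nonneg mult_nonneg_nonneg) auto
  ultimately have "1 / r_density r (expansion r0 r F) \<le> 1 / (e / (v + e * (real r - real r0)))"
    by (intro divide_left_mono mult_pos_pos; linarith)
  also have "\<dots> = v / e + (real r - real r0)" using e by (simp add: field_simps)
  finally show ?thesis unfolding F'(4) v_def[symmetric] e_def[symmetric] by simp
qed

text \<open>Two edges through \<open>x\<close> span at most \<open>2 * r - 1\<close> vertices, so
  already this subgraph has density at least \<open>1 / (r - 1)\<close>.\<close>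

lemma r_density_two_edges:
  assumes F: "r_graph r F" and e: "e1 \<in> edges F" "e2 \<in> edges F" "e1 \<noteq> e2" "x \<in> e1 \<inter> e2"
  shows "1 / r_density r F \<le> real r - 1"
proof -
  let ?F' = "(e1 \<union> e2, {e1, e2})"
  have sub: "subgraph ?F' F" using F e unfolding subgraph_def r_graph_def by auto
  have two: "card (edges ?F') \<ge> 2" using e(3) by simp
  have fin: "finite e1" "finite e2" and c: "card e1 = r" "card e2 = r"
    using F e unfolding r_graph_def by (auto dest: finite_subset)
  have twoF: "card (edges F) \<ge> 2"
    using card_mono[OF finite_edges[OF F], of "{e1, e2}"] e by simp
  have gt: "r < card (verts ?F')" by (rule card_verts_gt[OF r_graph_subgraph[OF F sub] two])
  have "card (e1 \<inter> e2) \<ge> 1" using e(4) fin by (metis One_nat_def Suc_leI card_gt_0_iff empty_iff finite_Int)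
  then have le: "card (e1 \<union> e2) \<le> 2 * r - 1" using card_Un_Int[OF fin] c by linarith
  have "1 / (real (card (e1 \<union> e2)) - real r) \<le> r_density r F"
    using r_density_ge[OF F sub two] e(3) by simp
  then have "1 / r_density r F \<le> 1 / (1 / (real (card (e1 \<union> e2)) - real r))"
    using gt r_density_pos[OF F twoF] by (intro divide_left_mono) auto
  then show ?thesis using le gt by simp
qed

section \<open>Lower bounds\<close>

text \<open>In a copy, the preimage of \<open>x\<close> lies in every edge, and by injectivity it is
  the same vertex of \<open>F\<close> each time.\<close>

lemma star_free:
  assumes F: "\<forall>e\<in>edges F. e \<subseteq> verts F" "edges F \<noteq> {}" "\<forall>u\<in>verts F. \<exists>e\<in>edges F. u \<notin> e"
    and E: "\<forall>e\<in>E. x \<in> e"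
  shows "is_free F (V, E)"
proof (rule ccontr)
  assume "\<not> is_free F (V, E)"
  then obtain S where "S \<in> edges ` copies F (V, E)" unfolding is_free_def by blast
  then obtain f where f: "inj_on f (verts F) \<and> f ` verts F \<subseteq> verts (V, E) \<and>
        S = (`) f ` edges F \<and> S \<subseteq> edges (V, E)"
    unfolding edges_copies_iff[OF F(1)] ..
  have x: "x \<in> f ` e" if "e \<in> edges F" for e
    using f E that by (metis image_eqI snd_conv subsetD)
  obtain e where e: "e \<in> edges F" using F(2) by blast
  then obtain u where u: "u \<in> e" "x = f u" using x by blast
  then obtain e' where e': "e' \<in> edges F" "u \<notin> e'" using F e by blast
  then obtain u' where u': "u' \<in> e'" "x = f u'" using x by blast
  have "u \<in> verts F" "u' \<in> verts F" using F(1) e e'(1) u(1) u'(1) by blast+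
  then have "u = u'" using u(2) u'(2) inj_onD[OF conjunct1[OF f]] by simp
  then show False using u' e' by simp
qed

text \<open>Lets the deletion argument destroy only the copies of a densest subgraph instead of
  those of the whole graph.\<close>

lemma is_free_mono:
  assumes sub: "subgraph F' F" "\<forall>e\<in>edges F. e \<subseteq> verts F" and free: "is_free F' H"
  shows "is_free F H"
proof (rule ccontr)
  assume "\<not> is_free F H"
  then obtain S where "S \<in> edges ` copies F H" unfolding is_free_def by blast
  then obtain f where f: "inj_on f (verts F) \<and> f ` verts F \<subseteq> verts H \<and> S = (`) f ` edges F \<and> S \<subseteq> edges H"
    unfolding edges_copies_iff[OF sub(2)] ..
  have sub': "\<forall>e\<in>edges F'. e \<subseteq> verts F'" "verts F' \<subseteq> verts F" "edges F' \<subseteq> edges F"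
    using sub(1) unfolding subgraph_def by auto
  have "(`) f ` edges F' \<in> edges ` copies F' H"
    unfolding edges_copies_iff[OF sub'(1)]
  proof (intro exI[of _ f] conjI)
    show "inj_on f (verts F')" by (rule inj_on_subset[OF conjunct1[OF f] sub'(2)])
    show "f ` verts F' \<subseteq> verts H" by (rule order_trans[OF image_mono[OF sub'(2)]]) (use f in simp)
    have "(`) f ` edges F \<subseteq> edges H" using f by blast
    then show "(`) f ` edges F' \<subseteq> edges H" by (rule order_trans[OF image_mono[OF sub'(3)]])
  qed simp
  then show False using free unfolding is_free_def by blast
qed

section \<open>Counting and deleting copies\<close>

definition potential_copies :: "nat \<Rightarrow> nat \<Rightarrow> 'a hypergraph \<Rightarrow> nat set set set" where
  "potential_copies r n F = edges ` copies F ({..<n}, r_subsets r n)"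

lemma potential_copies:
  assumes F: "r_graph r F"
  shows "finite (potential_copies r n F)" "card (potential_copies r n F) \<le> n ^ card (verts F)"
    "S \<in> potential_copies r n F \<Longrightarrow> S \<subseteq> r_subsets r n \<and> card S = card (edges F)"
proof -
  have sub: "\<forall>e\<in>edges F. e \<subseteq> verts F" and fin: "finite (verts F)" using F unfolding r_graph_def by auto
  show S: "S \<subseteq> r_subsets r n \<and> card S = card (edges F)" if "S \<in> potential_copies r n F" for S
    using card_copy_edges[OF that[unfolded potential_copies_def] sub] by simp
  show fin': "finite (potential_copies r n F)"
    by (rule finite_subset[of _ "Pow (r_subsets r n)"]) (use S finite_r_subsets in auto)
  have "potential_copies r n F \<subseteq> (\<lambda>f. (`) f ` edges F) ` (verts F \<rightarrow>\<^sub>E {..<n})"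
  proof
    fix S assume "S \<in> potential_copies r n F"
    then obtain f where f: "inj_on f (verts F) \<and> f ` verts F \<subseteq> verts ({..<n}, r_subsets r n) \<and>
        S = (`) f ` edges F \<and> S \<subseteq> edges ({..<n}, r_subsets r n)"
      unfolding potential_copies_def edges_copies_iff[OF sub] ..
    \<comment> \<open>Restriction makes \<open>f\<close> an element of a finite function space with
      \<open>n ^ card (verts F)\<close> members, without changing the edges of the copy.\<close>
    have "(`) f ` edges F = (`) (restrict f (verts F)) ` edges F"
      using sub by (intro image_cong refl) (auto simp: subset_iff)
    moreover have "restrict f (verts F) \<in> verts F \<rightarrow>\<^sub>E {..<n}" using f by auto
    ultimately show "S \<in> (\<lambda>f. (`) f ` edges F) ` (verts F \<rightarrow>\<^sub>E {..<n})" using f by blast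
  qed
  then have "card (potential_copies r n F) \<le> card (verts F \<rightarrow>\<^sub>E {..<n})"
    using fin by (intro surj_card_le finite_PiE) auto
  then show "card (potential_copies r n F) \<le> n ^ card (verts F)" using fin by (simp add: card_PiE)
qed

lemma prob_many_copies:
  assumes F: "r_graph r F" and p: "0 \<le> p" "p \<le> 1" and t: "t > 0"
  shows "measure_pmf.prob (random_subset (r_subsets r n) p)
      {E. t \<le> real (card {S \<in> potential_copies r n F. S \<subseteq> E})}
    \<le> real n ^ card (verts F) * p ^ card (edges F) / t"
proof (rule random_subset_markov[OF finite_r_subsets])
  note pc = potential_copies[OF F]
  have "measure_pmf.expectation (random_subset (r_subsets r n) p)
      (\<lambda>E. real (card {S \<in> potential_copies r n F. S \<subseteq> E})) = (\<Sum>S\<in>potential_copies r n F. p ^ card S)"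
    using pc p by (intro expectation_count finite_r_subsets) auto
  also have "\<dots> = real (card (potential_copies r n F)) * p ^ card (edges F)" using pc(3) by simp
  also have "\<dots> \<le> real n ^ card (verts F) * p ^ card (edges F)"
    using of_nat_mono[OF pc(2), where 'a = real] p by (intro mult_right_mono) auto
  finally show "measure_pmf.expectation (random_subset (r_subsets r n) p)
      (\<lambda>E. real (card {S \<in> potential_copies r n F. S \<subseteq> E})) \<le> real n ^ card (verts F) * p ^ card (edges F)" .
qed (use t in auto)

lemma prob_deviation:
  assumes B: "B \<subseteq> r_subsets r n" and p: "0 < p" "p \<le> 1" and \<theta>: "\<theta> > 0" and ne: "card B > 0"
  shows "measure_pmf.prob (random_subset (r_subsets r n) p)
      {E. \<theta> * (p * card B) \<le> \<bar>real (card (E \<inter> B)) - p * card B\<bar>} \<le> 1 / (\<theta>\<^sup>2 * (p * card B))"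
proof -
  have pos: "p * card B > 0" using p ne by simp
  have "measure_pmf.prob (random_subset (r_subsets r n) p)
      {E. \<theta> * (p * card B) \<le> \<bar>real (card (E \<inter> B)) - p * card B\<bar>} \<le> p * card B / (\<theta> * (p * card B))\<^sup>2"
    using p \<theta> pos by (intro random_subset_chebyshev finite_r_subsets B) auto
  also have "\<dots> = 1 / (\<theta>\<^sup>2 * (p * card B))" using pos \<theta> by (simp add: power2_eq_square field_simps)
  finally show ?thesis .
qed

text \<open>Holds for every fixed \<open>E\<close>: the thinning parameter \<open>s\<close> is
  independent of the randomness of \<open>E\<close> and is set below 1 for dense \<open>E\<close>,
  and to 1 for sparse \<open>E\<close>.\<close>

lemma ex_number_ge_deletion:
  assumes F: "r_graph r F" "subgraph F' F" "card (edges F') \<ge> 1" and E: "E \<subseteq> r_subsets r n"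
    and s: "0 \<le> s" "s \<le> 1"
  shows "s * real (card E) - s ^ card (edges F') * real (card {S \<in> potential_copies r n F'. S \<subseteq> E})
    \<le> real (ex_number ({..<n}, E) F)"
proof -
  have finE: "finite E" by (rule finite_subset[OF E finite_r_subsets])
  note pc = potential_copies[OF r_graph_subgraph[OF F(1,2)], where n = n]
  let ?X = "{S \<in> potential_copies r n F'. S \<subseteq> E}"
  have "\<exists>J\<subseteq>E. (\<forall>S\<in>?X. \<not> S \<subseteq> J) \<and> s * real (card E) - s ^ card (edges F') * real (card ?X) \<le> real (card J)"
    using pc F(3) s by (intro independent_subset_exists finE) auto
  then obtain J where J: "J \<subseteq> E" "\<forall>S\<in>?X. \<not> S \<subseteq> J"
    "s * real (card E) - s ^ card (edges F') * real (card ?X) \<le> real (card J)" by blast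
  have "is_free F' ({..<n}, J)"
  proof (rule ccontr)
    assume "\<not> is_free F' ({..<n}, J)"
    then obtain F'' where F'': "F'' \<in> copies F' ({..<n}, J)" unfolding is_free_def by blast
    then have "edges F'' \<subseteq> J" unfolding copies_def subgraph_def by simp
    moreover have "F'' \<in> copies F' ({..<n}, r_subsets r n)"
      using F'' J(1) E unfolding copies_def subgraph_def by auto
    then have "edges F'' \<in> potential_copies r n F'" unfolding potential_copies_def by (rule imageI)
    ultimately show False using J by blast
  qed
  then have "is_free F ({..<n}, J)"
    using is_free_mono[OF F(2)] F(1) unfolding r_graph_def by blast
  moreover have "subgraph ({..<n}, J) ({..<n}, E)"
    using J(1) E unfolding subgraph_def r_subsets_def by auto
  ultimately have "card (edges ({..<n}, J)) \<le> ex_number ({..<n}, E) F" by (intro ex_number_ge finE)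
  then show ?thesis using J(3) by simp
qed

lemma choose_ge:
  assumes "1 \<le> r" "r \<le> n"
  shows "real n ^ r / real r ^ r \<le> real (n choose r)"
  using binomial_ge_n_over_k_pow_k[of r n, where 'a = real] assms by (simp add: power_divide)

text \<open>Shifting by \<open>Suc\<close> and adding 0 embeds the \<open>(r - 1)\<close>-subsets of
  \<open>{..<n - 1}\<close> into the star at 0. The factor 2 in the denominator absorbs the step
  from \<open>n\<close> to \<open>n - 1\<close>.\<close>

lemma card_star_ge:
  assumes "1 \<le> r" "2 \<le> n" "r \<le> n"
  shows "real n ^ (r - 1) / (2 * real r) ^ (r - 1) \<le> real (card {e \<in> r_subsets r n. 0 \<in> e})"
proof -
  let ?g = "\<lambda>e. insert 0 (Suc ` e)"
  have "inj_on ?g (r_subsets (r - 1) (n - 1))"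
  proof (rule inj_onI)
    fix e e' :: "nat set" assume "?g e = ?g e'"
    then have "Suc -` (?g e) = Suc -` (?g e')" by simp
    then show "e = e'" by (auto simp: vimage_def)
  qed
  moreover have "?g e \<in> {e \<in> r_subsets r n. 0 \<in> e}" if "e \<in> r_subsets (r - 1) (n - 1)" for e
  proof -
    have e: "e \<subseteq> {..<n - 1}" "card e = r - 1" using that unfolding r_subsets_def by auto
    then have "finite e" by (auto dest: finite_subset)
    then have "card (?g e) = r" using e assms(1) by (simp add: card_image)
    then show ?thesis using e assms(2) unfolding r_subsets_def by auto
  qed
  ultimately have "card (r_subsets (r - 1) (n - 1)) \<le> card {e \<in> r_subsets r n. 0 \<in> e}"
    using finite_r_subsets by (intro card_inj_on_le[of ?g]) auto
  then have le: "(n - 1) choose (r - 1) \<le> card {e \<in> r_subsets r n. 0 \<in> e}" unfolding card_r_subsets .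
  show ?thesis
  \<comment> \<open>The estimate of the binomial coefficient needs a positive lower index; for
    \<open>r = 1\<close> the star is a single edge.\<close>
  proof (cases "r = 1")
    case True
    then show ?thesis using le by simp
  next
    case False
    then have r: "1 \<le> r - 1" "r - 1 \<le> n - 1" using assms by auto
    have "real n * real (r - 1) \<le> 2 * real (n - 1) * real r"
      using assms by (intro mult_mono) auto
    then have "real n / (2 * real r) \<le> real (n - 1) / real (r - 1)"
      using r assms by (simp add: field_simps)
    then have "(real n / (2 * real r)) ^ (r - 1) \<le> (real (n - 1) / real (r - 1)) ^ (r - 1)"
      by (intro power_mono) auto
    also have "\<dots> \<le> real ((n - 1) choose (r - 1))" using choose_ge[OF r] by (simp add: power_divide)
    also have "\<dots> \<le> real (card {e \<in> r_subsets r n. 0 \<in> e})" using le by simp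
    finally show ?thesis by (simp add: power_divide)
  qed
qed

text \<open>The random star at vertex 0 is free, and its expected size is unbounded because
  \<open>p\<close> is far above \<open>n powr (- 1 / d)\<close>, which is at least
  \<open>1 / n ^ (r - 1)\<close>; so it keeps half of its expectation.\<close>

lemma ex_number_star_aas:
  assumes F: "r_graph r F" "edges F \<noteq> {}" "\<forall>u\<in>verts F. \<exists>e\<in>edges F. u \<notin> e" and r: "1 \<le> r"
    and d: "1 / d \<le> real r - 1" and p: "\<And>n. 0 < p n \<and> p n \<le> 1"
    and dense: "much_less (\<lambda>n. real n powr (- 1 / d)) p"
  shows "aas (\<lambda>n. random_r_graph r n (p n)) (\<lambda>n G.
    1 / (2 * (2 * real r) ^ (r - 1)) * p n * real n ^ (r - 1) \<le> real (ex_number G F))"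
proof (rule aasI)
  define k where "k = (2 * real r) ^ (r - 1)"
  have k: "k > 0" unfolding k_def using r by simp
  show "(\<lambda>n. 4 * k * (real n powr (- 1 / d) / p n)) \<longlonglongrightarrow> 0"
    using tendsto_mult_right_zero[OF dense[unfolded much_less_def], of "4 * k"] .
  have sub: "\<forall>e\<in>edges F. e \<subseteq> verts F" using F unfolding r_graph_def by auto
  show "\<forall>\<^sub>F n in sequentially. measure_pmf.prob (random_subset (r_subsets r n) (p n))
      {E. E \<subseteq> r_subsets r n \<and> \<not> 1 / (2 * k) * p n * real n ^ (r - 1) \<le> real (ex_number ({..<n}, E) F)}
      \<le> 4 * k * (real n powr (- 1 / d) / p n)"
    using eventually_ge_at_top[of "r + 2"]
  proof eventually_elim
    case (elim n)
    define B where "B = {e \<in> r_subsets r n. 0 \<in> e}"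
    define w where "w = real n ^ (r - 1) / k"
    have w: "w > 0" unfolding w_def using k elim by simp
    have B: "B \<subseteq> r_subsets r n" "w \<le> real (card B)"
      unfolding B_def w_def k_def using card_star_ge[OF r, of n] elim by auto
    have pw: "p n * w > 0" "p n * w \<le> p n * card B" using p[of n] w B by auto
    have "measure_pmf.prob (random_subset (r_subsets r n) (p n))
        {E. E \<subseteq> r_subsets r n \<and> \<not> 1 / (2 * k) * p n * real n ^ (r - 1) \<le> real (ex_number ({..<n}, E) F)}
      \<le> measure_pmf.prob (random_subset (r_subsets r n) (p n))
        {E. 1 / 2 * (p n * card B) \<le> \<bar>real (card (E \<inter> B)) - p n * card B\<bar>}"
    proof (rule measure_pmf.finite_measure_mono, clarify)
      fix E assume E: "E \<subseteq> r_subsets r n"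
        and small: "\<not> 1 / (2 * k) * p n * real n ^ (r - 1) \<le> real (ex_number ({..<n}, E) F)"
      have finE: "finite E" by (rule finite_subset[OF E finite_r_subsets])
      have "is_free F ({..<n}, E \<inter> B)" by (rule star_free[OF sub F(2,3)]) (auto simp: B_def)
      moreover have "subgraph ({..<n}, E \<inter> B) ({..<n}, E)"
        using E unfolding subgraph_def r_subsets_def by auto
      ultimately have "card (E \<inter> B) \<le> ex_number ({..<n}, E) F"
        using ex_number_ge[OF finE, of "({..<n}, E \<inter> B)"] by simp
      moreover have "1 / (2 * k) * p n * real n ^ (r - 1) = p n * w / 2" unfolding w_def by simp
      ultimately have "real (card (E \<inter> B)) \<le> p n * card B / 2" using small pw(2) by linarith
      then show "1 / 2 * (p n * card B) \<le> \<bar>real (card (E \<inter> B)) - p n * card B\<bar>" by linarith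
    qed simp
    also have "\<dots> \<le> 1 / ((1 / 2)\<^sup>2 * (p n * card B))"
      using p[of n] w B by (intro prob_deviation) auto
    also have "\<dots> = 4 * (1 / (p n * card B))" by (simp add: power2_eq_square)
    also have "\<dots> \<le> 4 * (1 / (p n * w))"
      using frac_le[OF _ order_refl pw, of 1] by (intro mult_left_mono) auto
    also have "\<dots> \<le> 4 * (k * (real n powr (- 1 / d) / p n))"
    proof (rule mult_left_mono)
      \<comment> \<open>Here \<open>1 / d \<le> r - 1\<close> turns the Chebyshev error, of order
        \<open>1 / (p * n ^ (r - 1))\<close>, into the ratio that vanishes by assumption.\<close>
      have "1 \<le> real n powr (real r - 1 + - 1 / d)" using elim d by (intro ge_one_powr_ge_zero) auto
      also have "\<dots> = real n ^ (r - 1) * real n powr (- 1 / d)"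
        unfolding powr_add using elim r by (simp add: powr_realpow[symmetric] of_nat_diff)
      finally have "1 / (p n * w) \<le> real n ^ (r - 1) * real n powr (- 1 / d) / (p n * w)"
        using pw by (intro divide_right_mono) auto
      also have "\<dots> = k * (real n powr (- 1 / d) / p n)"
        unfolding w_def using k elim by simp
      finally show "1 / (p n * w) \<le> k * (real n powr (- 1 / d) / p n)" .
    qed simp
    finally show ?case by simp
  qed
qed

text \<open>For a subgraph attaining the density, the orders \<open>n ^ v * p ^ e\<close> of copies
  and \<open>n ^ r * p\<close> of edges coincide exactly at \<open>p = n powr (- 1 / d)\<close>; one
  factor \<open>p\<close> is cancelled on both sides.\<close>

lemma power_density_identity:
  assumes e: "2 \<le> (e::nat)" and v: "r < (v::nat)" and d: "d = (real e - 1) / (real v - real r)" and n: "1 \<le> n"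
  shows "real n ^ v * (real n powr (- 1 / d)) ^ (e - 1) = real n ^ r"
proof -
  have "(real n powr (- 1 / d)) ^ (e - 1) = real n powr (- 1 / d * (real e - 1))"
    using n e by (simp add: powr_realpow[symmetric] powr_powr of_nat_diff)
  moreover have "- 1 / d * (real e - 1) = real r - real v" unfolding d using e v by (simp add: field_simps)
  ultimately have "real n ^ v * (real n powr (- 1 / d)) ^ (e - 1) = real n powr real v * real n powr (real r - real v)"
    using n by (simp add: powr_realpow)
  also have "\<dots> = real n ^ r" unfolding powr_add[symmetric] using n by (simp add: powr_realpow)
  finally show ?thesis .
qed

text \<open>Thinning lowers the density from \<open>p\<close> to slightly below
  \<open>n powr (- 1 / d)\<close>, where copies of the densest subgraph are rarer than edges. Markov
  with slack \<open>ln n\<close> controls the copies, and Chebyshev with at least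
  \<open>n / k\<close> expected edges controls the edges.\<close>

lemma ex_number_deletion_aas:
  assumes F: "r_graph r F" "subgraph F' F" "card (edges F') \<ge> 2" "r < card (verts F')"
    and d: "d = (real (card (edges F')) - 1) / (real (card (verts F')) - real r)" "1 / d \<le> real r - 1"
    and r: "1 \<le> r" and C: "C \<ge> 3" and p: "\<And>n. 0 < p n \<and> p n \<le> 1"
    and dense: "much_less (\<lambda>n. real n powr (- 1 / d)) p"
  shows "aas (\<lambda>n. random_r_graph r n (p n)) (\<lambda>n G.
    real n powr (real r - 1 / d) * ln (real n) powr (- C) \<le> real (ex_number G F))"
proof (rule aasI)
  define k where "k = real r ^ r"
  have k: "k > 0" unfolding k_def using r by simp
  define v where "v = card (verts F')"
  define e where "e = card (edges F')"
  have e: "e \<ge> 2" unfolding e_def by (rule F(3))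
  have ev_y: "\<forall>\<^sub>F n in sequentially. 4 * k + 1 \<le> ln (real n)" by real_asymp
  have ev_g: "\<forall>\<^sub>F n in sequentially. real n powr (- 1 / d) / p n < 1"
    using order_tendstoD(2)[OF dense[unfolded much_less_def]] by simp
  show "(\<lambda>n. 4 * k / real n + 1 / ln (real n)) \<longlonglongrightarrow> 0" by real_asymp
  show "\<forall>\<^sub>F n in sequentially. measure_pmf.prob (random_subset (r_subsets r n) (p n))
      {E. E \<subseteq> r_subsets r n \<and> \<not> real n powr (real r - 1 / d) * ln (real n) powr (- C) \<le> real (ex_number ({..<n}, E) F)}
      \<le> 4 * k / real n + 1 / ln (real n)"
    using ev_y ev_g eventually_ge_at_top[of "r + 2"]
  proof eventually_elim
    case (elim n)
    define y where "y = ln (real n)"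
    define g where "g = real n powr (- 1 / d)"
    define N where "N = card (r_subsets r n)"
    have y: "y \<ge> 1" "y \<ge> 4 * k" using elim(1) k unfolding y_def by auto
    have g: "g > 0" "g \<le> p n" unfolding g_def using elim p[of n] by (auto simp: field_simps)
    have pn: "p n > 0" "p n \<le> 1" using p[of n] by auto
    have n0: "real n > 0" using elim by simp
    have N: "real n ^ r / k \<le> real N" unfolding N_def card_r_subsets k_def using elim r by (intro choose_ge) auto
    have "real n ^ r / k > 0" using n0 k by simp
    then have N0: "N > 0" using N by linarith
    have gr: "g * real n ^ r = real n powr (real r - 1 / d)"
      unfolding g_def using n0 by (simp add: powr_realpow[symmetric] powr_add[symmetric])
    have id: "real n ^ v * g ^ (e - 1) = real n ^ r"
      unfolding g_def v_def e_def using elim by (intro power_density_identity F d) auto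
    define t where "t = y * (real n ^ v * p n ^ e)"
    have t: "t > 0" unfolding t_def using y n0 pn by simp
    let ?P = "measure_pmf.prob (random_subset (r_subsets r n) (p n))"
    let ?bad1 = "{E. 1 / 2 * (p n * card (r_subsets r n)) \<le> \<bar>real (card (E \<inter> r_subsets r n)) - p n * card (r_subsets r n)\<bar>}"
    let ?bad2 = "{E. t \<le> real (card {S \<in> potential_copies r n F'. S \<subseteq> E})}"
    have "?P {E. E \<subseteq> r_subsets r n \<and> \<not> real n powr (real r - 1 / d) * y powr (- C) \<le> real (ex_number ({..<n}, E) F)}
        \<le> ?P (?bad1 \<union> ?bad2)"
    proof (rule measure_pmf.finite_measure_mono, rule subsetI, rule ccontr)
      fix E assume E': "E \<in> {E. E \<subseteq> r_subsets r n \<and>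
          \<not> real n powr (real r - 1 / d) * y powr (- C) \<le> real (ex_number ({..<n}, E) F)}"
        and good: "E \<notin> ?bad1 \<union> ?bad2"
      then have E: "E \<subseteq> r_subsets r n" by simp
      have "\<bar>real (card E) - p n * N\<bar> < 1 / 2 * (p n * N)"
        using good E unfolding N_def by (simp add: Int_absorb2 not_le)
      then have big: "real (card E) \<ge> p n * N / 2" by linarith
      have few: "real (card {S \<in> potential_copies r n F'. S \<subseteq> E}) \<le> t" using good by auto
      \<comment> \<open>Thinning by \<open>s\<close> leaves density
        \<open>s * p = q = g / y ^ 2\<close>. Since \<open>e \<ge> 2\<close>, this saves a factor
        \<open>y ^ 2\<close> in the copies relative to the edges; Markov costs one \<open>y\<close>.
        What remains is at least \<open>q * n ^ r / y = g * n ^ r / y ^ 3\<close>, whence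
        \<open>C \<ge> 3\<close>.\<close>
      define s where "s = g / (y\<^sup>2 * p n)"
      define q where "q = g / y\<^sup>2"
      have y2: "y\<^sup>2 \<ge> 1" using y by simp
      have s: "0 \<le> s" "s \<le> 1"
      proof -
        show "0 \<le> s" unfolding s_def using g pn by simp
        have "g \<le> y\<^sup>2 * p n" using g(2) mult_right_mono[OF y2, of "p n"] pn by linarith
        moreover have "0 < y\<^sup>2 * p n" using y2 pn by (intro mult_pos_pos) linarith+
        ultimately show "s \<le> 1" unfolding s_def by (simp add: pos_divide_le_eq)
      qed
      have sp: "s * p n = q" unfolding s_def q_def using pn by simp
      have q: "q > 0" unfolding q_def using g y by simp
      have "s ^ e * real (card {S \<in> potential_copies r n F'. S \<subseteq> E}) \<le> s ^ e * t"
        using few s by (intro mult_left_mono) auto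
      also have "\<dots> = y * real n ^ v * q ^ e" unfolding t_def sp[symmetric] by (simp add: power_mult_distrib)
      also have "q ^ e = q * q ^ (e - 1)" using e by (cases e) auto
      also have "y * real n ^ v * (q * q ^ (e - 1)) \<le> y * real n ^ v * (q * (g ^ (e - 1) / y\<^sup>2))"
      proof (intro mult_left_mono)
        have "y\<^sup>2 \<le> (y\<^sup>2) ^ (e - 1)" using y2 e by (intro self_le_power) auto
        then show "q ^ (e - 1) \<le> g ^ (e - 1) / y\<^sup>2"
          unfolding q_def power_divide using g y2 by (intro divide_left_mono mult_pos_pos) auto
      qed (use q y in auto)
      also have "\<dots> = q * (real n ^ v * g ^ (e - 1)) / y" using y by (simp add: power2_eq_square)
      also have "\<dots> = q * real n ^ r / y" unfolding id ..
      finally have del: "s ^ e * real (card {S \<in> potential_copies r n F'. S \<subseteq> E}) \<le> q * real n ^ r / y" .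
      \<comment> \<open>Here \<open>y \<ge> 4 * k\<close> makes the thinned edges at least twice the
        bound on deleted ones.\<close>
      have "2 * (q * real n ^ r / y) \<le> q * (real n ^ r / k) / 2"
      proof -
        have "2 / y \<le> 1 / (2 * k)" using y k by (simp add: field_simps)
        then have "(q * real n ^ r) * (2 / y) \<le> (q * real n ^ r) * (1 / (2 * k))"
          using q by (intro mult_left_mono) auto
        then show ?thesis by simp
      qed
      also have "\<dots> \<le> q * real N / 2" using N q by (intro divide_right_mono mult_left_mono) auto
      also have "\<dots> = s * (p n * N / 2)" using sp by simp
      also have "\<dots> \<le> s * real (card E)" using big s by (intro mult_left_mono) auto
      finally have half: "2 * (q * real n ^ r / y) \<le> s * real (card E)" .
      have "a \<le> b - c" if "2 * a \<le> b" "c \<le> a" for a b c :: real using that by linarith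
      from this[OF half del]
      have "q * real n ^ r / y \<le> s * real (card E) - s ^ e * real (card {S \<in> potential_copies r n F'. S \<subseteq> E})" .
      also have "\<dots> \<le> real (ex_number ({..<n}, E) F)"
        unfolding e_def using F(3) by (intro ex_number_ge_deletion F(1,2) E s) auto
      finally have "q * real n ^ r / y \<le> real (ex_number ({..<n}, E) F)" .
      moreover have "real n powr (real r - 1 / d) * y powr (- C) \<le> q * real n ^ r / y"
      proof -
        have "y powr (- C) \<le> y powr (- 3)" using y C by (intro powr_mono) auto
        also have "\<dots> = 1 / y ^ 3" using y by (simp add: powr_minus powr_numeral divide_inverse)
        finally have "g * real n ^ r * y powr (- C) \<le> g * real n ^ r * (1 / y ^ 3)"
          using g by (intro mult_left_mono) auto
        then show ?thesis unfolding gr q_def by (simp add: power2_eq_square power3_eq_cube gr[symmetric])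
      qed
      ultimately show False using E' by simp
    qed simp
    also have "\<dots> \<le> ?P ?bad1 + ?P ?bad2" by (rule measure_Un_le) auto
    also have "\<dots> \<le> 4 * k / real n + 1 / y"
    proof (rule add_mono)
      have "?P ?bad1 \<le> 1 / ((1 / 2)\<^sup>2 * (p n * card (r_subsets r n)))"
        using pn N0 unfolding N_def by (intro prob_deviation) auto
      also have "\<dots> = 4 / (p n * N)" unfolding N_def by (simp add: power2_eq_square)
      also have "\<dots> \<le> 4 / (real n / k)"
      proof (rule divide_left_mono)
        have "real n = real n powr 1" using n0 by simp
        also have "\<dots> \<le> real n powr (real r - 1 / d)" using d(2) elim by (intro powr_mono) auto
        finally have "real n / k \<le> g * real n ^ r / k" unfolding gr using k by (intro divide_right_mono) auto
        also have "\<dots> \<le> p n * (real n ^ r / k)" using mult_right_mono[OF g(2), of "real n ^ r / k"] k by simp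
        also have "\<dots> \<le> p n * N" using N pn by (intro mult_left_mono) auto
        finally show "real n / k \<le> p n * N" .
      qed (use pn N0 n0 k in auto)
      finally show "?P ?bad1 \<le> 4 * k / real n" by simp
      have "?P ?bad2 \<le> real n ^ card (verts F') * p n ^ card (edges F') / t"
        using pn t by (intro prob_many_copies r_graph_subgraph[OF F(1,2)]) auto
      also have "\<dots> = 1 / y" unfolding t_def v_def e_def using n0 pn by simp
      finally show "?P ?bad2 \<le> 1 / y" .
    qed
    finally show ?case unfolding y_def .
  qed
qed

text \<open>Below \<open>n powr (- 1 / d)\<close> the copies of the densest subgraph are a vanishing
  fraction of the edges, so deletion without thinning keeps almost everything; from above, the
  number of edges itself is the bound.\<close>

lemma ex_number_sparse_aas:
  assumes F: "r_graph r F" "subgraph F' F" "card (edges F') \<ge> 2" "r < card (verts F')"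
    and d: "d = (real (card (edges F')) - 1) / (real (card (verts F')) - real r)"
    and r: "1 \<le> r" and p: "\<And>n. 0 < p n \<and> p n \<le> 1"
    and lower: "much_less (\<lambda>n. real n powr (- real r)) p" and upper: "much_less p (\<lambda>n. real n powr (- 1 / d))"
  shows "\<exists>\<delta> :: nat \<Rightarrow> real. \<delta> \<longlonglongrightarrow> 0 \<and> aas (\<lambda>n. random_r_graph r n (p n))
    (\<lambda>n G. \<bar>real (ex_number G F) - p n * real (n choose r)\<bar> \<le> \<delta> n * (p n * real (n choose r)))"
proof -
  define k where "k = real r ^ r"
  have k: "k > 0" unfolding k_def using r by simp
  define v where "v = card (verts F')"
  define e where "e = card (edges F')"
  have e: "e \<ge> 2" unfolding e_def by (rule F(3))
  have neF: "edges F \<noteq> {}" using F(2,3) unfolding subgraph_def by auto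
  define g where "g n = real n powr (- 1 / d)" for n :: nat
  \<comment> \<open>A lower bound for the expected number of edges, unbounded because
    \<open>p\<close> is far above \<open>n powr (- r)\<close>.\<close>
  define h where "h n = p n * real n ^ r / k" for n
  \<comment> \<open>Chebyshev then fails with probability at most
    \<open>1 / (\<delta>1 ^ 2 * h) = h powr (- 1 / 2)\<close>, so error and failure probability
    vanish together.\<close>
  define \<delta>1 where "\<delta>1 n = h n powr (- 1 / 4)" for n
  \<comment> \<open>The expected number of copies is at most \<open>\<delta>2 ^ 2\<close> times that
    of edges, so Markov at level \<open>\<delta>2\<close> fails with probability at most
    \<open>\<delta>2\<close>.\<close>
  define \<delta>2 where "\<delta>2 n = sqrt (k * (p n / g n) ^ (e - 1))" for n
  have h_top: "filterlim h at_top sequentially"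
  proof -
    have "(\<lambda>n. real n powr (- real r) / p n * k) \<longlonglongrightarrow> 0"
      using tendsto_mult_left_zero[OF lower[unfolded much_less_def], of k] .
    moreover have "\<forall>\<^sub>F n in sequentially. 0 < real n powr (- real r) / p n * k"
      using eventually_ge_at_top[of 1] by eventually_elim (use p k in simp)
    ultimately have "filterlim (\<lambda>n. inverse (real n powr (- real r) / p n * k)) at_top sequentially"
      by (rule filterlim_inverse_at_top)
    moreover have "\<forall>\<^sub>F n in sequentially. inverse (real n powr (- real r) / p n * k) = h n"
      using eventually_ge_at_top[of 1]
      by eventually_elim (simp add: h_def powr_minus powr_realpow field_simps)
    ultimately show ?thesis by (rule filterlim_cong[THEN iffD1, rotated -1, OF _ refl refl])
  qed
  have \<delta>1: "\<delta>1 \<longlonglongrightarrow> 0" unfolding \<delta>1_def by (rule tendsto_neg_powr[OF _ h_top]) simp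
  have \<delta>1': "(\<lambda>n. h n powr (- 1 / 2)) \<longlonglongrightarrow> 0" by (rule tendsto_neg_powr[OF _ h_top]) simp
  have \<delta>2: "\<delta>2 \<longlonglongrightarrow> 0"
  proof -
    have "(\<lambda>n. (p n / g n) ^ (e - 1)) \<longlonglongrightarrow> 0 ^ (e - 1)"
      using upper unfolding much_less_def g_def by (rule tendsto_power)
    moreover have "(0 :: real) ^ (e - 1) = 0" using e by (simp add: power_0_left)
    ultimately have "(\<lambda>n. (p n / g n) ^ (e - 1)) \<longlonglongrightarrow> 0" by (simp only:)
    then have "(\<lambda>n. k * (p n / g n) ^ (e - 1)) \<longlonglongrightarrow> 0" by (rule tendsto_mult_right_zero)
    from tendsto_real_sqrt[OF this] show ?thesis unfolding \<delta>2_def by simp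
  qed
  have lim: "(\<lambda>n. \<delta>1 n + \<delta>2 n) \<longlonglongrightarrow> 0" using tendsto_add[OF \<delta>1 \<delta>2] by simp
  have "aas (\<lambda>n. random_r_graph r n (p n))
    (\<lambda>n G. \<bar>real (ex_number G F) - p n * real (n choose r)\<bar> \<le> (\<delta>1 n + \<delta>2 n) * (p n * real (n choose r)))"
  proof (rule aasI)
    show "(\<lambda>n. h n powr (- 1 / 2) + \<delta>2 n) \<longlonglongrightarrow> 0" using tendsto_add[OF \<delta>1' \<delta>2] by simp
    show "\<forall>\<^sub>F n in sequentially. measure_pmf.prob (random_subset (r_subsets r n) (p n))
      {E. E \<subseteq> r_subsets r n \<and> \<not> \<bar>real (ex_number ({..<n}, E) F) - p n * real (n choose r)\<bar>
          \<le> (\<delta>1 n + \<delta>2 n) * (p n * real (n choose r))} \<le> h n powr (- 1 / 2) + \<delta>2 n"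
      using eventually_ge_at_top[of "r + 2"]
    proof eventually_elim
      case (elim n)
      have pn: "p n > 0" "p n \<le> 1" using p[of n] by auto
      have n0: "real n > 0" using elim by simp
      define N where "N = n choose r"
      have N: "real n ^ r / k \<le> real N" unfolding N_def k_def using elim r by (intro choose_ge) auto
      have "real n ^ r / k > 0" using n0 k by simp
      then have N0: "real N > 0" using N by linarith
      have pN: "p n * N > 0" using pn N0 by simp
      have hpos: "h n > 0" unfolding h_def using pn n0 k by simp
      have hN: "h n \<le> p n * N" unfolding h_def using mult_left_mono[OF N, of "p n"] pn by simp
      have gpos: "g n > 0" unfolding g_def using n0 by simp
      have d1: "\<delta>1 n > 0" unfolding \<delta>1_def using hpos by simp
      have d2: "\<delta>2 n > 0" unfolding \<delta>2_def using k pn gpos by simp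
      have id: "real n ^ v * g n ^ (e - 1) = real n ^ r"
        unfolding g_def v_def e_def using elim by (intro power_density_identity F d) auto
      let ?P = "measure_pmf.prob (random_subset (r_subsets r n) (p n))"
      let ?bad1 = "{E. \<delta>1 n * (p n * card (r_subsets r n)) \<le> \<bar>real (card (E \<inter> r_subsets r n)) - p n * card (r_subsets r n)\<bar>}"
      let ?bad2 = "{E. \<delta>2 n * (p n * N) \<le> real (card {S \<in> potential_copies r n F'. S \<subseteq> E})}"
      have "?P {E. E \<subseteq> r_subsets r n \<and> \<not> \<bar>real (ex_number ({..<n}, E) F) - p n * real N\<bar>
          \<le> (\<delta>1 n + \<delta>2 n) * (p n * real N)} \<le> ?P (?bad1 \<union> ?bad2)"
      proof (rule measure_pmf.finite_measure_mono, rule subsetI, rule ccontr)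
        fix E assume E': "E \<in> {E. E \<subseteq> r_subsets r n \<and> \<not> \<bar>real (ex_number ({..<n}, E) F) - p n * real N\<bar>
          \<le> (\<delta>1 n + \<delta>2 n) * (p n * real N)}" and good: "E \<notin> ?bad1 \<union> ?bad2"
        then have E: "E \<subseteq> r_subsets r n" by simp
        have finE: "finite E" by (rule finite_subset[OF E finite_r_subsets])
        have near: "\<bar>real (card E) - p n * N\<bar> < \<delta>1 n * (p n * N)"
          using good E unfolding N_def card_r_subsets by (simp add: Int_absorb2 not_le)
        have few: "real (card {S \<in> potential_copies r n F'. S \<subseteq> E}) < \<delta>2 n * (p n * N)"
          using good by (simp add: not_le)
        have "ex_number ({..<n}, E) F \<le> card E" by (rule ex_number_le_card[OF finE neF])
        moreover have "real (card E) - real (card {S \<in> potential_copies r n F'. S \<subseteq> E}) \<le> real (ex_number ({..<n}, E) F)"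
          using ex_number_ge_deletion[OF F(1,2) _ E, of 1] F(3) by simp
        moreover have "0 < \<delta>2 n * (p n * N)" using d2 pN by simp
        ultimately have "\<bar>real (ex_number ({..<n}, E) F) - p n * real N\<bar> \<le> (\<delta>1 n + \<delta>2 n) * (p n * real N)"
          using near few unfolding distrib_right by linarith
        then show False using E' by simp
      qed simp
      also have "\<dots> \<le> ?P ?bad1 + ?P ?bad2" by (rule measure_Un_le) auto
      also have "\<dots> \<le> h n powr (- 1 / 2) + \<delta>2 n"
      proof (rule add_mono)
        have "?P ?bad1 \<le> 1 / ((\<delta>1 n)\<^sup>2 * (p n * card (r_subsets r n)))"
          using pn N0 d1 unfolding N_def card_r_subsets[symmetric] by (intro prob_deviation) auto
        also have "\<dots> = 1 / ((\<delta>1 n)\<^sup>2 * (p n * N))" unfolding N_def card_r_subsets ..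
        also have "\<dots> \<le> 1 / ((\<delta>1 n)\<^sup>2 * h n)"
          using hN hpos d1 by (intro frac_le mult_left_mono mult_pos_pos) auto
        also have "(\<delta>1 n)\<^sup>2 = h n powr (- 1 / 2)"
          unfolding \<delta>1_def using hpos by (simp add: powr_realpow[symmetric] powr_powr powr_power)
        also have "1 / (h n powr (- 1 / 2) * h n) = h n powr (- 1 / 2)"
        proof -
          have "h n powr (- 1 / 2) * (h n powr (- 1 / 2) * h n powr 1) = 1"
            unfolding powr_add[symmetric] using hpos by simp
          then show ?thesis using hpos by (simp add: field_simps)
        qed
        finally show "?P ?bad1 \<le> h n powr (- 1 / 2)" .
        have "?P ?bad2 \<le> real n ^ card (verts F') * p n ^ card (edges F') / (\<delta>2 n * (p n * N))"
          using pn d2 pN by (intro prob_many_copies r_graph_subgraph[OF F(1,2)]) auto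
        also have "\<dots> = real n ^ v * p n ^ (e - 1) / N / \<delta>2 n"
        proof -
          have "p n ^ e = p n * p n ^ (e - 1)" using e by (cases e) auto
          then show ?thesis unfolding v_def[symmetric] e_def[symmetric] using pn by simp
        qed
        also have "\<dots> \<le> (\<delta>2 n)\<^sup>2 / \<delta>2 n"
        proof (rule divide_right_mono)
          have "real n ^ v * p n ^ (e - 1) / N \<le> real n ^ v * p n ^ (e - 1) / (real n ^ r / k)"
            using N n0 k pn N0 by (intro divide_left_mono) auto
          also have "\<dots> = k * (p n ^ (e - 1) / g n ^ (e - 1))"
            unfolding id[symmetric] using n0 gpos by (simp add: field_simps)
          also have "\<dots> = (\<delta>2 n)\<^sup>2" unfolding \<delta>2_def using k pn gpos by (simp add: power_divide)
          finally show "real n ^ v * p n ^ (e - 1) / N \<le> (\<delta>2 n)\<^sup>2" .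
        qed (use d2 in simp)
        also have "\<dots> = \<delta>2 n" using d2 by (simp add: power2_eq_square)
        finally show "?P ?bad2 \<le> \<delta>2 n" .
      qed
      finally show ?case unfolding N_def .
    qed
  qed
  with lim show ?thesis by blast
qed

section \<open>Assembling the bounds\<close>

theorem theorem2p9:
  fixes F :: "'a hypergraph" and r0 :: nat
  assumes "r_graph r0 F"
    and "2 \<le> max_degree F" and "max_degree F < card (edges F)"
    and "\<exists>T. tight_tree r0 T \<and> spanning_subgraph F T"
    and "\<exists>C0 :: real. C0 > 0 \<and>
           balanced r0 F
             (\<lambda>n. C0 * real n ^ (r0 - 1))
             (\<lambda>n. ln (real n) powr C0)
             (\<lambda>n m. real n powr (real r0 - 1 / r_density r0 F) * ln (real n) powr C0)"
  shows "\<forall>r\<ge>r0. \<exists>c>0. \<exists>C>0. \<forall>p :: nat \<Rightarrow> real. (\<forall>n. 0 < p n \<and> p n \<le> 1) \<longrightarrow>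
    (let Fr = expansion r0 r F; d = r_density r Fr in
      (much_less (\<lambda>n. real n powr (- 1 / d)) p \<longrightarrow>
         aas (\<lambda>n. random_r_graph r n (p n))
           (\<lambda>n G.
              max (c * p n * real n ^ (r - 1))
                  (real n powr (real r - 1 / d) * ln (real n) powr (- C))
                \<le> real (ex_number G Fr) \<and>
              real (ex_number G Fr)
                \<le> max (C * p n * real n ^ (r - 1))
                      (real n powr (real r - 1 / d) * ln (real n) powr C)))
      \<and>
      (much_less (\<lambda>n. real n powr (- real r)) p \<and>
       much_less p (\<lambda>n. real n powr (- 1 / d)) \<longrightarrow>
         (\<exists>\<delta> :: nat \<Rightarrow> real. \<delta> \<longlonglongrightarrow> 0 \<and>
            aas (\<lambda>n. random_r_graph r n (p n))
              (\<lambda>n G. \<bar>real (ex_number G Fr) - p n * real (n choose r)\<bar>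
                        \<le> \<delta> n * (p n * real (n choose r))))))"
  proof (intro allI impI)
  fix r assume r: "r0 \<le> r"
  note F = assms(1)
  have finV: "finite (verts F)" and finF: "finite (edges F)" and sub: "\<forall>e\<in>edges F. e \<subseteq> verts F"
    using F finite_edges[OF F] unfolding r_graph_def by auto
  have three: "card (edges F) \<ge> 3" using assms(2,3) by linarith
  have "verts F \<noteq> {}"
  proof
    assume "verts F = {}"
    then have "card (edges F) \<le> card {{} :: 'a set}" using sub by (intro card_mono) auto
    then show False using three by simp
  qed
  then have "max_degree F \<in> {card {e \<in> edges F. v \<in> e} |v. v \<in> verts F}"
    unfolding max_degree_def using finV by (intro Max_in) auto
  then obtain x where x: "card {e \<in> edges F. x \<in> e} \<ge> 2" using assms(2) by auto
  then obtain e1 e2 where e12: "e1 \<in> edges F" "e2 \<in> edges F" "e1 \<noteq> e2" "x \<in> e1" "x \<in> e2"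
    using card_le_Suc0_iff_eq[of "{e \<in> edges F. x \<in> e}"] finF by fastforce
  have "finite e1" using e12(1) sub finV by (meson finite_subset)
  then have "card e1 \<noteq> 0" using e12(4) by (auto simp: card_eq_0_iff)
  then have r0: "1 \<le> r0" using e12 F unfolding r_graph_def by auto
  define Fr where "Fr = expansion r0 r F"
  define d where "d = r_density r Fr"
  have Fr: "r_graph r Fr" unfolding Fr_def by (rule r_graph_expansion[OF F r])
  have subFr: "\<forall>e\<in>edges Fr. e \<subseteq> verts Fr" using Fr unfolding r_graph_def by blast
  have cardFr: "card (edges Fr) = card (edges F)" unfolding Fr_def by (rule card_edges_expansion)
  then have neFr: "edges Fr \<noteq> {}" using three by auto
  have d_le: "1 / d \<le> real r - 1"
    unfolding d_def
  proof (rule r_density_two_edges[OF Fr])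
    show "expand_edge r0 r e1 \<in> edges Fr" "expand_edge r0 r e2 \<in> edges Fr"
      unfolding Fr_def edges_expansion using e12 by auto
    show "expand_edge r0 r e1 \<noteq> expand_edge r0 r e2"
      using inj_expand_edge[of r0 r UNIV] e12(3) by (auto simp: inj_on_def)
    show "Inl x \<in> expand_edge r0 r e1 \<inter> expand_edge r0 r e2"
      unfolding expand_edge_def using e12 by auto
  qed
  \<comment> \<open>An old vertex misses an edge because
    \<open>max_degree F < card (edges F)\<close>; a new vertex lies only in the expansion of the
    edge it was created for.\<close>
  have no_centre: "\<forall>u\<in>verts Fr. \<exists>e\<in>edges Fr. u \<notin> e"
  proof
    fix u assume u: "u \<in> verts Fr"
    show "\<exists>e\<in>edges Fr. u \<notin> e"
    proof (cases u)
      case (Inl v)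
      then have "v \<in> verts F" using u unfolding Fr_def verts_expansion by auto
      then have deg: "card {e \<in> edges F. v \<in> e} \<le> max_degree F"
        unfolding max_degree_def using finV by (intro Max_ge) auto
      have "{e \<in> edges F. v \<in> e} \<noteq> edges F"
      proof
        assume "{e \<in> edges F. v \<in> e} = edges F"
        then have "card (edges F) \<le> max_degree F" using deg by (simp only:)
        then show False using assms(3) by simp
      qed
      then obtain e where e: "e \<in> edges F" "v \<notin> e" by blast
      have "expand_edge r0 r e \<in> edges Fr" unfolding Fr_def edges_expansion using e(1) by (rule imageI)
      moreover have "u \<notin> expand_edge r0 r e" unfolding Inl expand_edge_def using e(2) by auto
      ultimately show ?thesis by (rule bexI[rotated])
    next
      case (Inr y)
      have "\<not> edges F \<subseteq> {fst y}"
      proof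
        assume "edges F \<subseteq> {fst y}"
        then have "card (edges F) \<le> card {fst y}" by (intro card_mono) auto
        then show False using three by simp
      qed
      then obtain e where e: "e \<in> edges F" "e \<noteq> fst y" by blast
      have "expand_edge r0 r e \<in> edges Fr" unfolding Fr_def edges_expansion using e(1) by (rule imageI)
      moreover have "u \<notin> expand_edge r0 r e" unfolding Inr expand_edge_def using e(2) by auto
      ultimately show ?thesis by (rule bexI[rotated])
    qed
  qed
  obtain F' where F': "subgraph F' Fr" "card (edges F') \<ge> 2" "r < card (verts F')"
    "d = (real (card (edges F')) - 1) / (real (card (verts F')) - real r)"
    unfolding d_def by (rule r_density_attained[OF Fr]) (use cardFr three in auto)
  obtain C0 where C0: "C0 > 0" "balanced r0 F (\<lambda>n. C0 * real n ^ (r0 - 1)) (\<lambda>n. ln (real n) powr C0)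
      (\<lambda>n m. real n powr (real r0 - 1 / r_density r0 F) * ln (real n) powr C0)"
    using assms(5) by blast
  have neF: "edges F \<noteq> {}" using three by auto
  have two: "card (edges F) \<ge> 2" using three by simp
  \<comment> \<open>The lift keeps the exponent \<open>r0 - 1 / r_density r0 F\<close>, and the
    density inequality allows replacing it by the larger \<open>r - 1 / d\<close>.\<close>
  have "eventually_spread r0 F (real r - 1 / d) r"
    using eventually_spread_expansion[OF F neF r0 eventually_spread_base[OF F C0] r]
      r_density_expansion[OF F two r] unfolding d_def Fr_def by (rule eventually_spread_mono)
  then obtain C1 B where CB: "C1 > 0" "B > 0" "\<forall>\<^sub>F n in sequentially. \<forall>E \<subseteq> r_subsets r n. E \<noteq> {} \<longrightarrow>
      C1 * real n ^ (r - 1) \<le> real (card E) \<longrightarrow>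
      spread Fr n E (ln (real n) powr B) (real n powr (real r - 1 / d) * ln (real n) powr B)"
    unfolding eventually_spread_def Fr_def by blast
  have r1: "1 \<le> r" and a: "real r - 1 / d > 0" using r0 r d_le by auto
  obtain D R where DR: "D > 0" "R > 0" "\<forall>\<^sub>F n in sequentially. \<exists>Q.
      real Q \<le> exp (real n powr (real r - 1 / d) * ln (real n) powr D) \<and>
      covered_by (r_subsets r n) (\<lambda>I. is_free Fr ({..<n}, I)) Q (R * real n ^ (r - 1))"
    using free_graph_containers[OF subFr r1 a CB] by blast
  \<comment> \<open>The 3 is for the logarithms lost in deletion, \<open>D\<close> for the number of
    containers, and \<open>exp 3 * R\<close> for their size.\<close>
  define C where "C = max 3 (max D (exp 3 * R))"
  have C: "C \<ge> 3" "C \<ge> D" "C \<ge> exp 3 * R" "C > 0" unfolding C_def by auto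
  \<comment> \<open>Half of the constant in the lower bound for the size of a star.\<close>
  define c where "c = 1 / (2 * (2 * real r) ^ (r - 1))"
  have c: "c > 0" unfolding c_def using r1 by simp
  show "\<exists>c>0. \<exists>C>0. \<forall>p :: nat \<Rightarrow> real. (\<forall>n. 0 < p n \<and> p n \<le> 1) \<longrightarrow>
    (let Fr = expansion r0 r F; d = r_density r Fr in
      (much_less (\<lambda>n. real n powr (- 1 / d)) p \<longrightarrow>
         aas (\<lambda>n. random_r_graph r n (p n))
           (\<lambda>n G.
              max (c * p n * real n ^ (r - 1))
                  (real n powr (real r - 1 / d) * ln (real n) powr (- C))
                \<le> real (ex_number G Fr) \<and>
              real (ex_number G Fr)
                \<le> max (C * p n * real n ^ (r - 1))
                      (real n powr (real r - 1 / d) * ln (real n) powr C)))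
      \<and>
      (much_less (\<lambda>n. real n powr (- real r)) p \<and>
       much_less p (\<lambda>n. real n powr (- 1 / d)) \<longrightarrow>
         (\<exists>\<delta> :: nat \<Rightarrow> real. \<delta> \<longlonglongrightarrow> 0 \<and>
            aas (\<lambda>n. random_r_graph r n (p n))
              (\<lambda>n G. \<bar>real (ex_number G Fr) - p n * real (n choose r)\<bar>
                        \<le> \<delta> n * (p n * real (n choose r))))))"
  proof (rule exI[of _ c], rule conjI, rule c, rule exI[of _ C], rule conjI, rule C(4), intro allI impI)
    fix p :: "nat \<Rightarrow> real" assume "\<forall>n. 0 < p n \<and> p n \<le> 1"
    then have p: "\<And>n. 0 < p n \<and> p n \<le> 1" by blast
    show "let Fr = expansion r0 r F; d = r_density r Fr in
      (much_less (\<lambda>n. real n powr (- 1 / d)) p \<longrightarrow>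
         aas (\<lambda>n. random_r_graph r n (p n))
           (\<lambda>n G.
              max (c * p n * real n ^ (r - 1))
                  (real n powr (real r - 1 / d) * ln (real n) powr (- C))
                \<le> real (ex_number G Fr) \<and>
              real (ex_number G Fr)
                \<le> max (C * p n * real n ^ (r - 1))
                      (real n powr (real r - 1 / d) * ln (real n) powr C)))
      \<and>
      (much_less (\<lambda>n. real n powr (- real r)) p \<and>
       much_less p (\<lambda>n. real n powr (- 1 / d)) \<longrightarrow>
         (\<exists>\<delta> :: nat \<Rightarrow> real. \<delta> \<longlonglongrightarrow> 0 \<and>
            aas (\<lambda>n. random_r_graph r n (p n))
              (\<lambda>n G. \<bar>real (ex_number G Fr) - p n * real (n choose r)\<bar>
                        \<le> \<delta> n * (p n * real (n choose r)))))"
      unfolding Let_def Fr_def[symmetric] d_def[symmetric]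
    proof (intro conjI impI)
      assume dense: "much_less (\<lambda>n. real n powr (- 1 / d)) p"
      show "aas (\<lambda>n. random_r_graph r n (p n)) (\<lambda>n G.
          max (c * p n * real n ^ (r - 1)) (real n powr (real r - 1 / d) * ln (real n) powr (- C))
            \<le> real (ex_number G Fr) \<and>
          real (ex_number G Fr)
            \<le> max (C * p n * real n ^ (r - 1)) (real n powr (real r - 1 / d) * ln (real n) powr C))"
        unfolding max.bounded_iff c_def
        by (intro aas_conj ex_number_star_aas[OF Fr neFr no_centre r1 d_le p dense]
            ex_number_deletion_aas[OF Fr F' d_le r1 C(1) p dense]
            ex_number_upper_aas[OF Fr neFr a DR(3,1,2) C(2,3) p])
    next
      assume "much_less (\<lambda>n. real n powr (- real r)) p \<and> much_less p (\<lambda>n. real n powr (- 1 / d))"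
      then have "much_less (\<lambda>n. real n powr (- real r)) p" "much_less p (\<lambda>n. real n powr (- 1 / d))" by blast+
      then show "\<exists>\<delta> :: nat \<Rightarrow> real. \<delta> \<longlonglongrightarrow> 0 \<and> aas (\<lambda>n. random_r_graph r n (p n))
          (\<lambda>n G. \<bar>real (ex_number G Fr) - p n * real (n choose r)\<bar> \<le> \<delta> n * (p n * real (n choose r)))"
        by (rule ex_number_sparse_aas[where p = p, OF Fr F' r1 p])
    qed
  qed
qed

end
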